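(* Let $G=(V,E)$ be a locally finite, connected, transitive, transient infinite simple graph, $\Gamma=\mathrm{Aut}(G)$. Suppose there exists a measure $Q$ on $(W,\mathcal{W})$ such that (i) $\nu(A)=Q((\pi^* )^{-1}(A))$ for all $A\in\mathcal{W}^*$, and (ii) $Q(B)=Q(\varphi(B))$ for all $B\in\mathcal{W}$ and all $\varphi\in\Gamma$, where $\nu$ is the interlacement intensity measure on $(W^*,\mathcal{W}^* )$. Then (a) the Poisson point process $\mathcal{Z}^W=\sum_{i\in I}\delta_{(w_i,t_i)}$ on $W\times\mathbb{R}_+$ with intensity measure $Q\times\lambda$ is a factor of i.i.d.; (b) $\mathcal{Z}:=\sum_{i\in I}\delta_{(\pi^*(w_i),t_i)}$ is a Poisson point process on $W^*\times\mathbb{R}_+$ with intensity measure $\nu\times\lambda$, and $\mathcal{Z}$ is also a factor of i.i.d.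
   Context: $\lambda$ is Lebesgue measure on $\mathbb{R}_+$. $G$ is transitive if $\Gamma$ acts transitively on $V$; transient if simple random walk on $G$ is transient. $K\subset\subset V$ means $K$ is a finite subset of $V$. Trajectories: $W$ is the set of $w:\mathbb{Z}\to V$ with $\{w(n),w(n+1)\}\in E$ for all $n$ and such that each vertex is visited only finitely many times; $\mathcal{W}$ is the $\sigma$-algebra on $W$ generated by the coordinate maps. $w,w'\in W$ are time-shift equivalent if for some $k\in\mathbb{Z}$, $w(n)=w'(n+k)$ for all $n$. $W^*$ is the set of equivalence classes, $\pi^*:W\to W^*$ the quotient map, $\mathcal{W}^*=\{A\subseteq W^*:(\pi^* )^{-1}(A)\in\mathcal{W}\}$. $W(K)$, $W^*(K)$ are the subsets of trajectories (classes) that visit $K$. Interlacement intensity measure: $P_x^{\pm}$ is the law on $(W,\mathcal{W})$ of a doubly infinite simple random walk $(X(n))_{n\in\mathbb{Z}}$ with $X(0)=x$ (forward path and time-reversed backward path are independent simple random walks from $x$). For $w$ visiting $K$, $H_K(w)=\min\{n:w(n)\in K\}$. $\nu$ is the unique $\sigma$-finite measure on $(W^*,\mathcal{W}^* )$ such that for all $A\in\mathcal{W}^*$ and all $K\subset\subset V$, $\nu(A\cap W^*(K))=Q_K((\pi^* )^{-1}(A))$, where $Q_K(B)=\sum_{x\in K}P_x^{\pm}(B,\,H_K=0)$ for $B\in\mathcal{W}$ (existence and uniqueness of $\nu$ are known). Factor of i.i.d.: a random element with law $\kappa$ of a measurable space $\Omega_2$ on which $\Gamma$ acts is a factor of i.i.d.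 if there are a probability space $(\Omega,\mathcal{A},\vartheta)$ and a measurable map $T:\Omega^V\to\Omega_2$ such that $T(\varphi(\underline\eta))=\varphi(T(\underline\eta))$ for all $\varphi\in\Gamma$, $\underline\eta\in\Omega^V$, where $\varphi(\underline\eta)=(\eta_{\varphi^{-1}(x)})_{x\in V}$, and $T(\underline\eta)$ has law $\kappa$ when $(\eta_x)_{x\in V}$ are i.i.d. with law $\vartheta$. Here $\Omega_2$ is the space of point measures $\omega$ on $W\times\mathbb{R}_+$ (resp. $W^*\times\mathbb{R}_+$) with $\omega(W(\{x\})\times[0,t])<\infty$ (resp. $\omega(W^*(\{x\})\times[0,t])<\infty$) for all $x\in V,t\ge 0$, with the usual $\sigma$-algebra, and $\Gamma$ acts by $\varphi(w)=(\varphi(w(n)))_n$, $\varphi(\pi^*(w))=\pi^*(\varphi(w))$, $\varphi(\sum_i\delta_{(w_i,t_i)})=\sum_i\delta_{(\varphi(w_i),t_i)}$. *)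

theory Defs
  imports "HOL-Probability.Probability"
begin

text \<open>
  The vertex set \<open>V\<close> is the whole type \<open>'v\<close>, so that a graph is given by its
  edge set \<open>E\<close>, a set of unordered pairs.
\<close>

definition simple_graph :: "'v set set \<Rightarrow> bool" where
  "simple_graph E \<longleftrightarrow> (\<forall>e\<in>E. card e = 2)"

definition nbrs :: "'v set set \<Rightarrow> 'v \<Rightarrow> 'v set" where
  "nbrs E x = {y. {x, y} \<in> E}"

definition locally_finite_graph :: "'v set set \<Rightarrow> bool" where
  "locally_finite_graph E \<longleftrightarrow> (\<forall>x. finite (nbrs E x))"

definition connected_graph :: "'v set set \<Rightarrow> bool" where
  "connected_graph E \<longleftrightarrow> (\<forall>x y. (x, y) \<in> {(u, v). {u, v} \<in> E}\<^sup>*)"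

definition graph_Aut :: "'v set set \<Rightarrow> ('v \<Rightarrow> 'v) set" where
  "graph_Aut E = {\<phi>. bij \<phi> \<and> (\<forall>x y. {\<phi> x, \<phi> y} \<in> E \<longleftrightarrow> {x, y} \<in> E)}"

definition transitive_graph :: "'v set set \<Rightarrow> bool" where
  "transitive_graph E \<longleftrightarrow> (\<forall>x y. \<exists>\<phi>\<in>graph_Aut E. \<phi> x = y)"

text \<open>The law of the \<open>n\<close>-th position given the positions at times \<open>0, \<dots>, n - 1\<close>.\<close>

definition srw_kernel :: "'v set set \<Rightarrow> 'v \<Rightarrow> nat \<Rightarrow> (nat \<Rightarrow> 'v) \<Rightarrow> 'v measure" where
  "srw_kernel E x n X =
    (if n = 0 then return (count_space UNIV) x
     else measure_pmf (pmf_of_set (nbrs E (X (n - 1)))))"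

text \<open>
  The law on sequences obtained from these kernels by the Ionescu-Tulcea theorem:
  \<^const>\<open>Ionescu_Tulcea.CI\<close> is the family of finite-dimensional distributions.
\<close>

definition srw :: "'v set set \<Rightarrow> 'v \<Rightarrow> (nat \<Rightarrow> 'v) measure" where
  "srw E x =
    projective_family.lim UNIV
      (Ionescu_Tulcea.CI (srw_kernel E x) (\<lambda>_. count_space UNIV)) (\<lambda>_. count_space UNIV)"

definition transient_graph :: "'v set set \<Rightarrow> bool" where
  "transient_graph E \<longleftrightarrow> (\<forall>x. measure (srw E x) {X \<in> space (srw E x). \<exists>n\<ge>1. X n = x} < 1)"

definition traj :: "'v set set \<Rightarrow> (int \<Rightarrow> 'v) set" where
  "traj E = {w. (\<forall>n. {w n, w (n + 1)} \<in> E) \<and> (\<forall>x. finite {n. w n = x})}"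

definition traj_space :: "'v set set \<Rightarrow> (int \<Rightarrow> 'v) measure" where
  "traj_space E = restrict_space (PiM UNIV (\<lambda>_. count_space UNIV)) (traj E)"

definition shift_rel :: "'v set set \<Rightarrow> ((int \<Rightarrow> 'v) \<times> (int \<Rightarrow> 'v)) set" where
  "shift_rel E = {(w, w'). w \<in> traj E \<and> w' \<in> traj E \<and> (\<exists>k. \<forall>n. w n = w' (n + k))}"

definition traj_classes :: "'v set set \<Rightarrow> (int \<Rightarrow> 'v) set set" where
  "traj_classes E = traj E // shift_rel E"

definition traj_proj :: "'v set set \<Rightarrow> (int \<Rightarrow> 'v) \<Rightarrow> (int \<Rightarrow> 'v) set" where
  "traj_proj E w = shift_rel E `` {w}"

definition class_space :: "'v set set \<Rightarrow> (int \<Rightarrow> 'v) set measure" where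
  "class_space E = sigma (traj_classes E)
     {A. A \<subseteq> traj_classes E \<and> traj_proj E -` A \<inter> traj E \<in> sets (traj_space E)}"

definition traj_hit :: "'v set set \<Rightarrow> 'v set \<Rightarrow> (int \<Rightarrow> 'v) set" where
  "traj_hit E K = {w \<in> traj E. \<exists>n. w n \<in> K}"

definition class_hit :: "'v set set \<Rightarrow> 'v set \<Rightarrow> (int \<Rightarrow> 'v) set set" where
  "class_hit E K = {C \<in> traj_classes E. \<exists>w\<in>C. \<exists>n. w n \<in> K}"

definition act_traj :: "('v \<Rightarrow> 'v) \<Rightarrow> (int \<Rightarrow> 'v) \<Rightarrow> (int \<Rightarrow> 'v)" where
  "act_traj \<phi> w = (\<lambda>n. \<phi> (w n))"

text \<open>
  Since automorphisms commute with time shifts, for \<open>\<phi> \<in> graph_Aut E\<close> the image of the class of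
  \<open>w\<close> is the class of \<open>act_traj \<phi> w\<close>.
\<close>

definition act_class :: "('v \<Rightarrow> 'v) \<Rightarrow> (int \<Rightarrow> 'v) set \<Rightarrow> (int \<Rightarrow> 'v) set" where
  "act_class \<phi> C = act_traj \<phi> ` C"

definition glue :: "(nat \<Rightarrow> 'v) \<times> (nat \<Rightarrow> 'v) \<Rightarrow> (int \<Rightarrow> 'v)" where
  "glue = (\<lambda>(f, b) n. if n \<ge> 0 then f (nat n) else b (nat (- n)))"

text \<open>
  The glued walk has nearest-neighbour steps almost surely and, on a transient graph, visits
  each vertex finitely often almost surely; hence restricting its law to \<open>traj E\<close> loses
  no mass.
\<close>

definition two_sided_srw :: "'v set set \<Rightarrow> 'v \<Rightarrow> (int \<Rightarrow> 'v) measure" where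
  "two_sided_srw E x =
    restrict_space
      (distr (srw E x \<Otimes>\<^sub>M srw E x) (PiM UNIV (\<lambda>_. count_space UNIV)) glue) (traj E)"

definition entrance_time :: "'v set \<Rightarrow> (int \<Rightarrow> 'v) \<Rightarrow> int" where
  "entrance_time K w = Min {n. w n \<in> K}"

definition Q_local :: "'v set set \<Rightarrow> 'v set \<Rightarrow> (int \<Rightarrow> 'v) set \<Rightarrow> ennreal" where
  "Q_local E K B =
    (\<Sum>x\<in>K. emeasure (two_sided_srw E x) {w \<in> B. w \<in> traj_hit E K \<and> entrance_time K w = 0})"

text \<open>
  On a locally finite connected transient graph exactly one measure has this property.
\<close>

definition interlacement_intensity :: "'v set set \<Rightarrow> (int \<Rightarrow> 'v) set measure \<Rightarrow> bool" where
  "interlacement_intensity E \<nu> \<longleftrightarrow>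
    sets \<nu> = sets (class_space E) \<and> sigma_finite_measure \<nu> \<and>
    (\<forall>A\<in>sets (class_space E). \<forall>K. finite K \<longrightarrow>
      emeasure \<nu> (A \<inter> class_hit E K) = Q_local E K (traj_proj E -` A \<inter> traj E))"

text \<open>
  A point measure \<open>\<Sum>i\<in>I. \<delta>(p i)\<close> is the image of the counting measure on \<open>I\<close> under
  \<open>p\<close>.  The index set is countable; points may be repeated.  The sets in \<open>F\<close> are those on which
  finiteness is required.
\<close>

definition point_measures :: "'a measure \<Rightarrow> 'a set set \<Rightarrow> 'a measure set" where
  "point_measures M F =
    {\<omega>. (\<exists>(I :: nat set) p. p \<in> I \<rightarrow> space M \<and> \<omega> = distr (count_space I) M p) \<and>
        (\<forall>B\<in>F. emeasure \<omega> B < \<infinity>)}"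

text \<open>The \<open>\<sigma>\<close>-algebra is generated by the evaluations, as for \<^const>\<open>subprob_algebra\<close>.\<close>

definition point_measure_space :: "'a measure \<Rightarrow> 'a set set \<Rightarrow> 'a measure measure" where
  "point_measure_space M F =
    (SUP A \<in> sets M. vimage_algebra (point_measures M F) (\<lambda>\<omega>. emeasure \<omega> A) borel)"

text \<open>
  \<open>N\<close> is the space of point measures in which \<open>Z\<close> takes its values.  With \<open>0 ^ 0 = 1\<close> the Poisson
  weights also cover sets of intensity \<open>0\<close>.
\<close>

definition poisson_point_process ::
    "'s measure \<Rightarrow> 'a measure measure \<Rightarrow> 'a measure \<Rightarrow> ('s \<Rightarrow> 'a measure) \<Rightarrow> bool" where
  "poisson_point_process P N \<mu> Z \<longleftrightarrow>
    prob_space P \<and> Z \<in> measurable P N \<and>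
    (\<forall>A\<in>sets \<mu>. emeasure \<mu> A < \<infinity> \<longrightarrow>
      (\<forall>k::nat. measure P {\<xi> \<in> space P. emeasure (Z \<xi>) A = of_nat k} =
         exp (- measure \<mu> A) * measure \<mu> A ^ k / fact k)) \<and>
    (\<forall>A\<in>sets \<mu>. emeasure \<mu> A = \<infinity> \<longrightarrow> (AE \<xi> in P. emeasure (Z \<xi>) A = \<infinity>)) \<and>
    (\<forall>(J :: nat set) A. finite J \<longrightarrow> A ` J \<subseteq> sets \<mu> \<longrightarrow> disjoint_family_on A J \<longrightarrow>
      prob_space.indep_vars P (\<lambda>_. borel) (\<lambda>i \<xi>. emeasure (Z \<xi>) (A i)) J)"

definition halfline :: "real measure" where
  "halfline = restrict_space lborel {0..}"

definition labelled_traj_space :: "'v set set \<Rightarrow> ((int \<Rightarrow> 'v) \<times> real) measure" where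
  "labelled_traj_space E = traj_space E \<Otimes>\<^sub>M halfline"

definition labelled_class_space :: "'v set set \<Rightarrow> ((int \<Rightarrow> 'v) set \<times> real) measure" where
  "labelled_class_space E = class_space E \<Otimes>\<^sub>M halfline"

definition traj_configs :: "'v set set \<Rightarrow> ((int \<Rightarrow> 'v) \<times> real) measure measure" where
  "traj_configs E =
    point_measure_space (labelled_traj_space E) {traj_hit E {x} \<times> {0..t} | x t. t \<ge> 0}"

definition class_configs :: "'v set set \<Rightarrow> ((int \<Rightarrow> 'v) set \<times> real) measure measure" where
  "class_configs E =
    point_measure_space (labelled_class_space E) {class_hit E {x} \<times> {0..t} | x t. t \<ge> 0}"

text \<open>
  Replacing each atom \<open>(w, t)\<close> of a point measure by \<open>(f w, t)\<close> is taking the image measure.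
\<close>

definition act_traj_config ::
    "'v set set \<Rightarrow> ('v \<Rightarrow> 'v) \<Rightarrow> ((int \<Rightarrow> 'v) \<times> real) measure \<Rightarrow> ((int \<Rightarrow> 'v) \<times> real) measure" where
  "act_traj_config E \<phi> \<omega> = distr \<omega> (labelled_traj_space E) (\<lambda>(w, t). (act_traj \<phi> w, t))"

definition act_class_config ::
    "'v set set \<Rightarrow> ('v \<Rightarrow> 'v) \<Rightarrow> ((int \<Rightarrow> 'v) set \<times> real) measure \<Rightarrow> ((int \<Rightarrow> 'v) set \<times> real) measure" where
  "act_class_config E \<phi> \<omega> = distr \<omega> (labelled_class_space E) (\<lambda>(C, t). (act_class \<phi> C, t))"

definition proj_config ::
    "'v set set \<Rightarrow> ((int \<Rightarrow> 'v) \<times> real) measure \<Rightarrow> ((int \<Rightarrow> 'v) set \<times> real) measure" where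
  "proj_config E \<omega> = distr \<omega> (labelled_class_space E) (\<lambda>(w, t). (traj_proj E w, t))"

text \<open>
  \<open>\<kappa>\<close> is a law on the measurable space \<open>N\<close>, on which the group \<open>\<Gamma>\<close> of vertex permutations acts
  by \<open>act\<close>.  As one cannot quantify existentially over types, the label space is
  a probability space with points in \<open>nat \<Rightarrow> real\<close>, with an arbitrary \<open>\<sigma>\<close>-algebra on an
  arbitrary subset; up to isomorphism these are all probability spaces with at most continuum many
  points, in particular all standard Borel ones.
\<close>

definition factor_of_iid ::
    "('v \<Rightarrow> 'v) set \<Rightarrow> (('v \<Rightarrow> 'v) \<Rightarrow> 'b \<Rightarrow> 'b) \<Rightarrow> 'b measure \<Rightarrow> 'b measure \<Rightarrow> bool" where
  "factor_of_iid \<Gamma> act N \<kappa> \<longleftrightarrow>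
    (\<exists>(\<theta> :: (nat \<Rightarrow> real) measure) T.
      prob_space \<theta> \<and>
      T \<in> measurable (PiM (UNIV :: 'v set) (\<lambda>_. \<theta>)) N \<and>
      (\<forall>\<phi>\<in>\<Gamma>. \<forall>\<eta>\<in>space (PiM (UNIV :: 'v set) (\<lambda>_. \<theta>)).
         T (\<lambda>x. \<eta> (inv \<phi> x)) = act \<phi> (T \<eta>)) \<and>
      distr (PiM (UNIV :: 'v set) (\<lambda>_. \<theta>)) N T = \<kappa>)"

end

theory Submission
  imports Defs
begin

text \<open>
  Give each vertex \<open>x\<close> a uniform label \<open>U x\<close> and an independent copy \<open>\<zeta> x\<close> of the
  process itself.  The measure \<open>Q\<close> splits into the pieces \<open>{w. w 0 = x}\<close>, and by
  invariance the piece at \<open>x\<close> is the image of the piece at a fixed root under any automorphism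
  taking the root to \<open>x\<close>.  The labels, almost surely distinct, pick one such automorphism
  equivariantly: the one whose sequence of labels is lexicographically minimal, which exists by
  local finiteness.  Superposing over \<open>x\<close> the images under these automorphisms of the points of
  \<open>\<zeta> x\<close> that are at the root at time \<open>0\<close> gives an equivariant map.  Conditionally on
  the labels its count vectors have the independent Poisson laws prescribed by
  \<open>Q \<times> \<lambda>\<close>, and these determine the law.
\<close>

subsection \<open>Point measures\<close>

text \<open>A fixed choice of one automorphism per vertex fails to be equivariant when the root has
  a nontrivial stabiliser, since several automorphisms carry the root to the same vertex. Distinct
  labels break this symmetry, and invariance of the intensity gives the moved counts the same law
  whichever automorphism is picked, so the selection leaves no trace in the final law. Using copies
  of the given process means that no Poisson process has to be constructed. The delicate point is
  local finiteness. With the position at time 0 and a unit time interval fixed, a count reads a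
  single copy and is finite for every input. A trajectory visiting a vertex may, however, be
  anywhere at time 0, so the count of visits collects points from all copies and may be infinite.
  Its finiteness is only almost sure; it is obtained by comparing laws on a larger configuration
  space, where the given process lies in the good set. As equivariance is demanded for every input,
  the exceptional set must be invariant and be sent to a fixed point of the action.\<close>

lemma space_point_measure_space [simp]: "space (point_measure_space M F) = point_measures M F"
  unfolding point_measure_space_def by (subst space_Sup_eq_UN) auto

lemma measurable_emeasure_point_measure [measurable]:
  assumes "A \<in> sets M"
  shows "(\<lambda>\<omega>. emeasure \<omega> A) \<in> borel_measurable (point_measure_space M F)"
  unfolding point_measure_space_def
  by (rule measurable_SUP1[OF assms measurable_vimage_algebra1]) auto

text \<open>The map \<open>g\<close> is there because prescribed counts indexed by \<open>D\<close>
  are later read on displaced sets such as \<open>moved \<psi> D\<close>.\<close>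

lemma sets_counts:
  assumes "finite \<D>" "\<And>D. D \<in> \<D> \<Longrightarrow> g D \<in> sets M"
  shows "{\<omega> \<in> point_measures M F. \<forall>D\<in>\<D>. emeasure \<omega> (g D) = of_nat (k D)} \<in> sets (point_measure_space M F)"
proof -
  have "{\<omega> \<in> space (point_measure_space M F). \<forall>D\<in>\<D>. emeasure \<omega> (g D) = of_nat (k D)} \<in> sets (point_measure_space M F)"
  proof (rule sets.sets_Collect_finite_All[OF _ assms(1)])
    fix D assume "D \<in> \<D>"
    note [measurable] = assms(2)[OF this]
    show "{\<omega> \<in> space (point_measure_space M F). emeasure \<omega> (g D) = of_nat (k D)} \<in> sets (point_measure_space M F)"
      by measurable
  qed
  then show ?thesis by simp
qed

lemma measurable_point_measure_spaceI:
  assumes "\<And>x. x \<in> space X \<Longrightarrow> f x \<in> point_measures M F"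
    and "\<And>A. A \<in> sets M \<Longrightarrow> (\<lambda>x. emeasure (f x) A) \<in> borel_measurable X"
  shows "f \<in> measurable X (point_measure_space M F)"
  unfolding point_measure_space_def using assms
  by (intro measurable_SUP2 measurable_vimage_algebra2) auto

lemma point_measuresE:
  assumes "\<omega> \<in> point_measures M F"
  obtains I :: "nat set" and p where "p \<in> I \<rightarrow> space M" "\<omega> = distr (count_space I) M p"
  using assms unfolding point_measures_def by blast

lemma sets_point_measure: "\<omega> \<in> point_measures M F \<Longrightarrow> sets \<omega> = sets M"
  by (auto simp: point_measures_def)

lemma space_point_measure: "\<omega> \<in> point_measures M F \<Longrightarrow> space \<omega> = space M"
  by (auto simp: point_measures_def)

text \<open>Separates being a sum of point masses from the finiteness conditions. The first holds by
  construction for every configuration below; the second changes with the family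
  \<open>F\<close>.\<close>

lemma point_measures_iff:
  "\<omega> \<in> point_measures M F \<longleftrightarrow> \<omega> \<in> point_measures M {} \<and> (\<forall>B\<in>F. emeasure \<omega> B < \<infinity>)"
  by (auto simp: point_measures_def)

lemma emeasure_distr_count_space:
  assumes "p \<in> I \<rightarrow> space M" "A \<in> sets M"
  shows "emeasure (distr (count_space I) M p) A = emeasure (count_space UNIV) {i \<in> I. p i \<in> A}"
proof -
  have "emeasure (distr (count_space I) M p) A = emeasure (count_space I) (p -` A \<inter> I)"
    using assms by (subst emeasure_distr) auto
  also have "p -` A \<inter> I = {i \<in> I. p i \<in> A}" by auto
  also have "emeasure (count_space I) {i \<in> I. p i \<in> A} = emeasure (count_space UNIV) {i \<in> I. p i \<in> A}"
    by (cases "finite {i \<in> I. p i \<in> A}")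
      (auto simp: emeasure_count_space_finite emeasure_count_space_infinite)
  finally show ?thesis .
qed

lemma emeasure_point_measure_nat:
  assumes "\<omega> \<in> point_measures M F" "emeasure \<omega> A < \<infinity>"
  shows "\<exists>k::nat. emeasure \<omega> A = of_nat k"
proof (cases "A \<in> sets M")
  case False
  then have "emeasure \<omega> A = 0" using sets_point_measure[OF assms(1)] by (simp add: emeasure_notin_sets)
  then show ?thesis by (intro exI[of _ 0]) simp
next
  case True
  obtain I :: "nat set" and p where p: "p \<in> I \<rightarrow> space M" "\<omega> = distr (count_space I) M p"
    using assms(1) by (rule point_measuresE)
  show ?thesis using assms(2) unfolding p(2) emeasure_distr_count_space[OF p(1) True]
    by (auto simp: emeasure_count_space split: if_splits)
qed

text \<open>The definition of point measures admits only index sets of natural numbers; an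
  enumeration of \<open>K\<close> makes any countable index set available, in particular pairs of a
  vertex and an atom number.\<close>

lemma distr_count_space_point_measure:
  assumes "countable K" "q \<in> K \<rightarrow> space M"
  shows "distr (count_space K) M q \<in> point_measures M {}"
proof -
  let ?I = "to_nat_on K ` K" and ?p = "q \<circ> from_nat_into K"
  have inj: "inj_on (to_nat_on K) K" by (rule inj_on_to_nat_on[OF assms(1)])
  have p: "?p \<in> ?I \<rightarrow> space M" using assms by auto
  have "distr (count_space K) M q = distr (count_space ?I) M ?p"
  proof (rule measure_eqI)
    fix A assume "A \<in> sets (distr (count_space K) M q)"
    then have A: "A \<in> sets M" by simp
    have *: "{i \<in> ?I. ?p i \<in> A} = to_nat_on K ` {i \<in> K. q i \<in> A}"
      using assms(1) by auto
    have "inj_on (to_nat_on K) {i \<in> K. q i \<in> A}" using inj by (rule inj_on_subset) auto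
    then have "emeasure (count_space UNIV) {i \<in> ?I. ?p i \<in> A} = emeasure (count_space UNIV) {i \<in> K. q i \<in> A}"
      unfolding * by (simp add: emeasure_count_space finite_image_iff card_image)
    then show "emeasure (distr (count_space K) M q) A = emeasure (distr (count_space ?I) M ?p) A"
      using emeasure_distr_count_space[OF p A] emeasure_distr_count_space[OF assms(2) A] by simp
  qed simp
  then show ?thesis using p by (auto simp: point_measures_def)
qed

lemma distr_point_measure:
  assumes "\<omega> \<in> point_measures M F" "f \<in> measurable M N"
  shows "distr \<omega> N f \<in> point_measures N {}"
proof -
  obtain I :: "nat set" and p where p: "p \<in> I \<rightarrow> space M" "\<omega> = distr (count_space I) M p"
    using assms(1) by (rule point_measuresE)
  have "distr \<omega> N f = distr (count_space I) N (f \<circ> p)"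
    using p assms(2) by (simp add: distr_distr)
  moreover have "f \<circ> p \<in> I \<rightarrow> space N" using p(1) measurable_space[OF assms(2)] by (auto simp: Pi_iff)
  ultimately show ?thesis by (auto simp: point_measures_def)
qed

lemma emeasure_distr_point_measure:
  assumes "\<omega> \<in> point_measures M F" "f \<in> measurable M N" "A \<in> sets N"
  shows "emeasure (distr \<omega> N f) A = emeasure \<omega> {m \<in> space M. f m \<in> A}"
proof -
  have "f \<in> measurable \<omega> N" using assms(2) sets_point_measure[OF assms(1)]
    by (metis measurable_cong_sets)
  moreover have "f -` A \<inter> space \<omega> = {m \<in> space M. f m \<in> A}"
    using space_point_measure[OF assms(1)] by auto
  ultimately show ?thesis using assms(3) by (simp add: emeasure_distr)
qed

lemma emeasure_count_space_Sigma:
  "emeasure (count_space UNIV) {(x, i). P x i} =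
     (\<integral>\<^sup>+x. emeasure (count_space UNIV) {i. P x i} \<partial>count_space UNIV)"
proof -
  have "emeasure (count_space UNIV) {(x, i). P x i} =
      (\<integral>\<^sup>+z. indicator {(x, i). P x i} z \<partial>count_space UNIV)"
    by (subst nn_integral_indicator) auto
  also have "\<dots> = (\<integral>\<^sup>+x. \<integral>\<^sup>+i. indicator {(x, i). P x i} (x, i) \<partial>count_space UNIV \<partial>count_space UNIV)"
    by (rule nn_integral_fst_count_space[symmetric])
  also have "\<dots> = (\<integral>\<^sup>+x. \<integral>\<^sup>+i. indicator {i. P x i} i \<partial>count_space UNIV \<partial>count_space UNIV)"
    by (simp add: indicator_def)
  also have "\<dots> = (\<integral>\<^sup>+x. emeasure (count_space UNIV) {i. P x i} \<partial>count_space UNIV)"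
    by (subst nn_integral_indicator) auto
  finally show ?thesis .
qed

text \<open>Counts on overlapping sets are not independent, but they are sums of counts on the atoms
  of the finite family. Adding a set \<open>B\<close> splits every old atom along \<open>B\<close>
  and adds the part of \<open>B\<close> not yet covered. The last conjunct keeps each atom inside a
  given set, hence inside one cell in the application.\<close>

lemma ex_disjoint_refinement:
  assumes "finite \<A>" "\<A> \<subseteq> sets M"
  shows "\<exists>\<D>. finite \<D> \<and> disjoint \<D> \<and> \<D> \<subseteq> sets M \<and> (\<forall>A\<in>\<A>. A = \<Union>{D\<in>\<D>. D \<subseteq> A}) \<and>
    (\<forall>D\<in>\<D>. \<exists>A\<in>\<A>. D \<subseteq> A)"
  using assms
proof (induction \<A> rule: finite_induct)
  case empty
  show ?case by (intro exI[of _ "{}"]) (simp add: disjoint_def)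
next
  case (insert B \<A>)
  then obtain \<D> where D: "finite \<D>" "disjoint \<D>" "\<D> \<subseteq> sets M"
    "\<And>A. A \<in> \<A> \<Longrightarrow> A = \<Union>{D\<in>\<D>. D \<subseteq> A}" "\<And>D. D \<in> \<D> \<Longrightarrow> \<exists>A\<in>\<A>. D \<subseteq> A"
    by auto
  let ?D = "(\<lambda>D. D \<inter> B) ` \<D> \<union> (\<lambda>D. D - B) ` \<D> \<union> {B - \<Union>\<D>}"
  have 1: "finite ?D" using D by auto
  have 2: "disjoint ?D"
  proof (rule disjointI)
    fix X Y assume XY: "X \<in> ?D" "Y \<in> ?D" "X \<noteq> Y"
    have *: "D = D'" if "D \<in> \<D>" "D' \<in> \<D>" "p \<in> D" "p \<in> D'" for D D' p
      using D(2) that by (auto simp: disjoint_def)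
    show "X \<inter> Y = {}"
    proof (rule ccontr)
      assume "X \<inter> Y \<noteq> {}"
      then obtain p where p: "p \<in> X" "p \<in> Y" by auto
      show False
      proof (cases "\<exists>D\<in>\<D>. p \<in> D")
        case True
        then obtain D0 where "D0 \<in> \<D>" "p \<in> D0" by auto
        then have "X = (if p \<in> B then D0 \<inter> B else D0 - B)" "Y = (if p \<in> B then D0 \<inter> B else D0 - B)"
          using XY(1,2) p * by auto
        then show False using XY(3) by simp
      next
        case False
        then have "X = B - \<Union>\<D>" "Y = B - \<Union>\<D>" using XY(1,2) p by auto
        then show False using XY(3) by simp
      qed
    qed
  qed
  have BM: "B \<in> sets M" using insert.prems by auto
  have 3: "?D \<subseteq> sets M"
    using D(1,3) BM by (auto intro!: sets.Diff sets.finite_Union)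
  have 4: "A = \<Union>{D\<in>?D. D \<subseteq> A}" if "A \<in> insert B \<A>" for A
  proof (cases "A = B")
    case True
    have "p \<in> \<Union>{D\<in>?D. D \<subseteq> B}" if "p \<in> B" for p
    proof (cases "p \<in> \<Union>\<D>")
      case True
      then obtain D0 where D0: "D0 \<in> \<D>" "p \<in> D0" by auto
      have "D0 \<inter> B \<in> {D\<in>?D. D \<subseteq> B}" using D0 by auto
      then show ?thesis by (rule UnionI) (use that D0 in auto)
    next
      case False
      have "B - \<Union>\<D> \<in> {D\<in>?D. D \<subseteq> B}" by auto
      then show ?thesis by (rule UnionI) (use that False in auto)
    qed
    then show ?thesis using True by auto
  next
    case False
    then have A: "A \<in> \<A>" using that by auto
    have "p \<in> \<Union>{D\<in>?D. D \<subseteq> A}" if "p \<in> A" for p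
    proof -
      obtain D0 where D0: "D0 \<in> \<D>" "D0 \<subseteq> A" "p \<in> D0" using D(4)[OF A] \<open>p \<in> A\<close> by auto
      show ?thesis
      proof (cases "p \<in> B")
        case True
        have "D0 \<inter> B \<in> {D\<in>?D. D \<subseteq> A}" using D0 by auto
        then show ?thesis by (rule UnionI) (use True D0 in auto)
      next
        case False
        have "D0 - B \<in> {D\<in>?D. D \<subseteq> A}" using D0 by auto
        then show ?thesis by (rule UnionI) (use False D0 in auto)
      qed
    qed
    then show ?thesis by auto
  qed
  have 5: "\<exists>A\<in>insert B \<A>. X \<subseteq> A" if "X \<in> ?D" for X
  proof -
    consider D0 where "D0 \<in> \<D>" "X \<subseteq> D0" | "X \<subseteq> B" using \<open>X \<in> ?D\<close> by blast
    then show ?thesis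
    proof cases
      case 1
      then show ?thesis using D(5)[of D0] by (meson insertI2 order_trans)
    qed auto
  qed
  show ?case by (intro exI[of _ ?D] conjI ballI 1 2 3 4 5)
qed

section \<open>Laws of point measures are determined by counts inside cells\<close>

lemma borel_measurable_nn_integral_count_space:
  assumes "countable (UNIV :: 'c set)" "\<And>c. f c \<in> borel_measurable X"
  shows "(\<lambda>x. \<integral>\<^sup>+c. f c x \<partial>count_space (UNIV::'c set)) \<in> borel_measurable X"
proof -
  interpret sigma_finite_measure "count_space (UNIV :: 'c set)"
    by (rule sigma_finite_measure_count_space_countable[OF assms(1)])
  have "(\<lambda>(x, c). f c x) \<in> borel_measurable (X \<Otimes>\<^sub>M count_space UNIV)"
    unfolding split_beta'
    by (rule measurable_compose_countable'[OF _ measurable_snd assms(1), of "\<lambda>c z. f c (fst z)"])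
      (rule measurable_compose[OF measurable_fst assms(2)])
  from borel_measurable_nn_integral[OF this] show ?thesis by simp
qed

text \<open>The configurations may have infinitely many points. The cells are countably many pieces
  on which the counts will be finite, so that there counts are natural numbers and may be
  subtracted.\<close>

locale cell_partition =
  fixes M :: "'a measure" and C :: "'c \<Rightarrow> 'a set"
  assumes countable_cells: "countable (UNIV :: 'c set)"
    and disjoint_cells: "disjoint_family C"
    and cover_cells: "(\<Union>c. C c) = space M"
    and sets_cells [measurable]: "C c \<in> sets M"
begin

lemma emeasure_eq_cells:
  assumes "sets \<omega> = sets M" "A \<in> sets M"
  shows "emeasure \<omega> A = (\<integral>\<^sup>+c. emeasure \<omega> (A \<inter> C c) \<partial>count_space UNIV)"
proof -
  have "A = (\<Union>c. A \<inter> C c)" using sets.sets_into_space[OF assms(2)] cover_cells by auto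
  then have "emeasure \<omega> A = emeasure \<omega> (\<Union>c. A \<inter> C c)" by simp
  also have "\<dots> = (\<integral>\<^sup>+c. emeasure \<omega> (A \<inter> C c) \<partial>count_space UNIV)"
    using disjoint_cells assms countable_cells
    by (intro emeasure_UN_countable) (auto simp: disjoint_family_on_def)
  finally show ?thesis .
qed

definition cell_sets :: "'a set set" where
  "cell_sets = {A \<in> sets M. \<exists>c. A \<subseteq> C c}"

text \<open>The events prescribing finitely many counts inside cells form a \<pi>-system that
  generates the \<sigma>-algebra. An event with overlapping sets is a countable disjoint union of
  events with disjoint sets: sum over all ways to distribute the prescribed counts among the atoms
  of the refinement.\<close>

lemma point_measure_eqI:
  fixes L1 L2 :: "'a measure measure"
  assumes fin: "\<And>\<omega> c. \<omega> \<in> point_measures M F \<Longrightarrow> emeasure \<omega> (C c) < \<infinity>"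
    and L1: "prob_space L1" "sets L1 = sets (point_measure_space M F)"
    and L2: "prob_space L2" "sets L2 = sets (point_measure_space M F)"
    and eq: "\<And>\<D> \<kappa>. finite \<D> \<Longrightarrow> disjoint \<D> \<Longrightarrow> \<D> \<subseteq> cell_sets \<Longrightarrow>
      emeasure L1 {\<omega> \<in> point_measures M F. \<forall>D\<in>\<D>. emeasure \<omega> D = of_nat (\<kappa> D)} =
      emeasure L2 {\<omega> \<in> point_measures M F. \<forall>D\<in>\<D>. emeasure \<omega> D = of_nat (\<kappa> D)}"
  shows "L1 = L2"
proof -
  interpret L1: prob_space L1 by (rule L1)
  interpret L2: prob_space L2 by (rule L2)
  let ?N = "point_measure_space M F" and ?S = "point_measures M F"
  \<comment> \<open>A relation \<open>R\<close>, rather than a function, may prescribe two different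
    counts for the same set. This makes intersections of events correspond to unions of
    relations.\<close>
  define ev :: "('a set \<times> nat) set \<Rightarrow> 'a measure set"
    where "ev R = {\<omega> \<in> ?S. \<forall>(A, k)\<in>R. emeasure \<omega> A = of_nat k}" for R
  define G where "G = ev ` {R. finite R \<and> fst ` R \<subseteq> cell_sets}"
  have ev_Un: "ev R \<inter> ev R' = ev (R \<union> R')" for R R' by (auto simp: ev_def)
  have stable: "Int_stable G"
  proof (rule Int_stableI)
    fix a b assume "a \<in> G" "b \<in> G"
    then obtain R R' where R: "a = ev R" "finite R" "fst ` R \<subseteq> cell_sets"
      "b = ev R'" "finite R'" "fst ` R' \<subseteq> cell_sets" by (auto simp: G_def)
    then show "a \<inter> b \<in> G" unfolding G_def
      by (intro image_eqI[of _ _ "R \<union> R'"]) (auto simp: ev_Un)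
  qed
  have fin': "emeasure \<omega> A < \<infinity>" if that0: "\<omega> \<in> ?S" "A \<in> cell_sets" for \<omega> A
  proof -
    obtain c where "A \<subseteq> C c" using that0 by (auto simp: cell_sets_def)
    then have "emeasure \<omega> A \<le> emeasure \<omega> (C c)"
      using sets_point_measure[OF that0(1)] by (intro emeasure_mono) auto
    then show ?thesis using fin[OF that0(1), of c] by (simp add: order.strict_trans1)
  qed
  have G_pow: "G \<subseteq> Pow ?S" by (auto simp: G_def ev_def)
  let ?\<Sigma> = "sigma ?S G"
  have sp: "space ?\<Sigma> = ?S" by (simp add: space_measure_of[OF G_pow])
  \<comment> \<open>Counts inside a cell are natural numbers, so the preimage of any set
    \<open>B\<close> whatsoever is a countable union of generating events.\<close>
  have meas_cell: "(\<lambda>\<omega>. emeasure \<omega> A) \<in> borel_measurable ?\<Sigma>" if A: "A \<in> cell_sets" for A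
  proof (rule measurableI)
    fix B :: "ennreal set"
    have "(\<lambda>\<omega>. emeasure \<omega> A) -` B \<inter> space ?\<Sigma> = (\<Union>k\<in>{k::nat. of_nat k \<in> B}. ev {(A, k)})"
    proof (intro set_eqI iffI)
      fix \<omega> assume "\<omega> \<in> (\<lambda>\<omega>. emeasure \<omega> A) -` B \<inter> space ?\<Sigma>"
      then have \<omega>: "\<omega> \<in> ?S" "emeasure \<omega> A \<in> B" by (auto simp: sp)
      then obtain k :: nat where "emeasure \<omega> A = of_nat k"
        using emeasure_point_measure_nat[OF \<omega>(1) fin'[OF \<omega>(1) A]] by auto
      then show "\<omega> \<in> (\<Union>k\<in>{k::nat. of_nat k \<in> B}. ev {(A, k)})" using \<omega> by (auto simp: ev_def)
    qed (auto simp: ev_def sp)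
    moreover have "ev {(A, k)} \<in> sets ?\<Sigma>" for k
    proof -
      have "ev {(A, k)} \<in> G" using A unfolding G_def by (intro imageI) auto
      then show ?thesis unfolding sets_measure_of[OF G_pow] by (rule sigma_sets.Basic)
    qed
    ultimately show "(\<lambda>\<omega>. emeasure \<omega> A) -` B \<inter> space ?\<Sigma> \<in> sets ?\<Sigma>" by auto
  qed auto
  \<comment> \<open>The count of an arbitrary measurable set is the countable sum of its counts in
    the cells, so the events in \<open>G\<close> already generate the full \<sigma>-algebra.\<close>
  have "(\<lambda>\<omega>. \<omega>) \<in> measurable ?\<Sigma> ?N"
  proof (rule measurable_point_measure_spaceI)
    fix A assume A: "A \<in> sets M"
    have "(\<lambda>\<omega>. \<integral>\<^sup>+c. emeasure \<omega> (A \<inter> C c) \<partial>count_space UNIV) \<in> borel_measurable ?\<Sigma>"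
      by (intro borel_measurable_nn_integral_count_space countable_cells meas_cell) (use A in \<open>auto simp: cell_sets_def\<close>)
    then show "(\<lambda>\<omega>. emeasure \<omega> A) \<in> borel_measurable ?\<Sigma>"
      by (subst measurable_cong[where g="\<lambda>\<omega>. \<integral>\<^sup>+c. emeasure \<omega> (A \<inter> C c) \<partial>count_space UNIV"])
        (auto simp: sp intro!: emeasure_eq_cells sets_point_measure A)
  qed (simp add: sp)
  note id_meas = this
  have N_sub: "sets ?N \<subseteq> sigma_sets ?S G"
  proof
    fix X assume X: "X \<in> sets ?N"
    have "(\<lambda>\<omega>. \<omega>) -` X \<inter> space ?\<Sigma> = X" using sets.sets_into_space[OF X] by (auto simp: sp)
    then show "X \<in> sigma_sets ?S G"
      using measurable_sets[OF id_meas X] by (simp add: sets_measure_of[OF G_pow])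
  qed
  have ev_N: "ev R \<in> sets ?N" if "finite R" "fst ` R \<subseteq> cell_sets" for R
  proof -
    have "{\<omega> \<in> space ?N. \<forall>r\<in>R. emeasure \<omega> (fst r) = of_nat (snd r)} \<in> sets ?N"
    proof (rule sets.sets_Collect_finite_All[OF _ that(1)])
      fix r assume "r \<in> R"
      then have [measurable]: "fst r \<in> sets M" using that(2) by (auto simp: cell_sets_def)
      show "{\<omega> \<in> space ?N. emeasure \<omega> (fst r) = of_nat (snd r)} \<in> sets ?N" by measurable
    qed
    also have "{\<omega> \<in> space ?N. \<forall>r\<in>R. emeasure \<omega> (fst r) = of_nat (snd r)} = ev R"
      by (auto simp: ev_def)
    finally show ?thesis .
  qed
  have G_N: "G \<subseteq> sets ?N" using ev_N by (auto simp: G_def)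
  have N_eq: "sets ?N = sigma_sets ?S G"
    using N_sub sets.sigma_sets_subset[OF G_N] by auto
  have eq_G: "emeasure L1 X = emeasure L2 X" if XG: "X \<in> G" for X
  proof -
    obtain R where R: "X = ev R" "finite R" "fst ` R \<subseteq> cell_sets" using XG by (auto simp: G_def)
    have "fst ` R \<subseteq> sets M" using R(3) by (auto simp: cell_sets_def)
    from ex_disjoint_refinement[OF finite_imageI[OF R(2)] this] obtain \<D> where D0: "finite \<D> \<and> disjoint \<D> \<and> \<D> \<subseteq> sets M \<and>
        (\<forall>A\<in>fst ` R. A = \<Union>{D\<in>\<D>. D \<subseteq> A}) \<and> (\<forall>D\<in>\<D>. \<exists>A\<in>fst ` R. D \<subseteq> A)"
      by (rule exE)
    note D = D0[THEN conjunct1] D0[THEN conjunct2, THEN conjunct1]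
      D0[THEN conjunct2, THEN conjunct2, THEN conjunct1]
      D0[THEN conjunct2, THEN conjunct2, THEN conjunct2, THEN conjunct1, THEN bspec]
      D0[THEN conjunct2, THEN conjunct2, THEN conjunct2, THEN conjunct2, THEN bspec]
    have D_cell: "\<D> \<subseteq> cell_sets"
    proof
      fix D assume "D \<in> \<D>"
      then obtain A where A: "A \<in> fst ` R" "D \<subseteq> A" using D(5) by blast
      then have "A \<in> cell_sets" using R(3) by blast
      then obtain c where "A \<subseteq> C c" by (auto simp: cell_sets_def)
      then show "D \<in> cell_sets" using A(2) \<open>D \<in> \<D>\<close> D(3) by (auto simp: cell_sets_def)
    qed
    \<comment> \<open>These are the distributions of the counts over the atoms that give every set
      of \<open>R\<close> its prescribed total. Extensionality outside \<open>\<D>\<close> makes two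
      different distributions disagree on some atom, whence the events \<open>E \<kappa>\<close> are
      disjoint.\<close>
    define Kp where "Kp = {\<kappa> \<in> \<D> \<rightarrow>\<^sub>E (UNIV::nat set). \<forall>(A, k)\<in>R. (\<Sum>D\<in>{D\<in>\<D>. D \<subseteq> A}. \<kappa> D) = k}"
    define E where "E \<kappa> = {\<omega> \<in> ?S. \<forall>D\<in>\<D>. emeasure \<omega> D = of_nat (\<kappa> D)}" for \<kappa> :: "'a set \<Rightarrow> nat"
    have cK: "countable Kp"
      unfolding Kp_def by (rule countable_subset[OF _ countable_PiE[OF D(1), of "\<lambda>_. UNIV"]]) auto
    have add: "emeasure \<omega> A = (\<Sum>D\<in>{D\<in>\<D>. D \<subseteq> A}. emeasure \<omega> D)" if "\<omega> \<in> ?S" "A \<in> fst ` R" for \<omega> A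
    proof -
      have "emeasure \<omega> A = emeasure \<omega> (\<Union>D\<in>{D\<in>\<D>. D \<subseteq> A}. D)"
        unfolding image_ident by (rule arg_cong[OF D(4)[OF that(2)]])
      also have "\<dots> = (\<Sum>D\<in>{D\<in>\<D>. D \<subseteq> A}. emeasure \<omega> D)"
        using D(1-3) sets_point_measure[OF that(1)]
        by (intro sum_emeasure[symmetric]) (auto simp: disjoint_family_on_def disjoint_def)
      finally show ?thesis .
    qed
    have X: "X = (\<Union>\<kappa>\<in>Kp. E \<kappa>)"
    proof (intro set_eqI iffI)
      fix \<omega> assume "\<omega> \<in> X"
      then have \<omega>: "\<omega> \<in> ?S" "\<And>A k. (A, k) \<in> R \<Longrightarrow> emeasure \<omega> A = of_nat k" by (auto simp: R(1) ev_def)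
      have "\<forall>D\<in>\<D>. \<exists>k::nat. emeasure \<omega> D = of_nat k"
        using D_cell fin'[OF \<omega>(1)] emeasure_point_measure_nat[OF \<omega>(1)] by blast
      then obtain \<kappa> where \<kappa>: "\<And>D. D \<in> \<D> \<Longrightarrow> emeasure \<omega> D = of_nat (\<kappa> D)" by metis
      have "(\<Sum>D\<in>{D\<in>\<D>. D \<subseteq> A}. \<kappa> D) = k" if "(A, k) \<in> R" for A k
      proof -
        have "of_nat k = (\<Sum>D\<in>{D\<in>\<D>. D \<subseteq> A}. emeasure \<omega> D)"
          using add[OF \<omega>(1), of A] \<omega>(2)[OF that] that by force
        also have "\<dots> = (\<Sum>D\<in>{D\<in>\<D>. D \<subseteq> A}. of_nat (\<kappa> D))" by (intro sum.cong) (auto simp: \<kappa>)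
        finally have "(of_nat k :: ennreal) = of_nat (\<Sum>D\<in>{D\<in>\<D>. D \<subseteq> A}. \<kappa> D)" by simp
        then show ?thesis by (metis of_nat_eq_iff)
      qed
      then have "restrict \<kappa> \<D> \<in> Kp" by (auto simp: Kp_def)
      moreover have "\<omega> \<in> E (restrict \<kappa> \<D>)" using \<omega> \<kappa> by (auto simp: E_def)
      ultimately show "\<omega> \<in> (\<Union>\<kappa>\<in>Kp. E \<kappa>)" by blast
    next
      fix \<omega> assume "\<omega> \<in> (\<Union>\<kappa>\<in>Kp. E \<kappa>)"
      then obtain \<kappa> where \<kappa>: "\<kappa> \<in> Kp" and \<omega>: "\<omega> \<in> ?S" "\<And>D. D \<in> \<D> \<Longrightarrow> emeasure \<omega> D = of_nat (\<kappa> D)"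
        by (auto simp: E_def)
      have "emeasure \<omega> A = of_nat k" if "(A, k) \<in> R" for A k
      proof -
        have "emeasure \<omega> A = (\<Sum>D\<in>{D\<in>\<D>. D \<subseteq> A}. of_nat (\<kappa> D))"
          using add[OF \<omega>(1), of A] that \<omega>(2) by (force intro: sum.cong)
        also have "\<dots> = of_nat (\<Sum>D\<in>{D\<in>\<D>. D \<subseteq> A}. \<kappa> D)" by simp
        also have "(\<Sum>D\<in>{D\<in>\<D>. D \<subseteq> A}. \<kappa> D) = k" using \<kappa> that by (auto simp: Kp_def)
        finally show ?thesis .
      qed
      then show "\<omega> \<in> X" using \<omega>(1) by (auto simp: R(1) ev_def)
    qed
    have disjE: "disjoint_family_on E Kp"
      unfolding disjoint_family_on_def
    proof (intro ballI impI)
      fix \<kappa> \<kappa>' assume k: "\<kappa> \<in> Kp" "\<kappa>' \<in> Kp" "\<kappa> \<noteq> \<kappa>'"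
      then have "\<exists>D\<in>\<D>. \<kappa> D \<noteq> \<kappa>' D" unfolding Kp_def by (metis (no_types, lifting) PiE_ext mem_Collect_eq)
      then show "E \<kappa> \<inter> E \<kappa>' = {}" by (auto simp: E_def)
    qed
    have E_sets: "E \<kappa> \<in> sets ?N" for \<kappa>
    proof -
      have "E \<kappa> = ev ((\<lambda>D. (D, \<kappa> D)) ` \<D>)" by (auto simp: E_def ev_def)
      moreover have "\<dots> \<in> sets ?N" using D(1) D_cell by (intro ev_N) auto
      ultimately show ?thesis by simp
    qed
    have "emeasure L1 X = (\<integral>\<^sup>+\<kappa>. emeasure L1 (E \<kappa>) \<partial>count_space Kp)"
      unfolding X using E_sets L1(2) by (intro emeasure_UN_countable cK disjE) auto
    also have "\<dots> = (\<integral>\<^sup>+\<kappa>. emeasure L2 (E \<kappa>) \<partial>count_space Kp)"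
      unfolding E_def using eq[OF D(1,2) D_cell] by simp
    also have "\<dots> = emeasure L2 X"
      unfolding X using E_sets L2(2) by (intro emeasure_UN_countable[symmetric] cK disjE) auto
    finally show ?thesis .
  qed
  have spL: "space L1 = ?S" "space L2 = ?S"
    using sets_eq_imp_space_eq[OF L1(2)] sets_eq_imp_space_eq[OF L2(2)] by auto
  have S_G: "?S \<in> G" unfolding G_def by (rule image_eqI[of _ _ "{}"]) (auto simp: ev_def)
  show ?thesis
    by (rule measure_eqI_generator_eq[OF stable G_pow eq_G, where A="\<lambda>_. ?S"])
      (use L1(2) L2(2) N_eq S_G in \<open>auto simp: L1.emeasure_eq_measure\<close>)
qed

text \<open>A Dynkin argument starting from rectangles, carried out inside one cell: the complement
  step subtracts counts, which requires them to be finite. Summation over the cells follows. The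
  lemma is needed because the sets to be counted will depend on the labels.\<close>

lemma measurable_emeasure_section:
  assumes fin: "\<And>\<omega> c. \<omega> \<in> point_measures M F \<Longrightarrow> emeasure \<omega> (C c) < \<infinity>"
    and S: "S \<in> sets (X \<Otimes>\<^sub>M M)"
  shows "(\<lambda>(x, \<omega>). emeasure \<omega> {m \<in> space M. (x, m) \<in> S})
    \<in> borel_measurable (X \<Otimes>\<^sub>M point_measure_space M F)"
proof -
  let ?N = "point_measure_space M F"
  define sec where "sec S x = {m \<in> space M. (x, m) \<in> S}" for S :: "('b \<times> 'a) set" and x
  have sec_sets: "sec S x \<in> sets M" if "S \<in> sets (X \<Otimes>\<^sub>M M)" for S x
  proof -
    have "Pair x -` S = sec S x" using sets.sets_into_space[OF that]
      by (auto simp: sec_def space_pair_measure)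
    then show ?thesis using sets_Pair1[OF that, of x] by simp
  qed
  have cell: "(\<lambda>z. emeasure (snd z) (sec S (fst z) \<inter> C c)) \<in> borel_measurable (X \<Otimes>\<^sub>M ?N)"
    if S: "S \<in> sets (X \<Otimes>\<^sub>M M)" for S c
    using Int_stable_pair_measure_generator pair_measure_closed S[unfolded sets_pair_measure]
  proof (induction S rule: sigma_sets_induct_disjoint)
    case (basic S)
    then obtain a b where ab: "S = a \<times> b" "a \<in> sets X" "b \<in> sets M" by auto
    have [measurable]: "a \<in> sets X" "b \<inter> C c \<in> sets M" using ab by auto
    have "(\<lambda>z. indicator a (fst z) * emeasure (snd z) (b \<inter> C c)) \<in> borel_measurable (X \<Otimes>\<^sub>M ?N)"
      by measurable
    moreover have "emeasure (snd z) (sec S (fst z) \<inter> C c) = indicator a (fst z) * emeasure (snd z) (b \<inter> C c)" for z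
    proof -
      have "sec S (fst z) = (if fst z \<in> a then b else {})"
        using sets.sets_into_space[OF ab(3)] by (auto simp: sec_def ab(1))
      then show ?thesis by simp
    qed
    ultimately show ?case by simp
  next
    case empty
    then show ?case by (simp add: sec_def)
  next
    case (compl S)
    have S: "S \<in> sets (X \<Otimes>\<^sub>M M)" using compl.hyps by (simp add: sets_pair_measure)
    have [measurable]: "(\<lambda>z. emeasure (snd z) (sec S (fst z) \<inter> C c)) \<in> borel_measurable (X \<Otimes>\<^sub>M ?N)"
      by (rule compl.IH)
    have "(\<lambda>z. emeasure (snd z) (C c) - emeasure (snd z) (sec S (fst z) \<inter> C c)) \<in> borel_measurable (X \<Otimes>\<^sub>M ?N)"
      by measurable
    moreover have "emeasure (snd z) (sec (space X \<times> space M - S) (fst z) \<inter> C c) =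
        emeasure (snd z) (C c) - emeasure (snd z) (sec S (fst z) \<inter> C c)"
      if "z \<in> space (X \<Otimes>\<^sub>M ?N)" for z
    proof -
      have z: "fst z \<in> space X" "snd z \<in> point_measures M F" using that by (auto simp: space_pair_measure)
      have "sec (space X \<times> space M - S) (fst z) \<inter> C c = C c - (sec S (fst z) \<inter> C c)"
        using z(1) sets.sets_into_space[OF sets_cells] by (auto simp: sec_def)
      also have "emeasure (snd z) \<dots> = emeasure (snd z) (C c) - emeasure (snd z) (sec S (fst z) \<inter> C c)"
      proof (rule emeasure_Diff)
        have "emeasure (snd z) (sec S (fst z) \<inter> C c) \<le> emeasure (snd z) (C c)"
          using sets_point_measure[OF z(2)] by (intro emeasure_mono) auto
        then show "emeasure (snd z) (sec S (fst z) \<inter> C c) \<noteq> \<infinity>"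
          using fin[OF z(2), of c] by (auto simp: top_unique)
      qed (use sets_point_measure[OF z(2)] sec_sets[OF S] in auto)
      finally show ?thesis .
    qed
    ultimately show ?case by (subst measurable_cong) auto
  next
    case (union A)
    then have [measurable]: "(\<lambda>z. emeasure (snd z) (sec (A i) (fst z) \<inter> C c)) \<in> borel_measurable (X \<Otimes>\<^sub>M ?N)" for i
      by auto
    have A: "A i \<in> sets (X \<Otimes>\<^sub>M M)" for i using union.hyps by (auto simp: sets_pair_measure)
    have "(\<lambda>z. \<Sum>i. emeasure (snd z) (sec (A i) (fst z) \<inter> C c)) \<in> borel_measurable (X \<Otimes>\<^sub>M ?N)"
      by measurable
    moreover have "emeasure (snd z) (sec (\<Union>(range A)) (fst z) \<inter> C c) =
        (\<Sum>i. emeasure (snd z) (sec (A i) (fst z) \<inter> C c))"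
      if "z \<in> space (X \<Otimes>\<^sub>M ?N)" for z
    proof -
      have z: "snd z \<in> point_measures M F" using that by (auto simp: space_pair_measure)
      have "sec (\<Union>(range A)) (fst z) \<inter> C c = (\<Union>i. sec (A i) (fst z) \<inter> C c)" by (auto simp: sec_def)
      also have "emeasure (snd z) \<dots> = (\<Sum>i. emeasure (snd z) (sec (A i) (fst z) \<inter> C c))"
        using sets_point_measure[OF z] sec_sets[OF A] union.hyps(1)
        by (intro suminf_emeasure[symmetric]) (auto simp: disjoint_family_on_def sec_def disjoint_iff)
      finally show ?thesis .
    qed
    ultimately show ?case by (subst measurable_cong) auto
  qed
  have "(\<lambda>z. \<integral>\<^sup>+c. emeasure (snd z) (sec S (fst z) \<inter> C c) \<partial>count_space UNIV) \<in> borel_measurable (X \<Otimes>\<^sub>M ?N)"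
    by (intro borel_measurable_nn_integral_count_space countable_cells cell S)
  then show ?thesis unfolding split_beta' sec_def[symmetric]
    by (subst measurable_cong[where g="\<lambda>z. \<integral>\<^sup>+c. emeasure (snd z) (sec S (fst z) \<inter> C c) \<partial>count_space UNIV"])
      (auto simp: space_pair_measure intro!: emeasure_eq_cells sets_point_measure sec_sets[OF S])
qed

end

subsection \<open>Product laws and label codes\<close>

text \<open>Counts of a process and of its projection are related only at points of the probability
  space, because elsewhere the process may take values outside its configuration space.\<close>

lemma (in prob_space) indep_vars_cong_on_space:
  assumes "\<And>i x. i \<in> I \<Longrightarrow> x \<in> space M \<Longrightarrow> X i x = Y i x"
  shows "indep_vars M' X I \<longleftrightarrow> indep_vars M' Y I"
proof -
  have *: "X i -` A \<inter> space M = Y i -` A \<inter> space M" if "i \<in> I" for i A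
    using assms that by auto
  have "(\<forall>i\<in>I. random_variable (M' i) (X i)) \<longleftrightarrow> (\<forall>i\<in>I. random_variable (M' i) (Y i))"
    using assms by (intro ball_cong refl measurable_cong)
  moreover have "indep_sets (\<lambda>i. {X i -` A \<inter> space M | A. A \<in> sets (M' i)}) I \<longleftrightarrow>
      indep_sets (\<lambda>i. {Y i -` A \<inter> space M | A. A \<in> sets (M' i)}) I"
    by (rule indep_sets_cong) (simp_all add: *)
  ultimately show ?thesis unfolding indep_vars_def2 by simp
qed

text \<open>The definition states independence for families indexed by natural numbers. An
  enumeration of \<open>\<D>\<close> brings the joint counts into that form, and the resulting
  product is reindexed by \<open>\<D>\<close>.\<close>

lemma poisson_point_process_fdd:
  assumes Z: "poisson_point_process P N \<mu> Z"
    and D: "finite \<D>" "disjoint \<D>" "\<D> \<subseteq> sets \<mu>" "\<And>D. D \<in> \<D> \<Longrightarrow> emeasure \<mu> D < \<infinity>"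
  shows "measure P {\<xi> \<in> space P. \<forall>D\<in>\<D>. emeasure (Z \<xi>) D = of_nat (\<kappa> D)} =
    (\<Prod>D\<in>\<D>. exp (- measure \<mu> D) * measure \<mu> D ^ \<kappa> D / fact (\<kappa> D))"
proof -
  interpret prob_space P using Z by (simp add: poisson_point_process_def)
  have pois: "measure P {\<xi> \<in> space P. emeasure (Z \<xi>) A = of_nat k} =
      exp (- measure \<mu> A) * measure \<mu> A ^ k / fact k"
    if "A \<in> sets \<mu>" "emeasure \<mu> A < \<infinity>" for A and k :: nat
    using Z that by (simp add: poisson_point_process_def)
  have ind: "indep_vars (\<lambda>_. borel) (\<lambda>i \<xi>. emeasure (Z \<xi>) (A i)) J"
    if "finite J" "A ` J \<subseteq> sets \<mu>" "disjoint_family_on A J" for A and J :: "nat set"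
    using Z that by (simp add: poisson_point_process_def)
  obtain h where h: "bij_betw h {..<card \<D>} \<D>"
    using ex_bij_betw_nat_finite[OF D(1)] by (auto simp: atLeast0LessThan)
  let ?J = "{..<card \<D>}"
  have him: "h ` ?J = \<D>" using h by (simp add: bij_betw_def)
  have hinj: "inj_on h ?J" using h by (simp add: bij_betw_def)
  have hD: "h i \<in> \<D>" if "i \<in> ?J" for i using him that by blast
  show ?thesis
  proof (cases "\<D> = {}")
    case True
    then show ?thesis by (simp add: prob_space)
  next
    case False
    then have ne: "?J \<noteq> {}" using D(1) by (simp add: card_gt_0_iff lessThan_empty_iff)
    have "disjoint_family_on h ?J"
      unfolding disjoint_family_on_def
    proof (intro ballI impI)
      fix i j assume ij: "i \<in> ?J" "j \<in> ?J" "i \<noteq> j"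
      then have "h i \<noteq> h j" using hinj by (meson inj_onD)
      then show "h i \<inter> h j = {}" using D(2) hD[OF ij(1)] hD[OF ij(2)] by (simp add: disjoint_def)
    qed
    then have "indep_vars (\<lambda>_. borel) (\<lambda>i \<xi>. emeasure (Z \<xi>) (h i)) ?J"
      using D(3) him by (intro ind) auto
    then have "prob (\<Inter>i\<in>?J. (\<lambda>\<xi>. emeasure (Z \<xi>) (h i)) -` {of_nat (\<kappa> (h i))} \<inter> space P) =
        (\<Prod>i\<in>?J. prob ((\<lambda>\<xi>. emeasure (Z \<xi>) (h i)) -` {of_nat (\<kappa> (h i))} \<inter> space P))"
      by (rule indep_varsD[OF _ ne]) auto
    also have "(\<Inter>i\<in>?J. (\<lambda>\<xi>. emeasure (Z \<xi>) (h i)) -` {of_nat (\<kappa> (h i))} \<inter> space P) =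
        {\<xi> \<in> space P. \<forall>D\<in>h ` ?J. emeasure (Z \<xi>) D = of_nat (\<kappa> D)}"
      using ne by auto
    also have "(\<Prod>i\<in>?J. prob ((\<lambda>\<xi>. emeasure (Z \<xi>) (h i)) -` {of_nat (\<kappa> (h i))} \<inter> space P)) =
        (\<Prod>i\<in>?J. exp (- measure \<mu> (h i)) * measure \<mu> (h i) ^ \<kappa> (h i) / fact (\<kappa> (h i)))"
    proof (rule prod.cong)
      fix i assume "i \<in> ?J"
      then have "h i \<in> sets \<mu>" "emeasure \<mu> (h i) < \<infinity>" using hD D(3,4) by auto
      moreover have "(\<lambda>\<xi>. emeasure (Z \<xi>) (h i)) -` {of_nat (\<kappa> (h i))} \<inter> space P =
          {\<xi> \<in> space P. emeasure (Z \<xi>) (h i) = of_nat (\<kappa> (h i))}" by auto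
      ultimately show "prob ((\<lambda>\<xi>. emeasure (Z \<xi>) (h i)) -` {of_nat (\<kappa> (h i))} \<inter> space P) =
          exp (- measure \<mu> (h i)) * measure \<mu> (h i) ^ \<kappa> (h i) / fact (\<kappa> (h i))"
        using pois by simp
    qed simp
    also have "\<dots> = (\<Prod>D\<in>h ` ?J. exp (- measure \<mu> D) * measure \<mu> D ^ \<kappa> D / fact (\<kappa> D))"
      by (simp add: prod.reindex[OF hinj])
    finally show ?thesis unfolding him .
  qed
qed

text \<open>An arbitrary, possibly non-measurable enumeration of the atoms. It enters only through
  an injection, where any choice will do, and through the assembled configuration, whose counts turn
  out not to depend on it.\<close>

definition point_measure_code :: "'a measure \<Rightarrow> 'a measure \<Rightarrow> nat set \<times> (nat \<Rightarrow> 'a)" where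
  "point_measure_code M \<omega> =
    (SOME (I, p). p \<in> I \<rightarrow> space M \<and> \<omega> = distr (count_space I) M p)"

lemma point_measure_code:
  fixes M :: "'a measure"
  assumes "\<omega> \<in> point_measures M F" "point_measure_code M \<omega> = (I, p)"
  shows "p \<in> I \<rightarrow> space M" "\<omega> = distr (count_space I) M p"
proof -
  have "\<exists>z :: nat set \<times> (nat \<Rightarrow> 'a). case z of (I, p) \<Rightarrow> p \<in> I \<rightarrow> space M \<and> \<omega> = distr (count_space I) M p"
  proof -
    obtain I :: "nat set" and p where "p \<in> I \<rightarrow> space M" "\<omega> = distr (count_space I) M p"
      using assms(1) by (rule point_measuresE)
    then show ?thesis by (intro exI[of _ "(I, p)"]) simp
  qed
  from someI_ex[OF this] show "p \<in> I \<rightarrow> space M" "\<omega> = distr (count_space I) M p"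
    using assms(2) by (auto simp: point_measure_code_def)
qed

text \<open>The definition of factors of i.i.d. fixes real sequences as labels.\<close>

lemma ex_inj_label_code:
  fixes M :: "((int \<Rightarrow> 'v) \<times> real) measure"
  assumes "countable (UNIV :: 'v set)"
  shows "\<exists>c :: real \<times> ((int \<Rightarrow> 'v) \<times> real) measure \<Rightarrow> nat \<Rightarrow> real. inj_on c (UNIV \<times> point_measures M F)"
proof -
  let ?t = "to_nat_on (UNIV :: 'v set)"
  have t: "inj ?t" using assms by (rule inj_on_to_nat_on)
  \<comment> \<open>An infinite table flattened by \<open>prod_decode\<close>: row \<open>i\<close>
    describes the \<open>i\<close>-th atom, and its columns from 3 onwards list the positions of the
    trajectory at all integer times.\<close>
  define c :: "real \<times> ((int \<Rightarrow> 'v) \<times> real) measure \<Rightarrow> nat \<Rightarrow> real" where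
    "c = (\<lambda>(u, \<omega>) n. case point_measure_code M \<omega> of (I, p) \<Rightarrow> case prod_decode n of (i, j) \<Rightarrow>
      if j = 0 then u else if j = 1 then of_bool (i \<in> I) else if j = 2 then snd (p i)
      else real (?t (fst (p i) (int_decode (j - 3)))))"
  have "inj_on c (UNIV \<times> point_measures M F)"
  proof (rule inj_onI, clarify)
    fix u \<omega> u' \<omega>'
    assume \<omega>: "\<omega> \<in> point_measures M F" "\<omega>' \<in> point_measures M F" and eq: "c (u, \<omega>) = c (u', \<omega>')"
    obtain I p I' p' where p: "point_measure_code M \<omega> = (I, p)" "point_measure_code M \<omega>' = (I', p')"
      by (metis surj_pair)
    have eq': "c (u, \<omega>) (prod_encode (i, j)) = c (u', \<omega>') (prod_encode (i, j))" for i j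
      using eq by simp
    have u: "u = u'" using eq'[of 0 0] by (simp add: c_def p)
    have "i \<in> I \<longleftrightarrow> i \<in> I'" for i using eq'[of i 1] by (simp add: c_def p of_bool_def split: if_splits)
    then have I: "I = I'" by auto
    have "fst (p i) k = fst (p' i) k" for i k
      using eq'[of i "int_encode k + 3"] injD[OF t] by (simp add: c_def p)
    moreover have "snd (p i) = snd (p' i)" for i using eq'[of i 2] by (simp add: c_def p)
    ultimately have "p i = p' i" for i by (simp add: prod_eq_iff fun_eq_iff)
    then have "p = p'" by auto
    then show "u = u' \<and> \<omega> = \<omega>'"
      using u I point_measure_code(2)[OF \<omega>(1) p(1)] point_measure_code(2)[OF \<omega>(2) p(2)] by simp
  qed
  then show ?thesis by blast
qed

text \<open>For fixed \<open>e\<close>, the law of \<open>U\<close> on the event \<open>e\<close>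
  and the product law scaled by the probability of \<open>e\<close> are finite measures agreeing on
  all finite boxes, hence equal. Independence of \<open>U\<close> from \<open>e\<close> thus extends
  from boxes to arbitrary measurable sets.\<close>

lemma prob_Int_PiM_boxes:
  fixes A :: "'i \<Rightarrow> 'a measure"
  assumes \<Omega>: "prob_space \<Omega>" and A: "\<And>i. prob_space (A i)"
    and U: "U \<in> measurable \<Omega> (PiM UNIV A)" and e: "e \<in> sets \<Omega>"
    and eq: "\<And>J X. finite J \<Longrightarrow> (\<And>i. i \<in> J \<Longrightarrow> X i \<in> sets (A i)) \<Longrightarrow>
      emeasure \<Omega> ({z \<in> space \<Omega>. \<forall>i\<in>J. U z i \<in> X i} \<inter> e) = (\<Prod>i\<in>J. emeasure (A i) (X i)) * emeasure \<Omega> e"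
    and S: "S \<in> sets (PiM UNIV A)"
  shows "emeasure \<Omega> ({z \<in> space \<Omega>. U z \<in> S} \<inter> e) = emeasure (PiM UNIV A) S * emeasure \<Omega> e"
proof -
  interpret \<Omega>: prob_space \<Omega> by (rule \<Omega>)
  let ?L = "distr (density \<Omega> (indicator e)) (PiM UNIV A) U"
  let ?R = "density (PiM UNIV A) (\<lambda>_. emeasure \<Omega> e)"
  have U': "U \<in> measurable (density \<Omega> (indicator e)) (PiM UNIV A)" using U by simp
  have L: "emeasure ?L T = emeasure \<Omega> ({z \<in> space \<Omega>. U z \<in> T} \<inter> e)" if "T \<in> sets (PiM UNIV A)" for T
  proof -
    have UT: "{z \<in> space \<Omega>. U z \<in> T} \<in> sets \<Omega>"
      using measurable_sets[OF U that] by (simp add: vimage_def Int_def conj_commute)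
    have "U -` T \<inter> space (density \<Omega> (indicator e)) = {z \<in> space \<Omega>. U z \<in> T}" by auto
    with UT have "emeasure ?L T = (\<integral>\<^sup>+z. indicator e z * indicator {z \<in> space \<Omega>. U z \<in> T} z \<partial>\<Omega>)"
      using U' that e by (simp add: emeasure_distr emeasure_density)
    also have "\<dots> = (\<integral>\<^sup>+z. indicator ({z \<in> space \<Omega>. U z \<in> T} \<inter> e) z \<partial>\<Omega>)"
      by (intro nn_integral_cong) (auto simp: indicator_def)
    also have "\<dots> = emeasure \<Omega> ({z \<in> space \<Omega>. U z \<in> T} \<inter> e)"
      using UT e by (intro nn_integral_indicator) auto
    finally show ?thesis .
  qed
  have R: "emeasure ?R T = emeasure (PiM UNIV A) T * emeasure \<Omega> e" if "T \<in> sets (PiM UNIV A)" for T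
    using that by (simp add: emeasure_density nn_integral_cmult_indicator mult.commute[of _ "emeasure \<Omega> e"])
  have "?L = ?R"
  proof (rule measure_eqI_PiM_infinite)
    fix X and J :: "'i set" assume J: "finite J" "\<And>i. i \<in> J \<Longrightarrow> X i \<in> sets (A i)"
    have box: "prod_emb UNIV A J (Pi\<^sub>E J X) \<in> sets (PiM UNIV A)"
      using J by (intro sets_PiM_I) auto
    have "{z \<in> space \<Omega>. U z \<in> prod_emb UNIV A J (Pi\<^sub>E J X)} = {z \<in> space \<Omega>. \<forall>i\<in>J. U z i \<in> X i}"
      using measurable_space[OF U] by (auto simp: prod_emb_def space_PiM PiE_iff)
    then show "emeasure ?L (prod_emb UNIV A J (Pi\<^sub>E J X)) = emeasure ?R (prod_emb UNIV A J (Pi\<^sub>E J X))"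
      unfolding L[OF box] R[OF box] using eq[OF J] J
      by (simp add: emeasure_PiM_emb[OF A])
  next
    show "finite_measure ?L"
    proof
      show "emeasure ?L (space ?L) \<noteq> \<infinity>"
        by (subst L) (auto simp: \<Omega>.emeasure_eq_measure)
    qed
  qed auto
  then show ?thesis using L[OF S] R[OF S] by simp
qed

text \<open>The preceding lemma is applied twice: with a finite box in the second components as
  event, to reach arbitrary sets in the first, and then with such a set as event, to reach arbitrary
  sets in the second. One family of labels can thereby serve as two independent families.\<close>

lemma distr_PiM_pair:
  fixes \<theta> :: "'l measure" and A :: "'a measure" and B :: "'b measure"
  assumes "prob_space \<theta>" "prob_space A" "prob_space B"
    and d1: "d1 \<in> measurable \<theta> A" and d2: "d2 \<in> measurable \<theta> B"
    and distr: "distr \<theta> (A \<Otimes>\<^sub>M B) (\<lambda>l. (d1 l, d2 l)) = A \<Otimes>\<^sub>M B"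
  shows "distr (PiM (UNIV :: 'i set) (\<lambda>_. \<theta>)) (PiM UNIV (\<lambda>_. A) \<Otimes>\<^sub>M PiM UNIV (\<lambda>_. B))
      (\<lambda>\<eta>. (\<lambda>x. d1 (\<eta> x), \<lambda>x. d2 (\<eta> x))) = PiM UNIV (\<lambda>_. A) \<Otimes>\<^sub>M PiM UNIV (\<lambda>_. B)"
proof -
  let ?\<Theta> = "PiM (UNIV :: 'i set) (\<lambda>_. \<theta>)"
  interpret \<theta>: prob_space \<theta> by fact
  interpret A: prob_space A by fact
  interpret B: prob_space B by fact
  interpret P\<theta>: prob_space ?\<Theta> by (intro prob_space_PiM assms)
  interpret PA: prob_space "PiM (UNIV :: 'i set) (\<lambda>_. A)" by (intro prob_space_PiM assms)
  interpret PB: prob_space "PiM (UNIV :: 'i set) (\<lambda>_. B)" by (intro prob_space_PiM assms)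
  have U: "(\<lambda>\<eta> x. d1 (\<eta> x)) \<in> measurable ?\<Theta> (PiM UNIV (\<lambda>_. A))"
    using d1
    by (intro measurable_PiM_single') (auto simp: space_PiM PiE_iff intro: measurable_space[OF d1])
  have V: "(\<lambda>\<eta> x. d2 (\<eta> x)) \<in> measurable ?\<Theta> (PiM UNIV (\<lambda>_. B))"
    using d2
    by (intro measurable_PiM_single') (auto simp: space_PiM PiE_iff intro: measurable_space[OF d2])
  have boxes: "emeasure ?\<Theta> ({\<eta> \<in> space ?\<Theta>. \<forall>i\<in>J. d1 (\<eta> i) \<in> X i} \<inter> {\<eta> \<in> space ?\<Theta>. \<forall>i\<in>K. d2 (\<eta> i) \<in> Y i}) =
      (\<Prod>i\<in>J. emeasure A (X i)) * (\<Prod>i\<in>K. emeasure B (Y i))"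
    if J: "finite J" "\<And>i. i \<in> J \<Longrightarrow> X i \<in> sets A" and K: "finite K" "\<And>i. i \<in> K \<Longrightarrow> Y i \<in> sets B"
    for J K :: "'i set" and X Y
  proof -
    \<comment> \<open>Padding by the whole space gives every coordinate in
      \<open>J \<union> K\<close> a rectangle, whose probability factorises by assumption. The
      padded factors equal 1 and drop out again at the end.\<close>
    define X' where "X' i = (if i \<in> J then X i else space A)" for i
    define Y' where "Y' i = (if i \<in> K then Y i else space B)" for i
    define Z where "Z i = {l \<in> space \<theta>. d1 l \<in> X' i \<and> d2 l \<in> Y' i}" for i
    have XY: "X' i \<in> sets A" "Y' i \<in> sets B" for i using J K by (auto simp: X'_def Y'_def)
    have Z_sets: "Z i \<in> sets \<theta>" for i
    proof -
      have "Z i = (d1 -` X' i \<inter> space \<theta>) \<inter> (d2 -` Y' i \<inter> space \<theta>)" by (auto simp: Z_def)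
      then show ?thesis using measurable_sets[OF d1 XY(1)] measurable_sets[OF d2 XY(2)] by auto
    qed
    have Z: "emeasure \<theta> (Z i) = emeasure A (X' i) * emeasure B (Y' i)" for i
    proof -
      have "emeasure A (X' i) * emeasure B (Y' i) = emeasure (A \<Otimes>\<^sub>M B) (X' i \<times> Y' i)"
        using XY by (simp add: B.emeasure_pair_measure_Times)
      also have "\<dots> = emeasure (distr \<theta> (A \<Otimes>\<^sub>M B) (\<lambda>l. (d1 l, d2 l))) (X' i \<times> Y' i)"
        by (simp only: distr)
      also have "\<dots> = emeasure \<theta> ((\<lambda>l. (d1 l, d2 l)) -` (X' i \<times> Y' i) \<inter> space \<theta>)"
        using d1 d2 XY by (intro emeasure_distr) auto
      also have "(\<lambda>l. (d1 l, d2 l)) -` (X' i \<times> Y' i) \<inter> space \<theta> = Z i" by (auto simp: Z_def)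
      finally show ?thesis by simp
    qed
    have "{\<eta> \<in> space ?\<Theta>. \<forall>i\<in>J. d1 (\<eta> i) \<in> X i} \<inter> {\<eta> \<in> space ?\<Theta>. \<forall>i\<in>K. d2 (\<eta> i) \<in> Y i} =
        prod_emb UNIV (\<lambda>_. \<theta>) (J \<union> K) (Pi\<^sub>E (J \<union> K) Z)"
      using measurable_space[OF d1] measurable_space[OF d2]
      by (auto simp: prod_emb_def space_PiM PiE_iff Z_def X'_def Y'_def split: if_splits)
    then have "emeasure ?\<Theta> ({\<eta> \<in> space ?\<Theta>. \<forall>i\<in>J. d1 (\<eta> i) \<in> X i} \<inter> {\<eta> \<in> space ?\<Theta>. \<forall>i\<in>K. d2 (\<eta> i) \<in> Y i}) =
        (\<Prod>i\<in>J \<union> K. emeasure \<theta> (Z i))"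
      using J K Z_sets by (simp add: emeasure_PiM_emb \<theta>.prob_space_axioms)
    also have "\<dots> = (\<Prod>i\<in>J \<union> K. emeasure A (X' i)) * (\<Prod>i\<in>J \<union> K. emeasure B (Y' i))"
      by (simp add: Z prod.distrib)
    also have "(\<Prod>i\<in>J \<union> K. emeasure A (X' i)) = (\<Prod>i\<in>J. emeasure A (X' i))"
      using J(1) K(1) by (intro prod.mono_neutral_right) (auto simp: X'_def A.emeasure_space_1)
    also have "(\<Prod>i\<in>J \<union> K. emeasure B (Y' i)) = (\<Prod>i\<in>K. emeasure B (Y' i))"
      using J(1) K(1) by (intro prod.mono_neutral_right) (auto simp: Y'_def B.emeasure_space_1)
    finally show ?thesis by (simp add: X'_def Y'_def cong: prod.cong)
  qed
  have UJ: "{\<eta> \<in> space ?\<Theta>. \<forall>i\<in>J. d1 (\<eta> i) \<in> X i} \<in> sets ?\<Theta>"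
    if "finite J" "\<And>i. i \<in> J \<Longrightarrow> X i \<in> sets A" for J :: "'i set" and X
    using that d1 by (intro sets.sets_Collect_finite_All) (auto intro!: measurable_sets_Collect)
  have VJ: "{\<eta> \<in> space ?\<Theta>. \<forall>i\<in>J. d2 (\<eta> i) \<in> X i} \<in> sets ?\<Theta>"
    if "finite J" "\<And>i. i \<in> J \<Longrightarrow> X i \<in> sets B" for J :: "'i set" and X
    using that d2 by (intro sets.sets_Collect_finite_All) (auto intro!: measurable_sets_Collect)
  have one: "emeasure ?\<Theta> {\<eta> \<in> space ?\<Theta>. \<forall>i\<in>K. d2 (\<eta> i) \<in> Y i} = (\<Prod>i\<in>K. emeasure B (Y i))"
    if "finite K" "\<And>i. i \<in> K \<Longrightarrow> Y i \<in> sets B" for K :: "'i set" and Y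
    using boxes[of "{}" _ K Y] that by (simp add: Int_absorb1)
  have half: "emeasure ?\<Theta> ({\<eta> \<in> space ?\<Theta>. (\<lambda>x. d1 (\<eta> x)) \<in> S} \<inter> {\<eta> \<in> space ?\<Theta>. \<forall>i\<in>K. d2 (\<eta> i) \<in> Y i}) =
      emeasure (PiM UNIV (\<lambda>_. A)) S * (\<Prod>i\<in>K. emeasure B (Y i))"
    if S: "S \<in> sets (PiM UNIV (\<lambda>_. A))" and K: "finite K" "\<And>i. i \<in> K \<Longrightarrow> Y i \<in> sets B" for S and K :: "'i set" and Y
    using prob_Int_PiM_boxes[OF P\<theta>.prob_space_axioms A.prob_space_axioms U VJ[OF K] _ S]
      boxes[OF _ _ K] one[OF K] by simp
  have first: "emeasure ?\<Theta> {\<eta> \<in> space ?\<Theta>. (\<lambda>x. d1 (\<eta> x)) \<in> S} = emeasure (PiM UNIV (\<lambda>_. A)) S"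
    if "S \<in> sets (PiM UNIV (\<lambda>_. A))" for S
    using half[OF that, of "{}"] by (simp add: Int_absorb2)
  have S_ev: "{\<eta> \<in> space ?\<Theta>. (\<lambda>x. d1 (\<eta> x)) \<in> S} \<in> sets ?\<Theta>" if "S \<in> sets (PiM UNIV (\<lambda>_. A))" for S
    using measurable_sets[OF U that] by (simp add: vimage_def Int_def conj_commute)
  have full: "emeasure ?\<Theta> ({\<eta> \<in> space ?\<Theta>. (\<lambda>x. d2 (\<eta> x)) \<in> R} \<inter> {\<eta> \<in> space ?\<Theta>. (\<lambda>x. d1 (\<eta> x)) \<in> S}) =
      emeasure (PiM UNIV (\<lambda>_. B)) R * emeasure (PiM UNIV (\<lambda>_. A)) S"
    if S: "S \<in> sets (PiM UNIV (\<lambda>_. A))" and R: "R \<in> sets (PiM UNIV (\<lambda>_. B))" for S R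
    using prob_Int_PiM_boxes[OF P\<theta>.prob_space_axioms B.prob_space_axioms V S_ev[OF S] _ R]
      half[OF S] first[OF S] by (simp add: Int_commute mult.commute)
  show ?thesis
  proof (rule pair_measure_eqI[symmetric])
    fix S R assume SR: "S \<in> sets (PiM (UNIV :: 'i set) (\<lambda>_. A))" "R \<in> sets (PiM (UNIV :: 'i set) (\<lambda>_. B))"
    have "emeasure (distr ?\<Theta> (PiM UNIV (\<lambda>_. A) \<Otimes>\<^sub>M PiM UNIV (\<lambda>_. B)) (\<lambda>\<eta>. (\<lambda>x. d1 (\<eta> x), \<lambda>x. d2 (\<eta> x)))) (S \<times> R) =
        emeasure ?\<Theta> ((\<lambda>\<eta>. (\<lambda>x. d1 (\<eta> x), \<lambda>x. d2 (\<eta> x))) -` (S \<times> R) \<inter> space ?\<Theta>)"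
      using U V SR by (intro emeasure_distr) auto
    also have "(\<lambda>\<eta>. (\<lambda>x. d1 (\<eta> x), \<lambda>x. d2 (\<eta> x))) -` (S \<times> R) \<inter> space ?\<Theta> =
        {\<eta> \<in> space ?\<Theta>. (\<lambda>x. d2 (\<eta> x)) \<in> R} \<inter> {\<eta> \<in> space ?\<Theta>. (\<lambda>x. d1 (\<eta> x)) \<in> S}" by auto
    also note full[OF SR]
    finally show "emeasure (PiM UNIV (\<lambda>_. A)) S * emeasure (PiM UNIV (\<lambda>_. B)) R =
        emeasure (distr ?\<Theta> (PiM UNIV (\<lambda>_. A) \<Otimes>\<^sub>M PiM UNIV (\<lambda>_. B)) (\<lambda>\<eta>. (\<lambda>x. d1 (\<eta> x), \<lambda>x. d2 (\<eta> x)))) (S \<times> R)"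
      by (simp add: mult.commute)
  qed (auto intro: PA.sigma_finite_measure_axioms PB.sigma_finite_measure_axioms)
qed

section \<open>Diffuse labels\<close>

definition unit_uniform :: "real measure" where
  "unit_uniform = uniform_measure lborel {0..1}"

lemma prob_space_unit_uniform: "prob_space unit_uniform"
  unfolding unit_uniform_def by (rule prob_space_uniform_measure) auto

lemma sets_unit_uniform [measurable_cong]: "sets unit_uniform = sets borel"
  by (simp add: unit_uniform_def)

lemma emeasure_unit_uniform_singleton: "emeasure unit_uniform {u} = 0"
proof -
  have "emeasure lborel ({0..1} \<inter> {u}) \<le> emeasure lborel {u}" by (intro emeasure_mono) auto
  then show ?thesis by (simp add: unit_uniform_def emeasure_uniform_measure)
qed

text \<open>Two distinct coordinates have the product law, which gives the diagonal measure zero by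
  Fubini because points are null. Countability of the index set leaves only countably many pairs to
  exclude.\<close>

lemma AE_inj_PiM_unit_uniform:
  assumes "countable (UNIV :: 'i set)"
  shows "AE U in PiM (UNIV :: 'i set) (\<lambda>_. unit_uniform). inj U"
proof -
  let ?P = "PiM (UNIV :: 'i set) (\<lambda>_. unit_uniform)"
  interpret u: prob_space unit_uniform by (rule prob_space_unit_uniform)
  interpret P: prob_space ?P by (rule prob_space_PiM) (rule prob_space_unit_uniform)
  have ne: "AE U in ?P. U x \<noteq> U y" if "x \<noteq> y" for x y :: 'i
  proof -
    let ?D = "{z :: real \<times> real. fst z = snd z}"
    have D: "?D \<in> sets (unit_uniform \<Otimes>\<^sub>M unit_uniform)"
    proof -
      have "{z \<in> space (borel \<Otimes>\<^sub>M borel :: (real \<times> real) measure). fst z = snd z} \<in> sets (borel \<Otimes>\<^sub>M borel)"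
        by measurable
      then show ?thesis by (simp add: space_pair_measure cong: sets_pair_measure_cong[OF sets_unit_uniform sets_unit_uniform])
    qed
    have "emeasure (unit_uniform \<Otimes>\<^sub>M unit_uniform) ?D = (\<integral>\<^sup>+a. emeasure unit_uniform (Pair a -` ?D) \<partial>unit_uniform)"
      using D by (rule u.emeasure_pair_measure_alt)
    also have "\<dots> = (\<integral>\<^sup>+a. 0 \<partial>unit_uniform)"
    proof (rule nn_integral_cong)
      fix a :: real
      have "Pair a -` ?D = {a}" by auto
      then show "emeasure unit_uniform (Pair a -` ?D) = 0" by (simp add: emeasure_unit_uniform_singleton)
    qed
    finally have D0: "emeasure (unit_uniform \<Otimes>\<^sub>M unit_uniform) ?D = 0" by simp
    have m: "(\<lambda>U. U i) \<in> measurable ?P unit_uniform" for i by measurable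
    have "distr ?P (unit_uniform \<Otimes>\<^sub>M unit_uniform) (\<lambda>U. (U x, U y)) = unit_uniform \<Otimes>\<^sub>M unit_uniform"
    proof (rule pair_measure_eqI[symmetric])
      fix S R assume SR: "S \<in> sets unit_uniform" "R \<in> sets unit_uniform"
      have "emeasure (distr ?P (unit_uniform \<Otimes>\<^sub>M unit_uniform) (\<lambda>U. (U x, U y))) (S \<times> R) =
          emeasure ?P ((\<lambda>U. (U x, U y)) -` (S \<times> R) \<inter> space ?P)"
        using SR m by (intro emeasure_distr) auto
      also have "(\<lambda>U. (U x, U y)) -` (S \<times> R) \<inter> space ?P =
          prod_emb UNIV (\<lambda>_. unit_uniform) {x, y} (Pi\<^sub>E {x, y} (\<lambda>i. if i = x then S else R))"
        using that by (auto simp: prod_emb_def space_PiM PiE_iff)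
      also have "emeasure ?P \<dots> = (\<Prod>i\<in>{x, y}. emeasure unit_uniform (if i = x then S else R))"
        using SR by (intro emeasure_PiM_emb prob_space_unit_uniform) auto
      also have "\<dots> = emeasure unit_uniform S * emeasure unit_uniform R" using that by simp
      finally show "emeasure unit_uniform S * emeasure unit_uniform R =
          emeasure (distr ?P (unit_uniform \<Otimes>\<^sub>M unit_uniform) (\<lambda>U. (U x, U y))) (S \<times> R)" by simp
    qed (auto intro: u.sigma_finite_measure_axioms)
    then have "emeasure (distr ?P (unit_uniform \<Otimes>\<^sub>M unit_uniform) (\<lambda>U. (U x, U y))) ?D = 0" using D0 by simp
    then have "emeasure ?P ((\<lambda>U. (U x, U y)) -` ?D \<inter> space ?P) = 0"
      using D m by (subst (asm) emeasure_distr) auto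
    moreover have "(\<lambda>U. (U x, U y)) -` ?D \<inter> space ?P \<in> sets ?P"
      using m by (intro measurable_sets[OF _ D]) auto
    ultimately show ?thesis by (intro AE_I) auto
  qed
  have "AE U in ?P. \<forall>z\<in>(UNIV :: ('i \<times> 'i) set). fst z \<noteq> snd z \<longrightarrow> U (fst z) \<noteq> U (snd z)"
    using assms ne by (subst AE_ball_countable) (auto intro: countable_SIGMA[of UNIV "\<lambda>_. UNIV", simplified])
  then show ?thesis by eventually_elim (auto simp: inj_def)
qed

subsection \<open>Selecting automorphisms by labels\<close>

lemma graph_Aut_comp: "\<phi> \<in> graph_Aut E \<Longrightarrow> \<psi> \<in> graph_Aut E \<Longrightarrow> \<phi> \<circ> \<psi> \<in> graph_Aut E"
  by (auto simp: graph_Aut_def bij_comp)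

lemma graph_Aut_inv:
  assumes "\<phi> \<in> graph_Aut E"
  shows "inv \<phi> \<in> graph_Aut E"
proof -
  have bij: "bij \<phi>" using assms by (simp add: graph_Aut_def)
  have "{inv \<phi> x, inv \<phi> y} \<in> E \<longleftrightarrow> {x, y} \<in> E" for x y
  proof -
    have "{\<phi> (inv \<phi> x), \<phi> (inv \<phi> y)} \<in> E \<longleftrightarrow> {inv \<phi> x, inv \<phi> y} \<in> E"
      using assms by (simp add: graph_Aut_def)
    then show ?thesis using bij by (simp add: bij_is_surj surj_f_inv_f)
  qed
  then show ?thesis using bij by (simp add: graph_Aut_def bij_imp_bij_inv)
qed

lemma graph_Aut_inv_f [simp]: "\<phi> \<in> graph_Aut E \<Longrightarrow> inv \<phi> (\<phi> x) = x"
  by (simp add: graph_Aut_def bij_is_inj)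

lemma graph_Aut_f_inv [simp]: "\<phi> \<in> graph_Aut E \<Longrightarrow> \<phi> (inv \<phi> x) = x"
  by (simp add: graph_Aut_def bij_is_surj surj_f_inv_f)

lemma graph_Aut_edge: "\<phi> \<in> graph_Aut E \<Longrightarrow> {\<phi> x, \<phi> y} \<in> E \<longleftrightarrow> {x, y} \<in> E"
  by (simp add: graph_Aut_def)

lemma connected_graph_reach_induct [consumes 1, case_names root step]:
  assumes "connected_graph E" "P x" "\<And>u v. P u \<Longrightarrow> {u, v} \<in> E \<Longrightarrow> P v"
  shows "P v"
proof -
  have "(x, v) \<in> {(u, v). {u, v} \<in> E}\<^sup>*" using assms(1) by (simp add: connected_graph_def)
  then show ?thesis by (induction rule: rtrancl_induct) (use assms in auto)
qed

text \<open>The endpoints of walks of a given length from a fixed vertex are finite in number by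
  local finiteness, and connectedness makes these sets exhaust the graph.\<close>

lemma countable_vertices:
  fixes E :: "'v set set"
  assumes "connected_graph E" "locally_finite_graph E"
  shows "countable (UNIV :: 'v set)"
proof -
  fix o' :: 'v
  let ?r = "{(u, v). {u, v} \<in> E}"
  have "finite ((?r ^^ n) `` {o'})" for n
  proof (induction n)
    case (Suc n)
    have "(?r ^^ Suc n) `` {o'} \<subseteq> (\<Union>u\<in>(?r ^^ n) `` {o'}. nbrs E u)"
      by (auto simp: nbrs_def)
    moreover have "finite \<dots>" using Suc assms(2) by (auto simp: locally_finite_graph_def)
    ultimately show ?case by (rule finite_subset)
  qed auto
  then have "countable (\<Union>n. (?r ^^ n) `` {o'})" by (intro countable_UN) (auto intro: countable_finite)
  moreover have "(\<Union>n. (?r ^^ n) `` {o'}) = UNIV"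
    using assms(1) unfolding connected_graph_def by (auto simp: rtrancl_is_UN_relpow)
  ultimately show ?thesis by simp
qed

locale rooted_transitive_graph =
  fixes E :: "'v set set" and root :: 'v
  assumes connected: "connected_graph E"
    and locally_finite: "locally_finite_graph E"
    and transitive: "transitive_graph E"
begin

lemma countable_V: "countable (UNIV :: 'v set)"
  by (rule countable_vertices[OF connected locally_finite])

text \<open>The root need not come first in this enumeration: its image is prescribed by
  \<open>Aut_to\<close>, not by the greedy choice.\<close>

definition vtx :: "nat \<Rightarrow> 'v" where "vtx = from_nat_into UNIV"

definition idx :: "'v \<Rightarrow> nat" where "idx = to_nat_on UNIV"

lemma vtx_idx [simp]: "vtx (idx v) = v"
  by (simp add: vtx_def idx_def countable_V)

definition Aut_to :: "'v \<Rightarrow> ('v \<Rightarrow> 'v) set" where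
  "Aut_to x = {\<phi> \<in> graph_Aut E. \<phi> root = x}"

text \<open>
  Among the automorphisms taking the root to \<open>x\<close> we select the one whose sequence of labels
  \<open>U (\<phi> (vtx 0)), U (\<phi> (vtx 1)), \<dots>\<close> is lexicographically minimal.  It is built
  greedily: \<open>greedy U x k\<close> lists the images of the first \<open>k\<close> vertices.
\<close>

definition cand :: "'v \<Rightarrow> 'v list \<Rightarrow> 'v set" where
  "cand x xs = {\<psi> (vtx (length xs)) | \<psi>. \<psi> \<in> Aut_to x \<and> (\<forall>i<length xs. \<psi> (vtx i) = xs ! i)}"

text \<open>\<open>SOME\<close> resolves ties for labels that are not injective, so the selection is
  an automorphism for every \<open>U\<close>; injectivity is called upon only for
  equivariance.\<close>

definition least_label :: "('v \<Rightarrow> real) \<Rightarrow> 'v set \<Rightarrow> 'v" where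
  "least_label U S = (SOME y. y \<in> S \<and> (\<forall>z\<in>S. U y \<le> U z))"

fun greedy :: "('v \<Rightarrow> real) \<Rightarrow> 'v \<Rightarrow> nat \<Rightarrow> 'v list" where
  "greedy U x 0 = []"
| "greedy U x (Suc k) = greedy U x k @ [least_label U (cand x (greedy U x k))]"

definition sel :: "('v \<Rightarrow> real) \<Rightarrow> 'v \<Rightarrow> 'v \<Rightarrow> 'v" where
  "sel U x v = greedy U x (Suc (idx v)) ! idx v"

lemma Aut_to_nonempty: "Aut_to x \<noteq> {}"
  using transitive by (auto simp: transitive_graph_def Aut_to_def)

text \<open>Along a path from the root: the root has the single image \<open>x\<close>, and a
  neighbour of \<open>u\<close> must go to one of the finitely many neighbours of an image of
  \<open>u\<close>.\<close>

lemma finite_images: "finite ((\<lambda>\<phi>. \<phi> v) ` Aut_to x)"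
  using connected
proof (induction v rule: connected_graph_reach_induct[where x = root])
  case root
  have "(\<lambda>\<phi>. \<phi> root) ` Aut_to x \<subseteq> {x}" by (auto simp: Aut_to_def)
  then show ?case by (rule finite_subset) simp
next
  case (step u v)
  have "(\<lambda>\<phi>. \<phi> v) ` Aut_to x \<subseteq> (\<Union>y\<in>(\<lambda>\<phi>. \<phi> u) ` Aut_to x. nbrs E y)"
    using step(2) by (auto simp: Aut_to_def nbrs_def graph_Aut_edge)
  moreover have "finite \<dots>" using step(1) locally_finite unfolding locally_finite_graph_def by blast
  ultimately show ?case by (rule finite_subset)
qed

lemma finite_cand: "finite (cand x xs)"
  by (rule finite_subset[OF _ finite_images[of "vtx (length xs)" x]]) (auto simp: cand_def)

lemma least_label:
  assumes "finite S" "S \<noteq> {}"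
  shows "least_label U S \<in> S" "z \<in> S \<Longrightarrow> U (least_label U S) \<le> U z"
proof -
  have "\<exists>y. y \<in> S \<and> (\<forall>z\<in>S. U y \<le> U z)"
    using ex_min_if_finite[of "U ` S"] assms by (force simp: not_less)
  from someI_ex[OF this] show "least_label U S \<in> S" "z \<in> S \<Longrightarrow> U (least_label U S) \<le> U z"
    by (auto simp: least_label_def)
qed

lemma least_label_eq:
  assumes "finite S" "inj U" "y \<in> S" "\<And>z. z \<in> S \<Longrightarrow> U y \<le> U z"
  shows "least_label U S = y"
proof -
  have "S \<noteq> {}" using assms(3) by auto
  then have "U (least_label U S) = U y"
    using least_label[OF assms(1), where U=U] assms(3,4) by (meson antisym)
  then show ?thesis using assms(2) by (simp add: inj_eq)
qed

lemma length_greedy [simp]: "length (greedy U x k) = k"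
  by (induction k) auto

text \<open>The greedy construction never gets stuck: each new entry is taken from
  \<open>cand\<close>, so some automorphism realises it together with all the earlier
  entries.\<close>

lemma greedy_realized: "\<exists>\<psi>\<in>Aut_to x. \<forall>i<k. \<psi> (vtx i) = greedy U x k ! i"
proof (induction k)
  case 0
  then show ?case using Aut_to_nonempty by auto
next
  case (Suc k)
  then have "cand x (greedy U x k) \<noteq> {}" by (auto simp: cand_def)
  then have "least_label U (cand x (greedy U x k)) \<in> cand x (greedy U x k)"
    by (rule least_label(1)[OF finite_cand])
  then obtain \<psi> where "\<psi> \<in> Aut_to x" "\<forall>i<k. \<psi> (vtx i) = greedy U x k ! i"
    "\<psi> (vtx k) = least_label U (cand x (greedy U x k))"
    by (auto simp: cand_def)
  then show ?case by (intro bexI[of _ \<psi>]) (auto simp: nth_append less_Suc_eq)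
qed

lemma cand_greedy_nonempty: "cand x (greedy U x k) \<noteq> {}"
  using greedy_realized[where k=k and x=x and U=U] by (auto simp: cand_def)

lemma greedy_nth: "i < k \<Longrightarrow> greedy U x k ! i = greedy U x (Suc i) ! i"
proof (induction k)
  case (Suc k)
  then show ?case by (cases "i = k") (auto simp: nth_append)
qed simp

text \<open>The realising automorphism changes with the length of the list, but the entries already
  chosen do not. Hence \<open>sel U x\<close> is a pointwise limit of automorphisms and agrees with
  one of them on each finite set.\<close>

lemma sel_realized:
  assumes "finite S"
  shows "\<exists>\<psi>\<in>Aut_to x. \<forall>v\<in>S. sel U x v = \<psi> v"
proof -
  obtain k where k: "\<forall>i\<in>idx ` S. i < k"
    using assms by (meson finite_imageI finite_nat_set_iff_bounded)
  obtain \<psi> where \<psi>: "\<psi> \<in> Aut_to x" "\<And>i. i < k \<Longrightarrow> \<psi> (vtx i) = greedy U x k ! i"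
    using greedy_realized[where k=k and x=x and U=U] by auto
  have "sel U x v = \<psi> v" if "v \<in> S" for v
    using \<psi>(2)[of "idx v"] k that greedy_nth[where i="idx v" and k=k and U=U and x=x] by (auto simp: sel_def)
  then show ?thesis using \<psi>(1) by blast
qed

text \<open>Each property is reduced to a finite set of vertices: one for the root, two for
  injectivity and for edges. Surjectivity, which is not of this kind, is propagated along paths from
  \<open>x\<close>.\<close>

lemma sel_in_Aut_to: "sel U x \<in> Aut_to x"
proof -
  have root: "sel U x root = x"
    using sel_realized[where S="{root}" and U=U and x=x] by (auto simp: Aut_to_def)
  have inj: "inj (sel U x)"
  proof (rule injI)
    fix u v assume eq: "sel U x u = sel U x v"
    obtain \<psi> where "\<psi> \<in> Aut_to x" "\<forall>w\<in>{u, v}. sel U x w = \<psi> w" using sel_realized[where S="{u, v}" and U=U and x=x] by auto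
    then show "u = v" using eq by (auto simp: Aut_to_def graph_Aut_def bij_def inj_eq)
  qed
  have edge: "{sel U x u, sel U x v} \<in> E \<longleftrightarrow> {u, v} \<in> E" for u v
  proof -
    obtain \<psi> where "\<psi> \<in> Aut_to x" "\<forall>w\<in>{u, v}. sel U x w = \<psi> w" using sel_realized[where S="{u, v}" and U=U and x=x] by auto
    then show ?thesis by (auto simp: Aut_to_def graph_Aut_edge)
  qed
  have "y \<in> range (sel U x)" for y
    using connected
  proof (induction y rule: connected_graph_reach_induct[where x = x])
    case root
    then show ?case using \<open>sel U x root = x\<close> by (metis rangeI)
  next
    case (step y z)
    then obtain u where u: "y = sel U x u" by auto
    \<comment> \<open>The preimage of a neighbour of \<open>sel U x u\<close> has to be a neighbour
      of \<open>u\<close>, so agreement with one automorphism on this finite set suffices to find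
      it.\<close>
    have "finite (insert u (nbrs E u))" using locally_finite by (simp add: locally_finite_graph_def)
    then obtain \<psi> where \<psi>: "\<psi> \<in> Aut_to x" "\<And>w. w \<in> insert u (nbrs E u) \<Longrightarrow> sel U x w = \<psi> w"
      using sel_realized[where S="insert u (nbrs E u)" and U=U and x=x] by blast
    have A: "\<psi> \<in> graph_Aut E" using \<psi>(1) by (simp add: Aut_to_def)
    have "{\<psi> u, \<psi> (inv \<psi> z)} \<in> E" using step(2) u \<psi>(2)[of u] A by simp
    then have "inv \<psi> z \<in> nbrs E u" using A by (simp only: graph_Aut_edge nbrs_def mem_Collect_eq)
    then have "sel U x (inv \<psi> z) = z" using \<psi>(2) A by simp
    then show ?case by (metis rangeI)
  qed
  then show ?thesis using root inj edge by (auto simp: Aut_to_def graph_Aut_def bij_def)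
qed

lemma sel_in_Aut: "sel U x \<in> graph_Aut E" and sel_root: "sel U x root = x"
  using sel_in_Aut_to[of U x] by (auto simp: Aut_to_def)

text \<open>Left composition with \<open>\<phi>\<close>, inverted by composition with
  \<open>inv \<phi>\<close>, matches the automorphisms realising \<open>xs\<close> with those
  realising \<open>map \<phi> xs\<close>.\<close>

lemma cand_act:
  assumes \<phi>: "\<phi> \<in> graph_Aut E"
  shows "cand (\<phi> x) (map \<phi> xs) = \<phi> ` cand x xs"
proof (intro set_eqI iffI)
  fix y assume "y \<in> cand (\<phi> x) (map \<phi> xs)"
  then obtain \<psi> where \<psi>: "y = \<psi> (vtx (length xs))" "\<psi> \<in> Aut_to (\<phi> x)" "\<forall>i<length xs. \<psi> (vtx i) = \<phi> (xs ! i)"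
    by (auto simp: cand_def)
  then have "inv \<phi> \<circ> \<psi> \<in> Aut_to x" "\<forall>i<length xs. (inv \<phi> \<circ> \<psi>) (vtx i) = xs ! i"
    using \<phi> by (auto simp: Aut_to_def intro!: graph_Aut_comp graph_Aut_inv)
  then have "(inv \<phi> \<circ> \<psi>) (vtx (length xs)) \<in> cand x xs" by (auto simp: cand_def simp del: o_apply)
  then have "\<phi> ((inv \<phi> \<circ> \<psi>) (vtx (length xs))) \<in> \<phi> ` cand x xs" by (rule imageI)
  then show "y \<in> \<phi> ` cand x xs" using \<phi> \<psi>(1) by simp
next
  fix y assume "y \<in> \<phi> ` cand x xs"
  then obtain \<psi> where \<psi>: "y = \<phi> (\<psi> (vtx (length xs)))" "\<psi> \<in> Aut_to x" "\<forall>i<length xs. \<psi> (vtx i) = xs ! i"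
    by (auto simp: cand_def)
  then have "\<phi> \<circ> \<psi> \<in> Aut_to (\<phi> x)" "\<forall>i<length xs. (\<phi> \<circ> \<psi>) (vtx i) = map \<phi> xs ! i"
    using \<phi> by (auto simp: Aut_to_def intro!: graph_Aut_comp)
  then have "(\<phi> \<circ> \<psi>) (vtx (length (map \<phi> xs))) \<in> cand (\<phi> x) (map \<phi> xs)"
    unfolding cand_def by (simp del: o_apply) blast
  then show "y \<in> cand (\<phi> x) (map \<phi> xs)" using \<psi>(1) by simp
qed

text \<open>The relabelled value at \<open>\<phi> y\<close> is the old value at \<open>y\<close>, so
  \<open>\<phi>\<close> carries minimisers to minimisers. Distinct labels make the minimiser unique,
  and the two choices must correspond.\<close>

lemma greedy_act:
  assumes \<phi>: "\<phi> \<in> graph_Aut E" and U: "inj U"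
  shows "greedy (\<lambda>v. U (inv \<phi> v)) (\<phi> x) k = map \<phi> (greedy U x k)"
proof (induction k)
  case (Suc k)
  let ?S = "cand x (greedy U x k)"
  have "inj (inv \<phi>)" using graph_Aut_inv[OF \<phi>] by (simp add: graph_Aut_def bij_def)
  then have inj: "inj (\<lambda>v. U (inv \<phi> v))" using U by (simp add: inj_def)
  have "least_label (\<lambda>v. U (inv \<phi> v)) (\<phi> ` ?S) = \<phi> (least_label U ?S)"
    using least_label[OF finite_cand cand_greedy_nonempty[where U=U and k=k and x=x], where U=U] \<phi>
    by (intro least_label_eq inj) (auto intro: finite_cand)
  then show ?case using Suc by (simp add: cand_act[OF \<phi>])
qed simp

lemma sel_act:
  assumes "\<phi> \<in> graph_Aut E" "inj U"
  shows "sel (\<lambda>v. U (inv \<phi> v)) (\<phi> x) v = \<phi> (sel U x v)"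
  unfolding sel_def greedy_act[OF assms] by (subst nth_map) simp_all

section \<open>Measurability of the selection\<close>

lemma measurable_least_label:
  assumes "finite S" "\<And>v. (\<lambda>U. U v) \<in> borel_measurable A"
  shows "(\<lambda>U. least_label U S) \<in> measurable A (count_space UNIV)"
proof -
  \<comment> \<open>The set of all minimisers ranges over the finite set \<open>Pow S\<close> and
    depends measurably on the labels. The choice made by \<open>SOME\<close> is then a function on a
    finite discrete space.\<close>
  define D where "D U = {y \<in> S. \<forall>z\<in>S. U y \<le> U z}" for U :: "'v \<Rightarrow> real"
  have "D \<in> measurable A (count_space (Pow S))"
  proof (rule measurable_count_space_eq2[THEN iffD2])
    show "finite (Pow S)" using assms(1) by simp
    show "D \<in> space A \<rightarrow> Pow S \<and> (\<forall>a\<in>Pow S. D -` {a} \<inter> space A \<in> sets A)"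
    proof (intro conjI ballI)
      fix a assume "a \<in> Pow S"
      have "{U \<in> space A. \<forall>y\<in>S. (\<forall>z\<in>S. U y \<le> U z) \<longleftrightarrow> y \<in> a} \<in> sets A"
      proof (rule sets.sets_Collect_finite_All[OF _ assms(1)])
        fix y assume "y \<in> S"
        have "{U \<in> space A. \<forall>z\<in>S. U y \<le> U z} \<in> sets A"
          using assms(1) by (intro sets.sets_Collect_finite_All borel_measurable_le assms(2))
        then show "{U \<in> space A. (\<forall>z\<in>S. U y \<le> U z) \<longleftrightarrow> y \<in> a} \<in> sets A"
          using sets.sets_Collect_neg[of A "\<lambda>U. \<forall>z\<in>S. U y \<le> U z"] by (cases "y \<in> a") auto
      qed
      also have "{U \<in> space A. \<forall>y\<in>S. (\<forall>z\<in>S. U y \<le> U z) \<longleftrightarrow> y \<in> a} = D -` {a} \<inter> space A"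
      proof (intro set_eqI)
        fix U
        have "(\<forall>y\<in>S. (\<forall>z\<in>S. U y \<le> U z) \<longleftrightarrow> y \<in> a) \<longleftrightarrow> (\<forall>y\<in>S. y \<in> D U \<longleftrightarrow> y \<in> a)"
          unfolding D_def by blast
        also have "\<dots> \<longleftrightarrow> D U = a"
        proof -
          have "a \<subseteq> S" "D U \<subseteq> S" using \<open>a \<in> Pow S\<close> by (auto simp: D_def)
          then show ?thesis by blast
        qed
        finally show "U \<in> {U \<in> space A. \<forall>y\<in>S. (\<forall>z\<in>S. U y \<le> U z) \<longleftrightarrow> y \<in> a} \<longleftrightarrow> U \<in> D -` {a} \<inter> space A"
          by blast
      qed
      finally show "D -` {a} \<inter> space A \<in> sets A" .
    qed (auto simp: D_def)
  qed
  then have "(\<lambda>U. SOME y. y \<in> D U) \<in> measurable A (count_space UNIV)"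
    by (rule measurable_compose) simp
  then show ?thesis by (simp add: least_label_def D_def)
qed

lemma measurable_greedy:
  assumes "\<And>v. (\<lambda>U. U v) \<in> borel_measurable A"
  shows "(\<lambda>U. greedy U x k) \<in> measurable A (count_space UNIV)"
proof (induction k)
  case (Suc k)
  have c: "countable (UNIV :: 'v list set)" using countable_V by (metis countable_lists lists_UNIV)
  \<comment> \<open>There are countably many lists, so the previous list can be frozen at a constant
    \<open>xs\<close> while the new entry is treated.\<close>
  have "(\<lambda>U. (\<lambda>xs U. xs @ [least_label U (cand x xs)]) (greedy U x k) U) \<in> measurable A (count_space UNIV)"
  proof (rule measurable_compose_countable'[OF _ Suc c])
    fix xs :: "'v list"
    show "(\<lambda>U. xs @ [least_label U (cand x xs)]) \<in> measurable A (count_space UNIV)"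
      by (rule measurable_compose[OF measurable_least_label[OF finite_cand assms]]) simp
  qed
  then show ?case by simp
qed simp

lemma measurable_sel:
  assumes "\<And>v. (\<lambda>U. U v) \<in> borel_measurable A"
  shows "(\<lambda>U. sel U x) \<in> measurable A (restrict_space (PiM UNIV (\<lambda>_. count_space UNIV)) (graph_Aut E))"
proof (rule measurable_restrict_space2)
  show "(\<lambda>U. sel U x) \<in> measurable A (PiM UNIV (\<lambda>_. count_space UNIV))"
  proof (rule measurable_PiM_single')
    fix v
    show "(\<lambda>U. sel U x v) \<in> measurable A (count_space UNIV)"
      unfolding sel_def by (rule measurable_compose[OF measurable_greedy[OF assms]]) simp
  qed auto
qed (auto simp: sel_in_Aut)

end

subsection \<open>Trajectories and configurations\<close>

text \<open>\<open>embed_measure\<close> carries the \<sigma>-algebra along with the measure, so an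
  injection \<open>c\<close> with no measurability of its own turns pairs of labels into real
  sequences, decoded by \<open>d\<close>. Decoding an i.i.d. family then yields two independent
  i.i.d. families.\<close>

lemma factor_of_iid_pairI:
  fixes A :: "'a measure" and B :: "'b measure" and c :: "'a \<times> 'b \<Rightarrow> nat \<Rightarrow> real"
    and T :: "('v \<Rightarrow> 'a) \<times> ('v \<Rightarrow> 'b) \<Rightarrow> 'c"
  assumes A: "prob_space A" and B: "prob_space B" and c: "inj_on c (space (A \<Otimes>\<^sub>M B))"
    and T: "T \<in> measurable (PiM UNIV (\<lambda>_. A) \<Otimes>\<^sub>M PiM UNIV (\<lambda>_. B)) N"
    and act: "\<And>\<phi> U \<zeta>. \<phi> \<in> \<Gamma> \<Longrightarrow> (\<And>x. U x \<in> space A) \<Longrightarrow> (\<And>x. \<zeta> x \<in> space B) \<Longrightarrow>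
      T (\<lambda>x. U (inv \<phi> x), \<lambda>x. \<zeta> (inv \<phi> x)) = act \<phi> (T (U, \<zeta>))"
    and law: "distr (PiM UNIV (\<lambda>_. A) \<Otimes>\<^sub>M PiM UNIV (\<lambda>_. B)) N T = \<kappa>"
  shows "factor_of_iid \<Gamma> act N \<kappa>"
proof -
  interpret A: prob_space A by (rule A)
  interpret B: prob_space B by (rule B)
  interpret AB: pair_prob_space A B ..
  define \<theta> where "\<theta> = embed_measure (A \<Otimes>\<^sub>M B) c"
  define d where "d = the_inv_into (space (A \<Otimes>\<^sub>M B)) c"
  have dc: "d (c z) = z" if "z \<in> space (A \<Otimes>\<^sub>M B)" for z
    unfolding d_def by (rule the_inv_into_f_f[OF c that])
  have d: "d \<in> measurable \<theta> (A \<Otimes>\<^sub>M B)"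
    unfolding \<theta>_def by (rule measurable_embed_measure1) (simp add: dc cong: measurable_cong)
  have c_meas: "c \<in> measurable (A \<Otimes>\<^sub>M B) \<theta>"
    unfolding \<theta>_def by (rule measurable_embed_measure2'[OF c])
  have \<theta>_eq: "\<theta> = distr (A \<Otimes>\<^sub>M B) \<theta> c"
    unfolding \<theta>_def by (rule embed_measure_eq_distr'[OF c])
  have \<theta>: "prob_space \<theta>"
    by (subst \<theta>_eq) (rule AB.prob_space_distr[OF c_meas])
  have "distr \<theta> (A \<Otimes>\<^sub>M B) d = distr (A \<Otimes>\<^sub>M B) (A \<Otimes>\<^sub>M B) (d \<circ> c)"
    by (subst \<theta>_eq) (rule distr_distr[OF d c_meas])
  also have "\<dots> = distr (A \<Otimes>\<^sub>M B) (A \<Otimes>\<^sub>M B) (\<lambda>z. z)"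
    by (rule distr_cong) (auto simp: dc)
  finally have "distr \<theta> (A \<Otimes>\<^sub>M B) (\<lambda>l. (fst (d l), snd (d l))) = A \<Otimes>\<^sub>M B"
    by (simp add: distr_id2)
  then have split: "distr (PiM (UNIV :: 'v set) (\<lambda>_. \<theta>)) (PiM UNIV (\<lambda>_. A) \<Otimes>\<^sub>M PiM UNIV (\<lambda>_. B))
      (\<lambda>\<eta>. (\<lambda>x. fst (d (\<eta> x)), \<lambda>x. snd (d (\<eta> x)))) = PiM UNIV (\<lambda>_. A) \<Otimes>\<^sub>M PiM UNIV (\<lambda>_. B)"
    by (intro distr_PiM_pair \<theta> A B measurable_fst'' measurable_snd'' d)
      (auto intro: measurable_compose[OF d measurable_fst] measurable_compose[OF d measurable_snd])
  let ?S = "\<lambda>\<eta> :: 'v \<Rightarrow> nat \<Rightarrow> real. (\<lambda>x. fst (d (\<eta> x)), \<lambda>x. snd (d (\<eta> x)))"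
  have S: "?S \<in> measurable (PiM UNIV (\<lambda>_. \<theta>)) (PiM UNIV (\<lambda>_. A) \<Otimes>\<^sub>M PiM UNIV (\<lambda>_. B))"
  proof (rule measurable_Pair)
    show "(\<lambda>\<eta> x. fst (d (\<eta> x))) \<in> measurable (PiM UNIV (\<lambda>_. \<theta>)) (PiM (UNIV :: 'v set) (\<lambda>_. A))"
    proof (rule measurable_PiM_single')
      fix i :: 'v
      show "(\<lambda>\<eta>. fst (d (\<eta> i))) \<in> measurable (PiM UNIV (\<lambda>_. \<theta>)) A"
        by (rule measurable_compose[of "\<lambda>\<eta>. \<eta> i" "PiM UNIV (\<lambda>_. \<theta>)" \<theta> "\<lambda>l. fst (d l)"])
          (simp, rule measurable_compose[OF d measurable_fst])
    qed (use measurable_space[OF d] in \<open>auto simp: space_PiM PiE_iff space_pair_measure mem_Times_iff\<close>)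
    show "(\<lambda>\<eta> x. snd (d (\<eta> x))) \<in> measurable (PiM UNIV (\<lambda>_. \<theta>)) (PiM (UNIV :: 'v set) (\<lambda>_. B))"
    proof (rule measurable_PiM_single')
      fix i :: 'v
      show "(\<lambda>\<eta>. snd (d (\<eta> i))) \<in> measurable (PiM UNIV (\<lambda>_. \<theta>)) B"
        by (rule measurable_compose[of "\<lambda>\<eta>. \<eta> i" "PiM UNIV (\<lambda>_. \<theta>)" \<theta> "\<lambda>l. snd (d l)"])
          (simp, rule measurable_compose[OF d measurable_snd])
    qed (use measurable_space[OF d] in \<open>auto simp: space_PiM PiE_iff space_pair_measure mem_Times_iff\<close>)
  qed
  show ?thesis
    unfolding factor_of_iid_def
  proof (intro exI conjI ballI)
    show "prob_space \<theta>" by (rule \<theta>)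
    show "(\<lambda>\<eta>. T (?S \<eta>)) \<in> measurable (PiM UNIV (\<lambda>_. \<theta>)) N"
      by (rule measurable_compose[OF S T])
    show "distr (PiM UNIV (\<lambda>_. \<theta>)) N (\<lambda>\<eta>. T (?S \<eta>)) = \<kappa>"
      using distr_distr[OF T S] by (simp add: split law comp_def)
    fix \<phi> \<eta> assume \<phi>: "\<phi> \<in> \<Gamma>" and \<eta>: "\<eta> \<in> space (PiM (UNIV :: 'v set) (\<lambda>_. \<theta>))"
    have "d (\<eta> x) \<in> space (A \<Otimes>\<^sub>M B)" for x
      using measurable_space[OF d] \<eta> by (auto simp: space_PiM PiE_iff)
    then show "T (?S (\<lambda>x. \<eta> (inv \<phi> x))) = act \<phi> (T (?S \<eta>))"
      using act[OF \<phi>, of "\<lambda>x. fst (d (\<eta> x))" "\<lambda>x. snd (d (\<eta> x))"]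
      by (auto simp: space_pair_measure mem_Times_iff)
  qed
qed

lemma factor_of_iid_image:
  fixes \<Gamma> :: "('v \<Rightarrow> 'v) set"
  assumes f: "factor_of_iid \<Gamma> act N \<kappa>" and h: "h \<in> measurable N N'"
    and act: "\<And>\<phi> \<omega>. \<phi> \<in> \<Gamma> \<Longrightarrow> \<omega> \<in> space N \<Longrightarrow> h (act \<phi> \<omega>) = act' \<phi> (h \<omega>)"
  shows "factor_of_iid \<Gamma> act' N' (distr \<kappa> N' h)"
proof -
  obtain \<theta> :: "(nat \<Rightarrow> real) measure" and T :: "('v \<Rightarrow> nat \<Rightarrow> real) \<Rightarrow> _" where T: "prob_space \<theta>"
      "T \<in> measurable (PiM (UNIV :: 'v set) (\<lambda>_. \<theta>)) N"
      "\<And>\<phi> \<eta>. \<phi> \<in> \<Gamma> \<Longrightarrow> \<eta> \<in> space (PiM (UNIV :: 'v set) (\<lambda>_. \<theta>)) \<Longrightarrow> T (\<lambda>x. \<eta> (inv \<phi> x)) = act \<phi> (T \<eta>)"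
      "distr (PiM (UNIV :: 'v set) (\<lambda>_. \<theta>)) N T = \<kappa>"
    using f unfolding factor_of_iid_def by blast
  show ?thesis
    unfolding factor_of_iid_def
  proof (intro exI[of _ \<theta>] exI[of _ "h \<circ> T"] conjI ballI)
    show "h \<circ> T \<in> measurable (PiM (UNIV :: 'v set) (\<lambda>_. \<theta>)) N'" by (rule measurable_comp[OF T(2) h])
    show "distr (PiM (UNIV :: 'v set) (\<lambda>_. \<theta>)) N' (h \<circ> T) = distr \<kappa> N' h"
      by (simp add: T(4)[symmetric] distr_distr[OF h T(2)])
    fix \<phi> \<eta> assume "\<phi> \<in> \<Gamma>" "\<eta> \<in> space (PiM (UNIV :: 'v set) (\<lambda>_. \<theta>))"
    then show "(h \<circ> T) (\<lambda>x. \<eta> (inv \<phi> x)) = act' \<phi> ((h \<circ> T) \<eta>)"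
      using T(3) act measurable_space[OF T(2)] by simp
  qed (rule T)
qed

section \<open>Trajectories, their time labels and their classes modulo shift\<close>

lemma space_traj_space [simp]: "space (traj_space E) = traj E"
  by (simp add: traj_space_def space_restrict_space space_PiM)

lemma measurable_traj_coordinate [measurable]:
  "(\<lambda>w. w n) \<in> measurable (traj_space E) (count_space UNIV)"
  unfolding traj_space_def by (rule measurable_restrict_space1) simp

lemma measurable_traj_spaceI:
  assumes "\<And>x. x \<in> space X \<Longrightarrow> f x \<in> traj E"
    and "\<And>n. (\<lambda>x. f x n) \<in> measurable X (count_space UNIV)"
  shows "f \<in> measurable X (traj_space E)"
  unfolding traj_space_def
  by (rule measurable_restrict_space2) (use assms in \<open>auto intro!: measurable_PiM_single'\<close>)

lemma act_traj_in_traj: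
  assumes "\<phi> \<in> graph_Aut E" "w \<in> traj E"
  shows "act_traj \<phi> w \<in> traj E"
proof -
  have "{n. \<phi> (w n) = x} = {n. w n = inv \<phi> x}" for x
    using assms(1) by (metis graph_Aut_f_inv graph_Aut_inv_f)
  then show ?thesis using assms by (simp add: traj_def act_traj_def graph_Aut_edge)
qed

lemma act_traj_comp: "act_traj (\<phi> \<circ> \<psi>) w = act_traj \<phi> (act_traj \<psi> w)"
  by (simp add: act_traj_def)

lemma act_traj_inv [simp]:
  assumes "\<phi> \<in> graph_Aut E"
  shows "act_traj (inv \<phi>) (act_traj \<phi> w) = w" "act_traj \<phi> (act_traj (inv \<phi>) w) = w"
  using assms by (auto simp: act_traj_def)

lemma measurable_act_traj:
  assumes "\<phi> \<in> graph_Aut E"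
  shows "act_traj \<phi> \<in> measurable (traj_space E) (traj_space E)"
proof (rule measurable_traj_spaceI)
  fix n
  show "(\<lambda>w. act_traj \<phi> w n) \<in> measurable (traj_space E) (count_space UNIV)"
    unfolding act_traj_def by (rule measurable_compose[OF measurable_traj_coordinate]) simp
qed (use assms act_traj_in_traj in auto)

lemma sets_traj_at [measurable]: "{w \<in> traj E. w n = x} \<in> sets (traj_space E)"
proof -
  have "{w \<in> space (traj_space E). w n = x} \<in> sets (traj_space E)" by measurable
  then show ?thesis by simp
qed

lemma traj_hit_eq: "traj_hit E {x} = (\<Union>n. {w \<in> traj E. w n = x})"
  by (auto simp: traj_hit_def)

lemma sets_traj_hit [measurable]: "traj_hit E {x} \<in> sets (traj_space E)"
  unfolding traj_hit_eq by (intro sets.countable_UN) auto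

lemma space_halfline [simp]: "space halfline = {0..}"
  by (simp add: halfline_def space_restrict_space)

lemma sets_halfline: "A \<in> sets borel \<Longrightarrow> A \<subseteq> {0..} \<Longrightarrow> A \<in> sets halfline"
  by (simp add: halfline_def sets_restrict_space_iff)

lemma emeasure_halfline: "A \<in> sets borel \<Longrightarrow> A \<subseteq> {0..} \<Longrightarrow> emeasure halfline A = emeasure lborel A"
  by (simp add: halfline_def emeasure_restrict_space)

lemma sigma_finite_halfline: "sigma_finite_measure halfline"
  unfolding halfline_def by (rule sigma_finite_measure_restrict_space[OF sigma_finite_lborel]) simp

lemma space_labelled_traj_space [simp]: "space (labelled_traj_space E) = traj E \<times> {0..}"
  by (simp add: labelled_traj_space_def space_pair_measure)

lemma class_space_gen: "{A. A \<subseteq> traj_classes E \<and> traj_proj E -` A \<inter> traj E \<in> sets (traj_space E)} \<subseteq> Pow (traj_classes E)"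
  by auto

lemma space_class_space [simp]: "space (class_space E) = traj_classes E"
  unfolding class_space_def by (rule space_measure_of[OF class_space_gen])

lemma in_sets_class_spaceI:
  assumes "A \<subseteq> traj_classes E" "traj_proj E -` A \<inter> traj E \<in> sets (traj_space E)"
  shows "A \<in> sets (class_space E)"
  unfolding class_space_def sets_measure_of[OF class_space_gen]
  by (rule sigma_sets.Basic) (use assms in auto)

lemma traj_proj_in_classes: "w \<in> traj E \<Longrightarrow> traj_proj E w \<in> traj_classes E"
  by (simp add: traj_proj_def traj_classes_def quotientI)

lemma measurable_traj_proj: "traj_proj E \<in> measurable (traj_space E) (class_space E)"
  unfolding class_space_def by (rule measurable_measure_of[OF class_space_gen]) (auto simp: traj_proj_in_classes)

lemma traj_proj_hit: "w \<in> traj E \<Longrightarrow> traj_proj E w \<in> class_hit E {x} \<longleftrightarrow> w \<in> traj_hit E {x}"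
proof -
  assume w: "w \<in> traj E"
  have "w \<in> traj_proj E w" using w by (auto simp: traj_proj_def shift_rel_def intro: exI[of _ 0])
  moreover have "\<exists>n. w n = x" if "w' \<in> traj_proj E w" "w' n = x" for w' n
  proof -
    obtain k where "\<And>n. w n = w' (n + k)" using \<open>w' \<in> traj_proj E w\<close> by (auto simp: traj_proj_def shift_rel_def)
    then have "w (n - k) = x" using \<open>w' n = x\<close> by simp
    then show ?thesis by blast
  qed
  ultimately show ?thesis using w traj_proj_in_classes[OF w] by (auto simp: class_hit_def traj_hit_def)
qed

lemma sets_class_hit: "class_hit E {x} \<in> sets (class_space E)"
proof (rule in_sets_class_spaceI)
  have "traj_proj E -` class_hit E {x} \<inter> traj E = traj_hit E {x}"
  proof -
    have "traj_hit E {x} \<subseteq> traj E" by (auto simp: traj_hit_def)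
    then show ?thesis using traj_proj_hit[of _ E x] by blast
  qed
  then show "traj_proj E -` class_hit E {x} \<inter> traj E \<in> sets (traj_space E)" by simp
qed (auto simp: class_hit_def)

lemma traj_proj_act:
  assumes \<phi>: "\<phi> \<in> graph_Aut E" and w: "w \<in> traj E"
  shows "traj_proj E (act_traj \<phi> w) = act_class \<phi> (traj_proj E w)"
proof (intro set_eqI iffI)
  fix w' assume "w' \<in> traj_proj E (act_traj \<phi> w)"
  then obtain k where k: "w' \<in> traj E" "\<And>n. act_traj \<phi> w n = w' (n + k)"
    by (auto simp: traj_proj_def shift_rel_def)
  have "w n = act_traj (inv \<phi>) w' (n + k)" for n
    using k(2)[of n, symmetric] \<phi> by (simp add: act_traj_def)
  then have "act_traj (inv \<phi>) w' \<in> traj_proj E w"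
    using w k(1) act_traj_in_traj[OF graph_Aut_inv[OF \<phi>]] by (auto simp: traj_proj_def shift_rel_def)
  then have "act_traj \<phi> (act_traj (inv \<phi>) w') \<in> act_class \<phi> (traj_proj E w)"
    unfolding act_class_def by (rule imageI)
  then show "w' \<in> act_class \<phi> (traj_proj E w)" using \<phi> by simp
next
  fix w' assume "w' \<in> act_class \<phi> (traj_proj E w)"
  then obtain w0 k where k: "w' = act_traj \<phi> w0" "w0 \<in> traj E" "\<And>n. w n = w0 (n + k)"
    by (auto simp: traj_proj_def shift_rel_def act_class_def)
  have "act_traj \<phi> w n = w' (n + k)" for n by (simp add: k(1,3) act_traj_def)
  then show "w' \<in> traj_proj E (act_traj \<phi> w)"
    using act_traj_in_traj[OF \<phi> w] act_traj_in_traj[OF \<phi> k(2)] by (auto simp: traj_proj_def shift_rel_def k(1))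
qed

lemma measurable_act_class:
  assumes \<phi>: "\<phi> \<in> graph_Aut E"
  shows "act_class \<phi> \<in> measurable (class_space E) (class_space E)"
proof -
  have cl: "act_class \<phi> C \<in> traj_classes E" if C: "C \<in> traj_classes E" for C
  proof -
    obtain w where w: "w \<in> traj E" "C = traj_proj E w"
      using C by (auto simp: traj_classes_def traj_proj_def quotient_def)
    then show ?thesis
      using traj_proj_act[OF \<phi> w(1)] traj_proj_in_classes[OF act_traj_in_traj[OF \<phi> w(1)]] by simp
  qed
  have "act_class \<phi> \<in> measurable (class_space E) (sigma (traj_classes E)
     {A. A \<subseteq> traj_classes E \<and> traj_proj E -` A \<inter> traj E \<in> sets (traj_space E)})"
  proof (rule measurable_measure_of[OF class_space_gen])
    fix A assume "A \<in> {A. A \<subseteq> traj_classes E \<and> traj_proj E -` A \<inter> traj E \<in> sets (traj_space E)}"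
    then have A: "A \<subseteq> traj_classes E" "traj_proj E -` A \<inter> traj E \<in> sets (traj_space E)" by auto
    have "traj_proj E -` (act_class \<phi> -` A \<inter> traj_classes E) \<inter> traj E =
        act_traj \<phi> -` (traj_proj E -` A \<inter> traj E) \<inter> space (traj_space E)"
    proof (rule set_eqI)
      fix w
      show "w \<in> traj_proj E -` (act_class \<phi> -` A \<inter> traj_classes E) \<inter> traj E \<longleftrightarrow>
          w \<in> act_traj \<phi> -` (traj_proj E -` A \<inter> traj E) \<inter> space (traj_space E)"
        by (cases "w \<in> traj E") (simp_all add: traj_proj_act[OF \<phi>] act_traj_in_traj[OF \<phi>] traj_proj_in_classes)
    qed
    then show "act_class \<phi> -` A \<inter> space (class_space E) \<in> sets (class_space E)"
      using measurable_sets[OF measurable_act_traj[OF \<phi>] A(2)] by (intro in_sets_class_spaceI) auto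
  qed (use cl in auto)
  then show ?thesis by (simp only: class_space_def)
qed

lemma measurable_map_label:
  assumes "f \<in> measurable A B"
  shows "(\<lambda>(w, t). (f w, t)) \<in> measurable (A \<Otimes>\<^sub>M halfline) (B \<Otimes>\<^sub>M halfline)"
  using assms by measurable

lemma measurable_labelled_act_traj:
  "\<phi> \<in> graph_Aut E \<Longrightarrow> (\<lambda>(w, t). (act_traj \<phi> w, t)) \<in> measurable (labelled_traj_space E) (labelled_traj_space E)"
  unfolding labelled_traj_space_def by (intro measurable_map_label measurable_act_traj)

lemma measurable_labelled_act_class:
  "\<phi> \<in> graph_Aut E \<Longrightarrow> (\<lambda>(C, t). (act_class \<phi> C, t)) \<in> measurable (labelled_class_space E) (labelled_class_space E)"
  unfolding labelled_class_space_def by (intro measurable_map_label measurable_act_class)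

lemma measurable_labelled_proj:
  "(\<lambda>(w, t). (traj_proj E w, t)) \<in> measurable (labelled_traj_space E) (labelled_class_space E)"
  unfolding labelled_traj_space_def labelled_class_space_def by (intro measurable_map_label measurable_traj_proj)

lemma sets_labelled_hit: "traj_hit E {x} \<times> {0..t} \<in> sets (labelled_traj_space E)"
  unfolding labelled_traj_space_def by (intro pair_measureI sets_traj_hit sets_halfline) auto

lemma sets_labelled_class_hit: "class_hit E {x} \<times> {0..t} \<in> sets (labelled_class_space E)"
  unfolding labelled_class_space_def by (intro pair_measureI sets_class_hit sets_halfline) auto

section \<open>Configurations under automorphisms and under projection to classes\<close>

abbreviation hit_boxes :: "'v set set \<Rightarrow> ((int \<Rightarrow> 'v) \<times> real) set set" where
  "hit_boxes E \<equiv> {traj_hit E {x} \<times> {0..t} | x t. t \<ge> 0}"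

lemma space_traj_configs: "space (traj_configs E) = point_measures (labelled_traj_space E) (hit_boxes E)"
  by (simp add: traj_configs_def)

text \<open>Monotonicity in \<open>t\<close> reduces local finiteness to integer times. On a
  countable vertex set this leaves countably many conditions, which makes the space of
  configurations a measurable subset later on.\<close>

lemma in_traj_configs_iff:
  "\<omega> \<in> space (traj_configs E) \<longleftrightarrow> \<omega> \<in> point_measures (labelled_traj_space E) {} \<and>
    (\<forall>x. \<forall>n::nat. emeasure \<omega> (traj_hit E {x} \<times> {0..real n}) < \<infinity>)"
proof -
  have "emeasure \<omega> (traj_hit E {x} \<times> {0..t}) < \<infinity>"
    if \<omega>: "\<omega> \<in> point_measures (labelled_traj_space E) {}"
      and fin: "\<And>n::nat. emeasure \<omega> (traj_hit E {x} \<times> {0..real n}) < \<infinity>" for x t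
  proof -
    obtain n :: nat where "t \<le> real n" using real_arch_simple by blast
    then have "emeasure \<omega> (traj_hit E {x} \<times> {0..t}) \<le> emeasure \<omega> (traj_hit E {x} \<times> {0..real n})"
      using sets_labelled_hit by (intro emeasure_mono) (auto simp: sets_point_measure[OF \<omega>])
    then show ?thesis using fin[of n] by (rule order.strict_trans1)
  qed
  note bound = this
  have "emeasure \<omega> (traj_hit E {x} \<times> {0..real n}) < \<infinity>" if "\<forall>B\<in>hit_boxes E. emeasure \<omega> B < \<infinity>" for x and n :: nat
    by (rule bspec[OF that]) (use of_nat_0_le_iff in blast)
  then show ?thesis
    unfolding space_traj_configs point_measures_iff[of \<omega> _ "hit_boxes E"] using bound by blast
qed

text \<open>The condition at \<open>x\<close> for the moved configuration is the condition at
  \<open>inv \<phi> x\<close> for the original one. The equivalence ensures that a configuration and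
  its image are rejected or accepted together.\<close>

lemma act_traj_config_in_configs_iff:
  assumes \<phi>: "\<phi> \<in> graph_Aut E" and \<omega>: "\<omega> \<in> point_measures (labelled_traj_space E) {}"
  shows "act_traj_config E \<phi> \<omega> \<in> space (traj_configs E) \<longleftrightarrow> \<omega> \<in> space (traj_configs E)"
proof -
  have eq: "emeasure (act_traj_config E \<phi> \<omega>) (traj_hit E {x} \<times> {0..t}) =
      emeasure \<omega> (traj_hit E {inv \<phi> x} \<times> {0..t})" for x t
  proof -
    have "{m \<in> space (labelled_traj_space E). (case m of (w, t) \<Rightarrow> (act_traj \<phi> w, t)) \<in> traj_hit E {x} \<times> {0..t}} =
        traj_hit E {inv \<phi> x} \<times> {0..t}"
    proof -
      have "\<phi> (w n) = x \<longleftrightarrow> w n = inv \<phi> x" for w :: "int \<Rightarrow> _" and n using \<phi> by (metis graph_Aut_f_inv graph_Aut_inv_f)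
      then have "act_traj \<phi> w \<in> traj_hit E {x} \<longleftrightarrow> w \<in> traj_hit E {inv \<phi> x}" if "w \<in> traj E" for w
        using act_traj_in_traj[OF \<phi> that] that by (simp add: traj_hit_def act_traj_def)
      moreover have "traj_hit E {inv \<phi> x} \<subseteq> traj E" by (auto simp: traj_hit_def)
      ultimately show ?thesis by auto
    qed
    then show ?thesis
      unfolding act_traj_config_def
      by (simp only: emeasure_distr_point_measure[OF \<omega> measurable_labelled_act_traj[OF \<phi>] sets_labelled_hit])
  qed
  have pm: "act_traj_config E \<phi> \<omega> \<in> point_measures (labelled_traj_space E) {}"
    unfolding act_traj_config_def by (rule distr_point_measure[OF \<omega> measurable_labelled_act_traj[OF \<phi>]])
  have "(\<forall>x. P (inv \<phi> x)) \<longleftrightarrow> (\<forall>x. P x)" for P using \<phi> by (metis graph_Aut_inv_f)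
  from this[of "\<lambda>x. \<forall>n::nat. emeasure \<omega> (traj_hit E {x} \<times> {0..real n}) < \<infinity>"]
  show ?thesis unfolding in_traj_configs_iff eq using pm \<omega> by simp
qed

lemma proj_config_in_configs:
  assumes "\<omega> \<in> space (traj_configs E)"
  shows "proj_config E \<omega> \<in> space (class_configs E)"
proof -
  have \<omega>: "\<omega> \<in> point_measures (labelled_traj_space E) {}"
    and fin: "\<And>x t. t \<ge> 0 \<Longrightarrow> emeasure \<omega> (traj_hit E {x} \<times> {0..t}) < \<infinity>"
    using assms unfolding space_traj_configs point_measures_iff[of \<omega> _ "hit_boxes E"] by auto
  have eq: "emeasure (proj_config E \<omega>) (class_hit E {x} \<times> {0..t}) = emeasure \<omega> (traj_hit E {x} \<times> {0..t})" for x t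
  proof -
    have "{m \<in> space (labelled_traj_space E). (case m of (w, t) \<Rightarrow> (traj_proj E w, t)) \<in> class_hit E {x} \<times> {0..t}} =
        traj_hit E {x} \<times> {0..t}"
    proof -
      have "traj_hit E {x} \<subseteq> traj E" by (auto simp: traj_hit_def)
      then show ?thesis using traj_proj_hit[of _ E x] by auto
    qed
    then show ?thesis
      unfolding proj_config_def
      by (simp only: emeasure_distr_point_measure[OF \<omega> measurable_labelled_proj sets_labelled_class_hit])
  qed
  have "proj_config E \<omega> \<in> point_measures (labelled_class_space E) {}"
    unfolding proj_config_def by (rule distr_point_measure[OF \<omega> measurable_labelled_proj])
  then show ?thesis
    unfolding class_configs_def space_point_measure_space
    by (subst point_measures_iff) (auto simp: eq fin[simplified])
qed

lemma measurable_proj_config: "proj_config E \<in> measurable (traj_configs E) (class_configs E)"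
  unfolding class_configs_def
proof (rule measurable_point_measure_spaceI)
  fix \<omega> assume "\<omega> \<in> space (traj_configs E)"
  then show "proj_config E \<omega> \<in> point_measures (labelled_class_space E) {class_hit E {x} \<times> {0..t} | x t. t \<ge> 0}"
    using proj_config_in_configs by (simp add: class_configs_def)
next
  fix A assume A: "A \<in> sets (labelled_class_space E)"
  let ?B = "{m \<in> space (labelled_traj_space E). (case m of (w, t) \<Rightarrow> (traj_proj E w, t)) \<in> A}"
  have "?B \<in> sets (labelled_traj_space E)"
    using measurable_sets[OF measurable_labelled_proj A] by (simp add: vimage_def Int_def conj_commute)
  then have "(\<lambda>\<omega>. emeasure \<omega> ?B) \<in> borel_measurable (traj_configs E)"
    unfolding traj_configs_def by (rule measurable_emeasure_point_measure)
  then show "(\<lambda>\<omega>. emeasure (proj_config E \<omega>) A) \<in> borel_measurable (traj_configs E)"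
    by (rule measurable_cong[THEN iffD1, rotated])
      (simp add: proj_config_def space_traj_configs emeasure_distr_point_measure[OF _ measurable_labelled_proj A])
qed

lemma proj_config_act:
  assumes \<phi>: "\<phi> \<in> graph_Aut E" and \<omega>: "\<omega> \<in> space (traj_configs E)"
  shows "proj_config E (act_traj_config E \<phi> \<omega>) = act_class_config E \<phi> (proj_config E \<omega>)"
proof -
  have s: "sets \<omega> = sets (labelled_traj_space E)" "space \<omega> = space (labelled_traj_space E)"
    using \<omega> sets_point_measure space_point_measure unfolding space_traj_configs by blast+
  have m: "measurable \<omega> N = measurable (labelled_traj_space E) N" for N :: "'x measure"
    by (rule measurable_cong_sets[OF s(1) refl])
  have "proj_config E (act_traj_config E \<phi> \<omega>) = distr \<omega> (labelled_class_space E)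
      ((\<lambda>(w, t). (traj_proj E w, t)) \<circ> (\<lambda>(w, t). (act_traj \<phi> w, t)))"
    unfolding proj_config_def act_traj_config_def
    by (rule distr_distr[OF measurable_labelled_proj]) (simp add: m measurable_labelled_act_traj[OF \<phi>])
  also have "\<dots> = distr \<omega> (labelled_class_space E)
      ((\<lambda>(C, t). (act_class \<phi> C, t)) \<circ> (\<lambda>(w, t). (traj_proj E w, t)))"
    by (rule distr_cong) (auto simp: s traj_proj_act[OF \<phi>])
  also have "\<dots> = act_class_config E \<phi> (proj_config E \<omega>)"
    unfolding proj_config_def act_class_config_def
    by (rule distr_distr[symmetric, OF measurable_labelled_act_class[OF \<phi>]]) (simp add: m measurable_labelled_proj)
  finally show ?thesis .
qed

subsection \<open>Assembling local point measures\<close>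

context rooted_transitive_graph
begin

abbreviation "ltraj \<equiv> labelled_traj_space E"

text \<open>The position at time 0 is defined for trajectories but not for their classes; it assigns
  each point to one vertex. The half-open unit intervals make the cells disjoint and, together with
  local finiteness, bound the counts.\<close>

definition cell :: "'v \<times> nat \<Rightarrow> ((int \<Rightarrow> 'v) \<times> real) set" where
  "cell c = {w \<in> traj E. w 0 = fst c} \<times> {real (snd c)..<real (snd c) + 1}"

sublocale cell_partition ltraj cell
proof
  show "countable (UNIV :: ('v \<times> nat) set)"
    using countable_V by (metis UNIV_Times_UNIV countable_SIGMA countableI_type)
  show "disjoint_family cell"
    unfolding disjoint_family_on_def
  proof (intro ballI impI)
    fix c d :: "'v \<times> nat" assume "c \<noteq> d"
    moreover have "c = d" if "(w, t) \<in> cell c" "(w, t) \<in> cell d" for w t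
    proof -
      have "fst c = fst d" "real (snd c) \<le> t" "t < real (snd c) + 1" "real (snd d) \<le> t" "t < real (snd d) + 1"
        using that by (auto simp: cell_def)
      then show ?thesis by (intro prod_eqI) linarith+
    qed
    ultimately show "cell c \<inter> cell d = {}" by (auto simp: disjoint_iff)
  qed
  show "(\<Union>c. cell c) = space ltraj"
  proof (intro set_eqI iffI)
    fix p assume "p \<in> space ltraj"
    then have "p \<in> cell (fst p 0, nat \<lfloor>snd p\<rfloor>)" by (auto simp: cell_def)
    then show "p \<in> (\<Union>c. cell c)" by blast
  qed (auto simp: cell_def)
  show "cell c \<in> sets ltraj" for c
    unfolding cell_def labelled_traj_space_def by (intro pair_measureI sets_traj_at sets_halfline) auto
qed

lemma cell_subset_hit_box: "cell c \<subseteq> traj_hit E {fst c} \<times> {0..real (Suc (snd c))}"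
  by (auto simp: cell_def traj_hit_def)

lemma emeasure_cell_config:
  assumes "\<omega> \<in> space (traj_configs E)"
  shows "emeasure \<omega> (cell c) < \<infinity>"
proof -
  have \<omega>: "\<omega> \<in> point_measures ltraj {}" and "emeasure \<omega> (traj_hit E {fst c} \<times> {0..real (Suc (snd c))}) < \<infinity>"
    using assms unfolding in_traj_configs_iff by blast+
  moreover have "emeasure \<omega> (cell c) \<le> emeasure \<omega> (traj_hit E {fst c} \<times> {0..real (Suc (snd c))})"
    by (rule emeasure_mono[OF cell_subset_hit_box]) (simp only: sets_point_measure[OF \<omega>] sets_labelled_hit)
  ultimately show ?thesis by (meson order.strict_trans1)
qed

text \<open>The larger space in which assembled configurations always lie. Finiteness on cells is
  weaker than finiteness on the visit sets, since a set of trajectories visiting a vertex may meet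
  infinitely many cells.\<close>

abbreviation "cell_configs \<equiv> point_measure_space ltraj (range cell)"

lemma traj_configs_subset_cell_configs: "space (traj_configs E) \<subseteq> space cell_configs"
proof
  fix \<omega> assume \<omega>: "\<omega> \<in> space (traj_configs E)"
  then have "\<omega> \<in> point_measures ltraj {}" unfolding in_traj_configs_iff by blast
  then show "\<omega> \<in> space cell_configs"
    unfolding space_point_measure_space point_measures_iff[of \<omega> ltraj "range cell"]
    using emeasure_cell_config[OF \<omega>] by blast
qed

text \<open>Makes local finiteness an event of the larger space, so that its probability depends
  only on the law there.\<close>

lemma traj_configs_in_sets_cell_configs: "space (traj_configs E) \<in> sets cell_configs"
proof -
  have "{\<omega> \<in> space cell_configs. \<forall>x\<in>UNIV. \<forall>n::nat. emeasure \<omega> (traj_hit E {x} \<times> {0..real n}) < \<infinity>} \<in> sets cell_configs"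
  proof (intro sets.sets_Collect_countable_All'[OF _ countable_V] sets.sets_Collect_countable_All)
    fix x and n :: nat
    have [measurable]: "traj_hit E {x} \<times> {0..real n} \<in> sets ltraj" by (rule sets_labelled_hit)
    show "{\<omega> \<in> space cell_configs. emeasure \<omega> (traj_hit E {x} \<times> {0..real n}) < \<infinity>} \<in> sets cell_configs"
      by measurable
  qed
  also have "{\<omega> \<in> space cell_configs. \<forall>x\<in>UNIV. \<forall>n::nat. emeasure \<omega> (traj_hit E {x} \<times> {0..real n}) < \<infinity>} =
      space (traj_configs E)"
  proof (intro set_eqI iffI)
    fix \<omega> assume \<omega>: "\<omega> \<in> {\<omega> \<in> space cell_configs. \<forall>x\<in>UNIV. \<forall>n::nat. emeasure \<omega> (traj_hit E {x} \<times> {0..real n}) < \<infinity>}"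
    then have "\<omega> \<in> point_measures ltraj {}" using point_measures_iff[of \<omega> ltraj "range cell"] by simp
    then show "\<omega> \<in> space (traj_configs E)" using \<omega> unfolding in_traj_configs_iff by blast
  next
    fix \<omega> assume \<omega>: "\<omega> \<in> space (traj_configs E)"
    then have "\<omega> \<in> space cell_configs" using traj_configs_subset_cell_configs by blast
    then show "\<omega> \<in> {\<omega> \<in> space cell_configs. \<forall>x\<in>UNIV. \<forall>n::nat. emeasure \<omega> (traj_hit E {x} \<times> {0..real n}) < \<infinity>}"
      using \<omega> unfolding in_traj_configs_iff by blast
  qed
  finally show ?thesis .
qed

text \<open>
  Each vertex \<open>x\<close> contributes the trajectories of its point measure \<open>\<zeta> x\<close> that sit
  at the root at time \<open>0\<close>, moved to \<open>x\<close> by the selected automorphism.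
\<close>

definition moved :: "('v \<Rightarrow> 'v) \<Rightarrow> ((int \<Rightarrow> 'v) \<times> real) set \<Rightarrow> ((int \<Rightarrow> 'v) \<times> real) set" where
  "moved \<psi> A = {p \<in> space ltraj. fst p 0 = root \<and> (act_traj \<psi> (fst p), snd p) \<in> A}"

text \<open>Atoms are indexed by pairs of a vertex and an atom number, so coinciding images keep
  their multiplicity and the result is a point measure by construction.\<close>

definition assemble :: "('v \<Rightarrow> real) \<Rightarrow> ('v \<Rightarrow> ((int \<Rightarrow> 'v) \<times> real) measure) \<Rightarrow> ((int \<Rightarrow> 'v) \<times> real) measure" where
  "assemble U \<zeta> = distr
     (count_space {(x, i). i \<in> fst (point_measure_code ltraj (\<zeta> x)) \<and> fst (snd (point_measure_code ltraj (\<zeta> x)) i) 0 = root})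
     ltraj (\<lambda>(x, i). map_prod (act_traj (sel U x)) id (snd (point_measure_code ltraj (\<zeta> x)) i))"

lemma sets_moved:
  assumes \<psi>: "\<psi> \<in> graph_Aut E" and A: "A \<in> sets ltraj"
  shows "moved \<psi> A \<in> sets ltraj"
proof -
  have "moved \<psi> A = ({w \<in> traj E. w 0 = root} \<times> {0..}) \<inter> ((\<lambda>(w, t). (act_traj \<psi> w, t)) -` A \<inter> space ltraj)"
    by (auto simp: moved_def)
  moreover have "{w \<in> traj E. w 0 = root} \<times> {0..} \<in> sets ltraj"
    unfolding labelled_traj_space_def by (intro pair_measureI sets_traj_at sets_halfline) auto
  ultimately show ?thesis using measurable_sets[OF measurable_labelled_act_traj[OF \<psi>] A] by auto
qed

context
  fixes \<zeta> :: "'v \<Rightarrow> ((int \<Rightarrow> 'v) \<times> real) measure" and F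
  assumes \<zeta>: "\<And>x. \<zeta> x \<in> point_measures ltraj F"
begin

lemma code_in_space:
  "i \<in> fst (point_measure_code ltraj (\<zeta> x)) \<Longrightarrow> snd (point_measure_code ltraj (\<zeta> x)) i \<in> space ltraj"
  using point_measure_code(1)[OF \<zeta> prod.collapse[symmetric]] by blast

lemma assemble_maps:
  "(\<lambda>(x, i). map_prod (act_traj (sel U x)) id (snd (point_measure_code ltraj (\<zeta> x)) i)) \<in>
    {(x, i). i \<in> fst (point_measure_code ltraj (\<zeta> x)) \<and> fst (snd (point_measure_code ltraj (\<zeta> x)) i) 0 = root} \<rightarrow> space ltraj"
  using code_in_space act_traj_in_traj[OF sel_in_Aut] by (fastforce simp: map_prod_def split_beta)

lemma assemble_point_measure: "assemble U \<zeta> \<in> point_measures ltraj {}"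
proof -
  have "countable (UNIV :: ('v \<times> nat) set)" by (rule countable_cells)
  then show ?thesis
    unfolding assemble_def
    by (intro distr_count_space_point_measure assemble_maps) (rule countable_subset[OF subset_UNIV])
qed

text \<open>Counting the index pairs vertex by vertex eliminates the chosen enumerations from the
  right-hand side. Measurability, equivariance and the law of \<open>assemble\<close> all rest on
  this formula.\<close>

lemma emeasure_assemble:
  assumes A: "A \<in> sets ltraj"
  shows "emeasure (assemble U \<zeta>) A = (\<integral>\<^sup>+x. emeasure (\<zeta> x) (moved (sel U x) A) \<partial>count_space UNIV)"
proof -
  have "emeasure (assemble U \<zeta>) A = emeasure (count_space UNIV)
      {(x, i). i \<in> fst (point_measure_code ltraj (\<zeta> x)) \<and> snd (point_measure_code ltraj (\<zeta> x)) i \<in> moved (sel U x) A}"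
    unfolding assemble_def emeasure_distr_count_space[OF assemble_maps A]
    by (rule arg_cong[where f="emeasure (count_space UNIV)"])
      (use code_in_space in \<open>auto simp: moved_def map_prod_def split_beta simp del: space_labelled_traj_space\<close>)
  also have "\<dots> = (\<integral>\<^sup>+x. emeasure (count_space UNIV)
      {i. i \<in> fst (point_measure_code ltraj (\<zeta> x)) \<and> snd (point_measure_code ltraj (\<zeta> x)) i \<in> moved (sel U x) A} \<partial>count_space UNIV)"
    by (rule emeasure_count_space_Sigma)
  also have "\<dots> = (\<integral>\<^sup>+x. emeasure (\<zeta> x) (moved (sel U x) A) \<partial>count_space UNIV)"
  proof (rule nn_integral_cong)
    fix x
    have "emeasure (\<zeta> x) (moved (sel U x) A) =
        emeasure (distr (count_space (fst (point_measure_code ltraj (\<zeta> x)))) ltraj (snd (point_measure_code ltraj (\<zeta> x)))) (moved (sel U x) A)"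
      using point_measure_code(2)[OF \<zeta>[of x] prod.collapse[symmetric]] by simp
    then show "emeasure (count_space UNIV) {i. i \<in> fst (point_measure_code ltraj (\<zeta> x)) \<and> snd (point_measure_code ltraj (\<zeta> x)) i \<in> moved (sel U x) A} =
        emeasure (\<zeta> x) (moved (sel U x) A)"
      using emeasure_distr_count_space[OF point_measure_code(1)[OF \<zeta>[of x] prod.collapse[symmetric]] sets_moved[OF sel_in_Aut A]]
      by simp
  qed
  finally show ?thesis .
qed

text \<open>The automorphism selected at \<open>y\<close> takes the root to \<open>y\<close>, so
  every trajectory contributed by the copy at \<open>y\<close> is at \<open>y\<close> at time 0.
  Inside a cell over \<open>x\<close> only the copy at \<open>x\<close> is seen, which is the source
  of independence and of finiteness.\<close>

lemma emeasure_assemble_cell: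
  assumes D: "D \<in> sets ltraj" "D \<subseteq> cell (x, m)"
  shows "emeasure (assemble U \<zeta>) D = emeasure (\<zeta> x) (moved (sel U x) D)"
proof -
  have "moved (sel U y) D = {}" if "y \<noteq> x" for y
    using D(2) that sel_root[of U y] by (auto simp: moved_def cell_def act_traj_def)
  then have "emeasure (assemble U \<zeta>) D =
      (\<integral>\<^sup>+y. emeasure (\<zeta> x) (moved (sel U x) D) * indicator {x} y \<partial>count_space UNIV)"
    unfolding emeasure_assemble[OF D(1)] by (intro nn_integral_cong) (auto simp: indicator_def)
  then show ?thesis by (simp add: nn_integral_cmult_indicator)
qed

end

lemma moved_cell: "moved (sel U x) (cell (x, m)) \<subseteq> cell (root, m)"
  by (auto simp: moved_def cell_def)

lemma assemble_in_cell_configs: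
  assumes \<zeta>: "\<And>x. \<zeta> x \<in> space (traj_configs E)"
  shows "assemble U \<zeta> \<in> space cell_configs"
proof -
  have \<zeta>': "\<And>x. \<zeta> x \<in> point_measures ltraj (hit_boxes E)" using \<zeta> by (simp add: space_traj_configs)
  have "emeasure (assemble U \<zeta>) (cell c) < \<infinity>" for c
  proof -
    obtain x m where c: "c = (x, m)" by fastforce
    have "emeasure (assemble U \<zeta>) (cell c) = emeasure (\<zeta> x) (moved (sel U x) (cell c))"
      unfolding c by (rule emeasure_assemble_cell[OF \<zeta>' sets_cells order_refl])
    also have "\<dots> \<le> emeasure (\<zeta> x) (cell (root, m))"
      unfolding c by (rule emeasure_mono[OF moved_cell]) (simp only: sets_point_measure[OF \<zeta>'] sets_cells)
    also have "\<dots> < \<infinity>" by (rule emeasure_cell_config[OF \<zeta>])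
    finally show ?thesis .
  qed
  then show ?thesis
    unfolding space_point_measure_space point_measures_iff[of _ ltraj "range cell"]
    using assemble_point_measure[where \<zeta> = \<zeta>, OF \<zeta>'] by blast
qed

text \<open>The sum over vertices is reindexed by \<open>\<phi>\<close>; at \<open>\<phi> x\<close>
  stands the old copy from \<open>x\<close>, and by \<open>sel_act\<close> the automorphism selected
  there is the old one followed by \<open>\<phi>\<close>.\<close>

lemma assemble_act:
  assumes \<phi>: "\<phi> \<in> graph_Aut E" and U: "inj U" and \<zeta>: "\<And>x. \<zeta> x \<in> space (traj_configs E)"
  shows "assemble (\<lambda>x. U (inv \<phi> x)) (\<lambda>x. \<zeta> (inv \<phi> x)) = act_traj_config E \<phi> (assemble U \<zeta>)"
proof -
  have \<zeta>': "\<And>x. \<zeta> x \<in> point_measures ltraj (hit_boxes E)" using \<zeta> by (simp add: space_traj_configs)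
  note pm = assemble_point_measure[OF \<zeta>']
  have sets1: "sets (assemble U' \<zeta>'') = sets ltraj" for U' \<zeta>'' by (simp add: assemble_def)
  have sets2: "sets (act_traj_config E \<phi> \<omega>) = sets ltraj" for \<omega> by (simp add: act_traj_config_def)
  show ?thesis
  proof (rule measure_eqI)
    fix A assume "A \<in> sets (assemble (\<lambda>x. U (inv \<phi> x)) (\<lambda>x. \<zeta> (inv \<phi> x)))"
    then have A: "A \<in> sets ltraj" by (simp only: sets1)
    let ?B = "{m \<in> space ltraj. (case m of (w, t) \<Rightarrow> (act_traj \<phi> w, t)) \<in> A}"
    have B: "?B \<in> sets ltraj"
      using measurable_sets[OF measurable_labelled_act_traj[OF \<phi>] A] by (simp add: vimage_def Int_def conj_commute)
    have bij: "bij \<phi>" using \<phi> by (simp add: graph_Aut_def)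
    have mv: "moved (sel (\<lambda>v. U (inv \<phi> v)) (\<phi> x)) A = moved (sel U x) ?B" for x
    proof -
      have "sel (\<lambda>v. U (inv \<phi> v)) (\<phi> x) = \<phi> \<circ> sel U x" using sel_act[OF \<phi> U] by auto
      then show ?thesis
        using act_traj_in_traj[OF sel_in_Aut] by (auto simp: moved_def act_traj_comp)
    qed
    have "emeasure (assemble (\<lambda>x. U (inv \<phi> x)) (\<lambda>x. \<zeta> (inv \<phi> x))) A =
        (\<integral>\<^sup>+x. emeasure (\<zeta> (inv \<phi> x)) (moved (sel (\<lambda>x. U (inv \<phi> x)) x) A) \<partial>count_space UNIV)"
      by (rule emeasure_assemble[OF \<zeta>' A])
    also have "\<dots> = (\<integral>\<^sup>+x. emeasure (\<zeta> (inv \<phi> (\<phi> x))) (moved (sel (\<lambda>x. U (inv \<phi> x)) (\<phi> x)) A) \<partial>count_space UNIV)"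
      by (rule nn_integral_bij_count_space[symmetric, OF bij])
    also have "\<dots> = (\<integral>\<^sup>+x. emeasure (\<zeta> x) (moved (sel U x) ?B) \<partial>count_space UNIV)"
      by (simp only: graph_Aut_inv_f[OF \<phi>] mv)
    also have "\<dots> = emeasure (assemble U \<zeta>) ?B"
      by (rule emeasure_assemble[OF \<zeta>' B, symmetric])
    also have "\<dots> = emeasure (act_traj_config E \<phi> (assemble U \<zeta>)) A"
      unfolding act_traj_config_def
      by (rule emeasure_distr_point_measure[OF pm measurable_labelled_act_traj[OF \<phi>] A, symmetric])
    finally show "emeasure (assemble (\<lambda>x. U (inv \<phi> x)) (\<lambda>x. \<zeta> (inv \<phi> x))) A =
        emeasure (act_traj_config E \<phi> (assemble U \<zeta>)) A" .
  qed (simp only: sets1 sets2)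
qed

section \<open>Measurability of the assembled configuration\<close>

abbreviation "Aut_space \<equiv> restrict_space (PiM UNIV (\<lambda>_. count_space UNIV)) (graph_Aut E)"

lemma measurable_joint_act:
  "(\<lambda>(\<psi>, w, t). (act_traj \<psi> w, t)) \<in> measurable (Aut_space \<Otimes>\<^sub>M ltraj) ltraj"
  unfolding labelled_traj_space_def split_beta'
proof (rule measurable_Pair)
  let ?X = "Aut_space \<Otimes>\<^sub>M (traj_space E \<Otimes>\<^sub>M halfline)"
  show "(\<lambda>z. snd (snd z)) \<in> measurable ?X halfline" by measurable
  have w: "(\<lambda>z. fst (snd z)) \<in> measurable ?X (traj_space E)" by measurable
  have \<psi>: "fst \<in> measurable ?X Aut_space" by (rule measurable_fst)
  show "(\<lambda>z. act_traj (fst z) (fst (snd z))) \<in> measurable ?X (traj_space E)"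
  proof (rule measurable_traj_spaceI)
    fix n
    have "(\<lambda>z. fst z v) \<in> measurable ?X (count_space UNIV)" for v
      by (rule measurable_compose[OF \<psi> measurable_restrict_space1]) simp
    then have "(\<lambda>z. fst z (fst (snd z) n)) \<in> measurable ?X (count_space UNIV)"
      by (rule measurable_compose_countable'[OF _ measurable_compose[OF w measurable_traj_coordinate] countable_V])
    then show "(\<lambda>z. act_traj (fst z) (fst (snd z)) n) \<in> measurable ?X (count_space UNIV)"
      by (simp add: act_traj_def)
  next
    fix z assume "z \<in> space ?X"
    then show "act_traj (fst z) (fst (snd z)) \<in> traj E"
      by (intro act_traj_in_traj) (auto simp: space_pair_measure space_restrict_space)
  qed
qed

text \<open>The set on which a copy is counted varies with the labels. It is the section, at the
  selected automorphism, of one measurable set \<open>?S\<close> of pairs of an automorphism and a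
  labelled trajectory, so \<open>measurable_emeasure_section\<close> applies.\<close>

lemma measurable_assemble:
  assumes A: "\<And>v. (\<lambda>z. U z v) \<in> borel_measurable X" and \<zeta>: "\<And>x. (\<lambda>z. \<zeta> z x) \<in> measurable X (traj_configs E)"
  shows "(\<lambda>z. assemble (U z) (\<zeta> z)) \<in> measurable X cell_configs"
proof (rule measurable_point_measure_spaceI)
  fix z assume "z \<in> space X"
  then show "assemble (U z) (\<zeta> z) \<in> point_measures ltraj (range cell)"
    using assemble_in_cell_configs measurable_space[OF \<zeta>] by simp
next
  fix B assume B: "B \<in> sets ltraj"
  let ?S = "{q \<in> space (Aut_space \<Otimes>\<^sub>M ltraj). fst (snd q) 0 = root \<and> (case q of (\<psi>, w, t) \<Rightarrow> (act_traj \<psi> w, t)) \<in> B}"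
  have S: "?S \<in> sets (Aut_space \<Otimes>\<^sub>M ltraj)"
  proof -
    have "{w \<in> traj E. w 0 = root} \<times> {0..} \<in> sets ltraj"
      unfolding labelled_traj_space_def by (intro pair_measureI sets_traj_at sets_halfline) auto
    from measurable_sets[OF measurable_snd this, of Aut_space] measurable_sets[OF measurable_joint_act B]
    have "snd -` ({w \<in> traj E. w 0 = root} \<times> {0..}) \<inter> space (Aut_space \<Otimes>\<^sub>M ltraj) \<inter>
        ((\<lambda>(\<psi>, w, t). (act_traj \<psi> w, t)) -` B \<inter> space (Aut_space \<Otimes>\<^sub>M ltraj)) \<in> sets (Aut_space \<Otimes>\<^sub>M ltraj)" by (rule sets.Int)
    also have "snd -` ({w \<in> traj E. w 0 = root} \<times> {0..}) \<inter> space (Aut_space \<Otimes>\<^sub>M ltraj) \<inter>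
        ((\<lambda>(\<psi>, w, t). (act_traj \<psi> w, t)) -` B \<inter> space (Aut_space \<Otimes>\<^sub>M ltraj)) = ?S"
      by (auto simp: space_pair_measure)
    finally show ?thesis .
  qed
  have sec: "{m \<in> space ltraj. (\<psi>, m) \<in> ?S} = moved \<psi> B" if "\<psi> \<in> graph_Aut E" for \<psi>
    using that by (auto simp: moved_def space_pair_measure space_restrict_space space_PiM)
  have fin: "emeasure \<omega> (cell c) < \<infinity>" if "\<omega> \<in> point_measures ltraj (hit_boxes E)" for \<omega> c
    using emeasure_cell_config that by (simp add: space_traj_configs)
  have "(\<lambda>(\<psi>, \<omega>). emeasure \<omega> {m \<in> space ltraj. (\<psi>, m) \<in> ?S}) \<in> borel_measurable (Aut_space \<Otimes>\<^sub>M traj_configs E)"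
    unfolding traj_configs_def by (rule measurable_emeasure_section[OF fin S])
  note joint = this
  have sec_meas: "(\<lambda>z. emeasure (\<zeta> z x) {m \<in> space ltraj. (sel (U z) x, m) \<in> ?S}) \<in> borel_measurable X" for x
  proof -
    have "U \<in> measurable X (PiM UNIV (\<lambda>_. borel))"
      by (rule measurable_PiM_single') (use A in auto)
    then have "(\<lambda>z. sel (U z) x) \<in> measurable X Aut_space"
      by (rule measurable_compose) (rule measurable_sel, simp)
    from measurable_Pair[OF this \<zeta>[of x]]
    have "(\<lambda>z. (sel (U z) x, \<zeta> z x)) \<in> measurable X (Aut_space \<Otimes>\<^sub>M traj_configs E)" .
    from measurable_compose[OF this joint] show ?thesis by (simp only: prod.case)
  qed
  have "(\<lambda>z. \<integral>\<^sup>+x. emeasure (\<zeta> z x) (moved (sel (U z) x) B) \<partial>count_space UNIV) \<in> borel_measurable X"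
    by (rule borel_measurable_nn_integral_count_space[OF countable_V])
      (use sec_meas in \<open>simp only: sec[OF sel_in_Aut]\<close>)
  then show "(\<lambda>z. emeasure (assemble (U z) (\<zeta> z)) B) \<in> borel_measurable X"
  proof (rule measurable_cong[THEN iffD1, rotated])
    fix z assume "z \<in> space X"
    then have "\<zeta> z x \<in> point_measures ltraj (hit_boxes E)" for x
      using measurable_space[OF \<zeta>] by (simp add: space_traj_configs)
    from emeasure_assemble[OF this B]
    show "(\<integral>\<^sup>+x. emeasure (\<zeta> z x) (moved (sel (U z) x) B) \<partial>count_space UNIV) = emeasure (assemble (U z) (\<zeta> z)) B" by simp
  qed
qed

end

subsection \<open>The law of the assembled configuration\<close>

locale trajectory_poisson = rooted_transitive_graph E root
  for E :: "'v set set" and root :: 'v +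
  fixes Q :: "(int \<Rightarrow> 'v) measure" and P :: "'s measure"
    and ZW :: "'s \<Rightarrow> ((int \<Rightarrow> 'v) \<times> real) measure"
  assumes sets_Q: "sets Q = sets (traj_space E)"
    and Q_act: "\<And>B \<phi>. B \<in> sets (traj_space E) \<Longrightarrow> \<phi> \<in> graph_Aut E \<Longrightarrow>
      emeasure Q B = emeasure Q (act_traj \<phi> ` B)"
    and poisson: "poisson_point_process P (traj_configs E) (Q \<Otimes>\<^sub>M halfline) ZW"
begin

sublocale ZP: prob_space P
  using poisson by (simp add: poisson_point_process_def)

lemma measurable_ZW: "ZW \<in> measurable P (traj_configs E)"
  using poisson by (simp add: poisson_point_process_def)

abbreviation "\<mu> \<equiv> Q \<Otimes>\<^sub>M halfline"

abbreviation "\<kappa> \<equiv> distr P (traj_configs E) ZW"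

lemma sets_\<mu>: "sets \<mu> = sets ltraj"
  unfolding labelled_traj_space_def by (intro sets_pair_measure_cong sets_Q refl)

lemma measurable_Q: "measurable Q N = measurable (traj_space E) N"
  by (rule measurable_cong_sets[OF sets_Q refl])

lemma space_Q: "space Q = traj E"
  using sets_eq_imp_space_eq[OF sets_Q] by simp

text \<open>An infinite value would make the Poisson count on the visit set times the unit interval
  almost surely infinite, whereas \<open>ZW\<close> takes only locally finite values.\<close>

lemma emeasure_hit_finite: "emeasure Q (traj_hit E {x}) < \<infinity>"
proof (rule ccontr)
  assume "\<not> emeasure Q (traj_hit E {x}) < \<infinity>"
  then have inf: "emeasure Q (traj_hit E {x}) = \<infinity>" by (simp add: not_less top_unique)
  interpret h: sigma_finite_measure halfline by (rule sigma_finite_halfline)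
  have "emeasure \<mu> (traj_hit E {x} \<times> {0..1}) = emeasure Q (traj_hit E {x}) * emeasure halfline {0..1}"
    by (rule h.emeasure_pair_measure_Times) (auto simp: sets_Q intro: sets_halfline)
  also have "\<dots> = \<infinity>" by (simp add: inf emeasure_halfline)
  finally have "emeasure \<mu> (traj_hit E {x} \<times> {0..1}) = \<infinity>" .
  moreover have hit: "traj_hit E {x} \<times> {0..1} \<in> sets \<mu>" unfolding sets_\<mu> by (rule sets_labelled_hit)
  ultimately have "AE \<xi> in P. emeasure (ZW \<xi>) (traj_hit E {x} \<times> {0..1}) = \<infinity>"
    using poisson by (simp add: poisson_point_process_def)
  moreover have "AE \<xi> in P. emeasure (ZW \<xi>) (traj_hit E {x} \<times> {0..1}) < \<infinity>"
  proof (rule AE_I2)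
    fix \<xi> assume "\<xi> \<in> space P"
    from measurable_space[OF measurable_ZW this] show "emeasure (ZW \<xi>) (traj_hit E {x} \<times> {0..1}) < \<infinity>"
      unfolding in_traj_configs_iff by (metis of_nat_1)
  qed
  ultimately have "AE \<xi> in P. False" by eventually_elim simp
  then show False by simp
qed

lemma emeasure_\<mu>_cell: "emeasure \<mu> (cell c) < \<infinity>"
proof -
  interpret h: sigma_finite_measure halfline by (rule sigma_finite_halfline)
  let ?I = "{real (snd c)..<real (snd c) + 1}"
  have "emeasure \<mu> (cell c) = emeasure Q {w \<in> traj E. w 0 = fst c} * emeasure halfline ?I"
    unfolding cell_def by (rule h.emeasure_pair_measure_Times) (auto simp: sets_Q intro: sets_halfline)
  also have "emeasure halfline ?I = 1" by (subst emeasure_halfline) auto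
  also have "emeasure Q {w \<in> traj E. w 0 = fst c} * 1 \<le> emeasure Q (traj_hit E {fst c})"
    using sets_traj_hit[of E "fst c"] by (simp, intro emeasure_mono) (auto simp: traj_hit_def, simp add: sets_Q)
  also have "\<dots> < \<infinity>" by (rule emeasure_hit_finite)
  finally show ?thesis .
qed

lemma emeasure_\<mu>_cell_set: "D \<in> cell_sets \<Longrightarrow> emeasure \<mu> D < \<infinity>"
proof -
  assume "D \<in> cell_sets"
  then obtain c where "D \<subseteq> cell c" by (auto simp: cell_sets_def)
  then have "emeasure \<mu> D \<le> emeasure \<mu> (cell c)" by (rule emeasure_mono) (simp only: sets_\<mu> sets_cells)
  then show ?thesis using emeasure_\<mu>_cell by (rule order.strict_trans1)
qed

lemma distr_map_label:
  assumes f: "f \<in> measurable (traj_space E) B"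
  shows "distr \<mu> (B \<Otimes>\<^sub>M halfline) (\<lambda>(w, t). (f w, t)) = distr Q B f \<Otimes>\<^sub>M halfline"
proof -
  have "distr Q B f \<Otimes>\<^sub>M distr halfline halfline (\<lambda>t. t) = distr \<mu> (B \<Otimes>\<^sub>M halfline) (\<lambda>(w, t). (f w, t))"
    by (rule pair_measure_distr) (use f in \<open>auto simp: measurable_Q sigma_finite_halfline\<close>)
  then show ?thesis by simp
qed

text \<open>The invariance assumption speaks of images, \<open>distr\<close> of preimages; the
  preimage under \<open>\<phi>\<close> is the image under \<open>inv \<phi>\<close>.\<close>

lemma distr_Q_act:
  assumes \<phi>: "\<phi> \<in> graph_Aut E"
  shows "distr Q (traj_space E) (act_traj \<phi>) = Q"
proof (rule measure_eqI)
  fix B assume "B \<in> sets (distr Q (traj_space E) (act_traj \<phi>))"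
  then have B: "B \<in> sets (traj_space E)" by simp
  have "act_traj \<phi> -` B \<inter> traj E = act_traj (inv \<phi>) ` B"
  proof (intro set_eqI iffI)
    fix w assume "w \<in> act_traj \<phi> -` B \<inter> traj E"
    then show "w \<in> act_traj (inv \<phi>) ` B" using \<phi> by (intro image_eqI[of _ _ "act_traj \<phi> w"]) auto
  next
    fix w assume "w \<in> act_traj (inv \<phi>) ` B"
    then show "w \<in> act_traj \<phi> -` B \<inter> traj E"
      using \<phi> sets.sets_into_space[OF B] act_traj_in_traj[OF graph_Aut_inv[OF \<phi>]] by auto
  qed
  then show "emeasure (distr Q (traj_space E) (act_traj \<phi>)) B = emeasure Q B"
    using Q_act[OF B graph_Aut_inv[OF \<phi>]] B measurable_act_traj[OF \<phi>]
    by (simp add: emeasure_distr measurable_Q space_Q)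
qed (simp add: sets_Q)

text \<open>A trajectory that \<open>\<psi>\<close> puts at \<open>x\<close> at time 0 was at the
  root, because \<open>\<psi>\<close> is injective and takes the root to \<open>x\<close>. The root
  condition in \<open>moved\<close> is therefore automatic over \<open>x\<close>.\<close>

lemma moved_eq:
  assumes "\<psi> \<in> Aut_to x" "D \<subseteq> cell (x, m)"
  shows "moved \<psi> D = (\<lambda>(w, t). (act_traj \<psi> w, t)) -` D \<inter> space ltraj"
proof -
  have "w 0 = root" if "act_traj \<psi> w 0 = x" for w
    using that assms(1) by (auto simp: act_traj_def Aut_to_def dest: graph_Aut_inv_f) (metis graph_Aut_inv_f)
  then show ?thesis using assms(2) by (fastforce simp: moved_def cell_def)
qed

lemma emeasure_moved:
  assumes "\<psi> \<in> Aut_to x" "D \<in> sets ltraj" "D \<subseteq> cell (x, m)"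
  shows "emeasure \<mu> (moved \<psi> D) = emeasure \<mu> D"
proof -
  have \<psi>: "\<psi> \<in> graph_Aut E" using assms(1) by (simp add: Aut_to_def)
  have sp: "space \<mu> = space ltraj" by (rule sets_eq_imp_space_eq[OF sets_\<mu>])
  have m: "(\<lambda>(w, t). (act_traj \<psi> w, t)) \<in> measurable \<mu> ltraj"
    using measurable_labelled_act_traj[OF \<psi>] by (simp add: measurable_cong_sets[OF sets_\<mu> refl])
  have "emeasure \<mu> D = emeasure (distr \<mu> ltraj (\<lambda>(w, t). (act_traj \<psi> w, t))) D"
    using distr_map_label[OF measurable_act_traj[OF \<psi>]] by (simp add: distr_Q_act[OF \<psi>] labelled_traj_space_def)
  also have "\<dots> = emeasure \<mu> (moved \<psi> D)"
    unfolding moved_eq[OF assms(1,3)] emeasure_distr[OF m assms(2)] sp ..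
  finally show ?thesis by simp
qed

text \<open>Supplies the left inverse that makes \<open>moved \<psi>\<close> injective on sets in
  cells over \<open>x\<close>, so that a family and its displaced family have matching
  members.\<close>

lemma image_moved:
  assumes "\<psi> \<in> Aut_to x" "D \<subseteq> cell (x, m)"
  shows "(\<lambda>(w, t). (act_traj \<psi> w, t)) ` moved \<psi> D = D"
proof (intro set_eqI iffI)
  fix p assume "p \<in> (\<lambda>(w, t). (act_traj \<psi> w, t)) ` moved \<psi> D"
  then show "p \<in> D" by (auto simp: moved_def)
next
  fix p assume p: "p \<in> D"
  have \<psi>: "\<psi> \<in> graph_Aut E" using assms(1) by (simp add: Aut_to_def)
  have "fst p \<in> traj E" "snd p \<ge> 0" using p assms(2) by (auto simp: cell_def)
  then have "(act_traj (inv \<psi>) (fst p), snd p) \<in> moved \<psi> D"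
    unfolding moved_eq[OF assms] using p act_traj_in_traj[OF graph_Aut_inv[OF \<psi>]] \<psi> by simp
  then show "p \<in> (\<lambda>(w, t). (act_traj \<psi> w, t)) ` moved \<psi> D"
    using \<psi> by (intro image_eqI[of _ _ "(act_traj (inv \<psi>) (fst p), snd p)"]) auto
qed

definition poisson_weight :: "((int \<Rightarrow> 'v) \<times> real) set \<Rightarrow> nat \<Rightarrow> ennreal" where
  "poisson_weight D k = ennreal (exp (- measure \<mu> D) * measure \<mu> D ^ k / fact k)"

lemma prob_space_\<kappa>: "prob_space \<kappa>"
  by (rule ZP.prob_space_distr[OF measurable_ZW])

lemma ZW_fdd:
  assumes "finite \<D>" "disjoint \<D>" "\<D> \<subseteq> cell_sets"
  shows "emeasure P {\<xi> \<in> space P. \<forall>D\<in>\<D>. emeasure (ZW \<xi>) D = of_nat (k D)} = (\<Prod>D\<in>\<D>. poisson_weight D (k D))"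
proof -
  have "\<D> \<subseteq> sets \<mu>" using assms(3) unfolding sets_\<mu> by (auto simp: cell_sets_def)
  then have "measure P {\<xi> \<in> space P. \<forall>D\<in>\<D>. emeasure (ZW \<xi>) D = of_nat (k D)} =
      (\<Prod>D\<in>\<D>. exp (- measure \<mu> D) * measure \<mu> D ^ k D / fact (k D))"
    using assms emeasure_\<mu>_cell_set by (intro poisson_point_process_fdd[OF poisson]) auto
  then show ?thesis
    by (simp add: ZP.emeasure_eq_measure poisson_weight_def prod_ennreal)
qed

lemma \<kappa>_fdd:
  assumes "finite \<D>" "disjoint \<D>" "\<D> \<subseteq> cell_sets"
  shows "emeasure \<kappa> {\<omega> \<in> space (traj_configs E). \<forall>D\<in>\<D>. emeasure \<omega> D = of_nat (k D)} = (\<Prod>D\<in>\<D>. poisson_weight D (k D))"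
proof -
  have "{\<omega> \<in> space (traj_configs E). \<forall>D\<in>\<D>. emeasure \<omega> D = of_nat (k D)} \<in> sets (traj_configs E)"
    unfolding space_traj_configs unfolding traj_configs_def
    using assms(1,3) by (intro sets_counts) (auto simp: cell_sets_def)
  then have "emeasure \<kappa> {\<omega> \<in> space (traj_configs E). \<forall>D\<in>\<D>. emeasure \<omega> D = of_nat (k D)} =
      emeasure P (ZW -` {\<omega> \<in> space (traj_configs E). \<forall>D\<in>\<D>. emeasure \<omega> D = of_nat (k D)} \<inter> space P)"
    by (rule emeasure_distr[OF measurable_ZW])
  also have "ZW -` {\<omega> \<in> space (traj_configs E). \<forall>D\<in>\<D>. emeasure \<omega> D = of_nat (k D)} \<inter> space P =
      {\<xi> \<in> space P. \<forall>D\<in>\<D>. emeasure (ZW \<xi>) D = of_nat (k D)}"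
    using measurable_space[OF measurable_ZW] by auto
  finally show ?thesis using ZW_fdd[OF assms] by simp
qed

lemma moved_in_cell_sets:
  assumes "\<psi> \<in> Aut_to x" "D \<in> sets ltraj" "D \<subseteq> cell (x, m)"
  shows "moved \<psi> D \<in> cell_sets"
proof -
  have "moved \<psi> D \<in> sets ltraj" using assms sets_moved by (auto simp: Aut_to_def)
  moreover have "moved \<psi> D \<subseteq> cell (root, m)"
  proof
    fix p assume p: "p \<in> moved \<psi> D"
    then have "(act_traj \<psi> (fst p), snd p) \<in> cell (x, m)" using assms(3) by (auto simp: moved_def)
    with p show "p \<in> cell (root, m)" by (cases p) (simp add: moved_def cell_def)
  qed
  ultimately show ?thesis by (auto simp: cell_sets_def)
qed

text \<open>The displaced sets are disjoint, lie in cells over the root and have the intensities of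
  the original sets by invariance of \<open>Q\<close>. A copy of the process seen from the root
  through any such \<open>\<psi>\<close> thus has the counts that the process has over
  \<open>x\<close>.\<close>

lemma \<kappa>_fdd_moved:
  assumes \<D>: "finite \<D>" "disjoint \<D>" "\<D> \<subseteq> sets ltraj" and x: "\<And>D. D \<in> \<D> \<Longrightarrow> \<exists>m. D \<subseteq> cell (x, m)"
    and \<psi>: "\<psi> \<in> Aut_to x"
  shows "emeasure \<kappa> {\<omega> \<in> space (traj_configs E). \<forall>D\<in>\<D>. emeasure \<omega> (moved \<psi> D) = of_nat (k D)} =
    (\<Prod>D\<in>\<D>. poisson_weight D (k D))"
proof -
  \<comment> \<open>Transfers the prescribed counts from \<open>\<D>\<close> to the displaced
    family.\<close>
  let ?inv = "the_inv_into \<D> (moved \<psi>)"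
  have inj: "inj_on (moved \<psi>) \<D>"
  proof (rule inj_on_inverseI)
    fix D assume "D \<in> \<D>"
    then obtain m where "D \<subseteq> cell (x, m)" using x by blast
    then show "(\<lambda>(w, t). (act_traj \<psi> w, t)) ` moved \<psi> D = D" by (rule image_moved[OF \<psi>])
  qed
  have disj: "disjoint (moved \<psi> ` \<D>)"
    using \<D>(2) by (auto simp: disjoint_def moved_def)
  have sub: "moved \<psi> ` \<D> \<subseteq> cell_sets"
  proof (rule image_subsetI)
    fix D assume "D \<in> \<D>"
    then obtain m where "D \<in> sets ltraj" "D \<subseteq> cell (x, m)" using x \<D>(3) by blast
    then show "moved \<psi> D \<in> cell_sets" by (rule moved_in_cell_sets[OF \<psi>])
  qed
  have "{\<omega> \<in> space (traj_configs E). \<forall>D\<in>\<D>. emeasure \<omega> (moved \<psi> D) = of_nat (k D)} =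
      {\<omega> \<in> space (traj_configs E). \<forall>D\<in>moved \<psi> ` \<D>. emeasure \<omega> D = of_nat (k (?inv D))}"
    by (auto simp: the_inv_into_f_f[OF inj])
  also have "emeasure \<kappa> \<dots> = (\<Prod>D\<in>moved \<psi> ` \<D>. poisson_weight D (k (?inv D)))"
    using \<D>(1) disj sub by (intro \<kappa>_fdd) auto
  also have "\<dots> = (\<Prod>D\<in>\<D>. poisson_weight (moved \<psi> D) (k D))"
    by (subst prod.reindex[OF inj]) (auto simp: the_inv_into_f_f[OF inj] intro: prod.cong)
  also have "\<dots> = (\<Prod>D\<in>\<D>. poisson_weight D (k D))"
  proof (rule prod.cong)
    fix D assume "D \<in> \<D>"
    then obtain m where "D \<in> sets ltraj" "D \<subseteq> cell (x, m)" using x \<D>(3) by blast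
    then have "emeasure \<mu> (moved \<psi> D) = emeasure \<mu> D" by (rule emeasure_moved[OF \<psi>])
    then show "poisson_weight (moved \<psi> D) (k D) = poisson_weight D (k D)"
      by (simp add: poisson_weight_def measure_def)
  qed simp
  finally show ?thesis .
qed

section \<open>Independent copies, and their assembly with the labels fixed or random\<close>

abbreviation "\<kappa>s \<equiv> PiM (UNIV :: 'v set) (\<lambda>_. \<kappa>)"

abbreviation "labels \<equiv> PiM (UNIV :: 'v set) (\<lambda>_. unit_uniform)"

lemma space_\<kappa>s: "\<zeta> \<in> space \<kappa>s \<longleftrightarrow> (\<forall>x. \<zeta> x \<in> space (traj_configs E))"
  by (auto simp: space_PiM PiE_iff)

text \<open>For fixed labels, the sets over one vertex read only the copy at that vertex. Grouped by
  vertex, the event is a finite box in the product of the copies, and each factor is known by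
  \<open>\<kappa>_fdd_moved\<close>. The value does not depend on \<open>U\<close>.\<close>

lemma assemble_fdd_given_labels:
  assumes \<D>: "finite \<D>" "disjoint \<D>" "\<D> \<subseteq> cell_sets"
  shows "emeasure \<kappa>s {\<zeta> \<in> space \<kappa>s. \<forall>D\<in>\<D>. emeasure (assemble U \<zeta>) D = of_nat (k D)} =
    (\<Prod>D\<in>\<D>. poisson_weight D (k D))"
proof -
  have "\<forall>D\<in>\<D>. \<exists>c. D \<subseteq> cell c" using \<D>(3) by (auto simp: cell_sets_def)
  \<comment> \<open>The empty set lies in every cell, so this is a genuine choice; any one works,
    because \<open>emeasure_assemble_cell\<close> holds for each cell containing
    \<open>D\<close>.\<close>
  from bchoice[OF this] obtain cf where cf: "\<And>D. D \<in> \<D> \<Longrightarrow> D \<subseteq> cell (cf D)" by blast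
  define xf where "xf D = fst (cf D)" for D
  have xf: "\<exists>m. D \<subseteq> cell (xf D, m)" if "D \<in> \<D>" for D
    using cf[OF that] unfolding xf_def by (metis prod.collapse)
  have \<D>_sets: "\<D> \<subseteq> sets ltraj" using \<D>(3) by (auto simp: cell_sets_def)
  define Dx where "Dx x = {D \<in> \<D>. xf D = x}" for x
  define Y where "Y x = {\<omega> \<in> space (traj_configs E). \<forall>D\<in>Dx x. emeasure \<omega> (moved (sel U x) D) = of_nat (k D)}" for x
  have Y_sets: "Y x \<in> sets \<kappa>" for x
    unfolding Y_def sets_distr unfolding space_traj_configs unfolding traj_configs_def
    using \<D>(1) \<D>_sets by (intro sets_counts sets_moved sel_in_Aut) (auto simp: Dx_def)
  have Y: "emeasure \<kappa> (Y x) = (\<Prod>D\<in>Dx x. poisson_weight D (k D))" for x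
    unfolding Y_def
  proof (rule \<kappa>_fdd_moved[OF _ _ _ _ sel_in_Aut_to])
    show "finite (Dx x)" "Dx x \<subseteq> sets ltraj" using \<D>(1) \<D>_sets by (auto simp: Dx_def)
    show "disjoint (Dx x)" using \<D>(2) by (rule pairwise_subset) (auto simp: Dx_def)
    show "\<exists>m. D \<subseteq> cell (x, m)" if "D \<in> Dx x" for D using xf that by (auto simp: Dx_def)
  qed
  have "{\<zeta> \<in> space \<kappa>s. \<forall>D\<in>\<D>. emeasure (assemble U \<zeta>) D = of_nat (k D)} =
      prod_emb UNIV (\<lambda>_. \<kappa>) (xf ` \<D>) (Pi\<^sub>E (xf ` \<D>) Y)"
  proof (rule set_eqI)
    fix \<zeta>
    show "\<zeta> \<in> {\<zeta> \<in> space \<kappa>s. \<forall>D\<in>\<D>. emeasure (assemble U \<zeta>) D = of_nat (k D)} \<longleftrightarrow>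
        \<zeta> \<in> prod_emb UNIV (\<lambda>_. \<kappa>) (xf ` \<D>) (Pi\<^sub>E (xf ` \<D>) Y)"
    proof (cases "\<zeta> \<in> space \<kappa>s")
      case True
      then have \<zeta>: "\<zeta> x \<in> space (traj_configs E)" for x by (simp add: space_\<kappa>s)
      then have \<zeta>': "\<zeta> x \<in> point_measures ltraj (hit_boxes E)" for x by (simp add: space_traj_configs)
      have "emeasure (assemble U \<zeta>) D = emeasure (\<zeta> (xf D)) (moved (sel U (xf D)) D)" if D: "D \<in> \<D>" for D
      proof -
        obtain m where "D \<subseteq> cell (xf D, m)" using xf[OF D] by blast
        with D \<D>_sets show ?thesis by (intro emeasure_assemble_cell[where \<zeta> = \<zeta>, OF \<zeta>']) auto
      qed
      then show ?thesis using True \<zeta> by (auto simp: prod_emb_def PiE_iff Y_def Dx_def)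
    next
      case False
      then show ?thesis by (auto simp: prod_emb_def space_PiM)
    qed
  qed
  then have "emeasure \<kappa>s {\<zeta> \<in> space \<kappa>s. \<forall>D\<in>\<D>. emeasure (assemble U \<zeta>) D = of_nat (k D)} =
      (\<Prod>x\<in>xf ` \<D>. emeasure \<kappa> (Y x))"
    using \<D>(1) Y_sets by (simp only:) (intro emeasure_PiM_emb prob_space_\<kappa>, auto)
  also have "\<dots> = (\<Prod>x\<in>xf ` \<D>. \<Prod>D\<in>Dx x. poisson_weight D (k D))" by (simp only: Y)
  also have "\<dots> = (\<Prod>D\<in>\<D>. poisson_weight D (k D))"
    unfolding Dx_def by (rule prod.group) (use \<D>(1) in auto)
  finally show ?thesis .
qed

lemma prob_space_\<kappa>s: "prob_space \<kappa>s"
  by (intro prob_space_PiM prob_space_\<kappa>)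

lemma prob_space_labels: "prob_space labels"
  by (intro prob_space_PiM prob_space_unit_uniform)

lemma prob_space_pair: "prob_space (labels \<Otimes>\<^sub>M \<kappa>s)"
proof -
  interpret L: prob_space labels by (rule prob_space_labels)
  interpret K: prob_space \<kappa>s by (rule prob_space_\<kappa>s)
  interpret pair_prob_space labels \<kappa>s ..
  show ?thesis by unfold_locales
qed

lemma measurable_assemble_pair: "(\<lambda>z. assemble (fst z) (snd z)) \<in> measurable (labels \<Otimes>\<^sub>M \<kappa>s) cell_configs"
proof (rule measurable_assemble)
  have "(\<lambda>U. U v) \<in> measurable labels unit_uniform" for v by measurable
  then have "(\<lambda>U. U v) \<in> borel_measurable labels" for v
    by (simp add: measurable_cong_sets[OF refl sets_unit_uniform])
  then show "(\<lambda>z. fst z v) \<in> borel_measurable (labels \<Otimes>\<^sub>M \<kappa>s)" for v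
    by (rule measurable_compose[OF measurable_fst])
  have "(\<lambda>\<zeta>. \<zeta> x) \<in> measurable \<kappa>s \<kappa>" for x by measurable
  then have "(\<lambda>\<zeta>. \<zeta> x) \<in> measurable \<kappa>s (traj_configs E)" for x by simp
  then show "(\<lambda>z. snd z x) \<in> measurable (labels \<Otimes>\<^sub>M \<kappa>s) (traj_configs E)" for x
    by (rule measurable_compose[OF measurable_snd])
qed

text \<open>The copies are independent of the labels, so Fubini reduces to fixed labels, where the
  probability is one and the same constant.\<close>

lemma assemble_fdd:
  assumes \<D>: "finite \<D>" "disjoint \<D>" "\<D> \<subseteq> cell_sets"
  shows "emeasure (labels \<Otimes>\<^sub>M \<kappa>s) {z \<in> space (labels \<Otimes>\<^sub>M \<kappa>s). \<forall>D\<in>\<D>. emeasure (assemble (fst z) (snd z)) D = of_nat (k D)} =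
    (\<Prod>D\<in>\<D>. poisson_weight D (k D))"
proof -
  interpret L: prob_space labels by (rule prob_space_labels)
  interpret K: prob_space \<kappa>s by (rule prob_space_\<kappa>s)
  let ?ev = "{z \<in> space (labels \<Otimes>\<^sub>M \<kappa>s). \<forall>D\<in>\<D>. emeasure (assemble (fst z) (snd z)) D = of_nat (k D)}"
  have c: "{\<omega> \<in> point_measures ltraj (range cell). \<forall>D\<in>\<D>. emeasure \<omega> D = of_nat (k D)} \<in> sets cell_configs"
    using \<D>(1,3) by (intro sets_counts) (auto simp: cell_sets_def)
  have "?ev = (\<lambda>z. assemble (fst z) (snd z)) -` {\<omega> \<in> point_measures ltraj (range cell). \<forall>D\<in>\<D>. emeasure \<omega> D = of_nat (k D)} \<inter> space (labels \<Otimes>\<^sub>M \<kappa>s)"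
    using measurable_space[OF measurable_assemble_pair] by auto
  then have "?ev \<in> sets (labels \<Otimes>\<^sub>M \<kappa>s)" using measurable_sets[OF measurable_assemble_pair c] by simp
  then have "emeasure (labels \<Otimes>\<^sub>M \<kappa>s) ?ev = (\<integral>\<^sup>+U. emeasure \<kappa>s (Pair U -` ?ev) \<partial>labels)"
    by (rule K.emeasure_pair_measure_alt)
  also have "\<dots> = (\<integral>\<^sup>+U. (\<Prod>D\<in>\<D>. poisson_weight D (k D)) \<partial>labels)"
  proof (rule nn_integral_cong)
    fix U assume "U \<in> space labels"
    then have "Pair U -` ?ev = {\<zeta> \<in> space \<kappa>s. \<forall>D\<in>\<D>. emeasure (assemble U \<zeta>) D = of_nat (k D)}"
      by (auto simp: space_pair_measure)
    then show "emeasure \<kappa>s (Pair U -` ?ev) = (\<Prod>D\<in>\<D>. poisson_weight D (k D))"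
      using assemble_fdd_given_labels[OF \<D>] by simp
  qed
  also have "\<dots> = (\<Prod>D\<in>\<D>. poisson_weight D (k D))" by (simp add: L.emeasure_space_1)
  finally show ?thesis .
qed

lemma measurable_ZW_cell_configs: "ZW \<in> measurable P cell_configs"
proof (rule measurable_point_measure_spaceI)
  show "ZW \<xi> \<in> point_measures ltraj (range cell)" if "\<xi> \<in> space P" for \<xi>
    using measurable_space[OF measurable_ZW that] traj_configs_subset_cell_configs by auto
  show "(\<lambda>\<xi>. emeasure (ZW \<xi>) A) \<in> borel_measurable P" if "A \<in> sets ltraj" for A
    using measurable_compose[OF measurable_ZW[unfolded traj_configs_def] measurable_emeasure_point_measure[OF that]] .
qed

lemma emeasure_distr_counts:
  assumes Z: "Z \<in> measurable X (point_measure_space ltraj F)" and \<D>: "finite \<D>" "\<D> \<subseteq> cell_sets"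
  shows "emeasure (distr X (point_measure_space ltraj F) Z) {\<omega> \<in> point_measures ltraj F. \<forall>D\<in>\<D>. emeasure \<omega> D = of_nat (k D)} =
    emeasure X {x \<in> space X. \<forall>D\<in>\<D>. emeasure (Z x) D = of_nat (k D)}"
proof -
  have "{\<omega> \<in> point_measures ltraj F. \<forall>D\<in>\<D>. emeasure \<omega> D = of_nat (k D)} \<in> sets (point_measure_space ltraj F)"
    using \<D> by (intro sets_counts) (auto simp: cell_sets_def)
  moreover have "Z -` {\<omega> \<in> point_measures ltraj F. \<forall>D\<in>\<D>. emeasure \<omega> D = of_nat (k D)} \<inter> space X =
      {x \<in> space X. \<forall>D\<in>\<D>. emeasure (Z x) D = of_nat (k D)}"
    using measurable_space[OF Z] by auto
  ultimately show ?thesis by (simp add: emeasure_distr[OF Z])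
qed

text \<open>The comparison takes place on the larger space, where \<open>assemble\<close> is
  measurable and always takes its values; local finiteness cannot yet be presupposed.\<close>

lemma assemble_law:
  "distr (labels \<Otimes>\<^sub>M \<kappa>s) cell_configs (\<lambda>z. assemble (fst z) (snd z)) = distr P cell_configs ZW"
proof (rule point_measure_eqI)
  interpret PS: prob_space "labels \<Otimes>\<^sub>M \<kappa>s" by (rule prob_space_pair)
  show "prob_space (distr (labels \<Otimes>\<^sub>M \<kappa>s) cell_configs (\<lambda>z. assemble (fst z) (snd z)))"
    by (rule PS.prob_space_distr[OF measurable_assemble_pair])
  show "prob_space (distr P cell_configs ZW)"
    by (rule ZP.prob_space_distr[OF measurable_ZW_cell_configs])
  show "emeasure \<omega> (cell c) < \<infinity>" if "\<omega> \<in> point_measures ltraj (range cell)" for \<omega> c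
    using that point_measures_iff[of \<omega> ltraj "range cell"] by blast
  show "emeasure (distr (labels \<Otimes>\<^sub>M \<kappa>s) cell_configs (\<lambda>z. assemble (fst z) (snd z)))
        {\<omega> \<in> point_measures ltraj (range cell). \<forall>D\<in>\<D>. emeasure \<omega> D = of_nat (k D)} =
      emeasure (distr P cell_configs ZW) {\<omega> \<in> point_measures ltraj (range cell). \<forall>D\<in>\<D>. emeasure \<omega> D = of_nat (k D)}"
    if "finite \<D>" "disjoint \<D>" "\<D> \<subseteq> cell_sets" for \<D> and k :: "((int \<Rightarrow> 'v) \<times> real) set \<Rightarrow> nat"
    using that by (simp add: emeasure_distr_counts[OF measurable_assemble_pair] emeasure_distr_counts[OF measurable_ZW_cell_configs]
        assemble_fdd ZW_fdd)
qed simp_all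

text \<open>\<open>ZW\<close> is locally finite for every sample point. Local finiteness is an event
  of the common law on the larger space, so it passes to the assembled configuration almost
  surely.\<close>

lemma AE_assemble_good:
  "AE z in labels \<Otimes>\<^sub>M \<kappa>s. inj (fst z) \<and> assemble (fst z) (snd z) \<in> space (traj_configs E)"
proof -
  interpret L: prob_space labels by (rule prob_space_labels)
  interpret K: prob_space \<kappa>s by (rule prob_space_\<kappa>s)
  interpret PS: prob_space "labels \<Otimes>\<^sub>M \<kappa>s" by (rule prob_space_pair)
  have "AE \<omega> in distr P cell_configs ZW. \<omega> \<in> space (traj_configs E)"
    by (subst AE_distr_iff[OF measurable_ZW_cell_configs])
      (use traj_configs_in_sets_cell_configs sets.sets_into_space[OF traj_configs_in_sets_cell_configs] measurable_space[OF measurable_ZW] in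
        \<open>auto simp: Int_absorb1 Collect_conj_eq intro!: AE_I2\<close>)
  then have "AE \<omega> in distr (labels \<Otimes>\<^sub>M \<kappa>s) cell_configs (\<lambda>z. assemble (fst z) (snd z)). \<omega> \<in> space (traj_configs E)"
    by (simp only: assemble_law)
  then have 1: "AE z in labels \<Otimes>\<^sub>M \<kappa>s. assemble (fst z) (snd z) \<in> space (traj_configs E)"
    by (rule AE_distrD[OF measurable_assemble_pair])
  have "AE U in distr (labels \<Otimes>\<^sub>M \<kappa>s) labels fst. inj U"
    by (subst K.distr_pair_fst) (rule AE_inj_PiM_unit_uniform[OF countable_V])
  then have 2: "AE z in labels \<Otimes>\<^sub>M \<kappa>s. inj (fst z)"
    by (rule AE_distrD[OF measurable_fst])
  show ?thesis using 1 2 by eventually_elim simp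
qed

end

subsection \<open>The factor map\<close>

context trajectory_poisson
begin

definition empty_config :: "((int \<Rightarrow> 'v) \<times> real) measure" where
  "empty_config = distr (count_space ({} :: nat set)) ltraj (\<lambda>_. undefined)"

lemma emeasure_empty_config: "emeasure empty_config A = 0"
proof (cases "A \<in> sets ltraj")
  case True
  then show ?thesis unfolding empty_config_def by (subst emeasure_distr) auto
next
  case False
  then show ?thesis by (simp add: emeasure_notin_sets empty_config_def)
qed

lemma empty_config_in_configs: "empty_config \<in> space (traj_configs E)"
proof -
  have "empty_config \<in> point_measures ltraj {}"
    unfolding empty_config_def by (rule distr_count_space_point_measure) auto
  then show ?thesis unfolding in_traj_configs_iff by (simp add: emeasure_empty_config)
qed

lemma act_empty_config:
  assumes "\<phi> \<in> graph_Aut E"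
  shows "act_traj_config E \<phi> empty_config = empty_config"
proof (rule measure_eqI)
  fix A assume "A \<in> sets (act_traj_config E \<phi> empty_config)"
  then have A: "A \<in> sets ltraj" by (simp add: act_traj_config_def)
  have "empty_config \<in> point_measures ltraj {}"
    using empty_config_in_configs unfolding in_traj_configs_iff by blast
  then show "emeasure (act_traj_config E \<phi> empty_config) A = emeasure empty_config A"
    unfolding act_traj_config_def
    by (simp only: emeasure_distr_point_measure[OF _ measurable_labelled_act_traj[OF assms] A] emeasure_empty_config)
qed (simp add: act_traj_config_def empty_config_def)

text \<open>
  Equivariance is required for every label configuration, so the null set where the assembled
  point measure is not equivariant or not locally finite is mapped to the empty configuration.
\<close>

definition factor_map :: "('v \<Rightarrow> real) \<times> ('v \<Rightarrow> ((int \<Rightarrow> 'v) \<times> real) measure) \<Rightarrow> ((int \<Rightarrow> 'v) \<times> real) measure" where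
  "factor_map z = (if inj (fst z) \<and> assemble (fst z) (snd z) \<in> space (traj_configs E)
     then assemble (fst z) (snd z) else empty_config)"

lemma factor_map_in_configs: "factor_map z \<in> space (traj_configs E)"
  by (simp add: factor_map_def empty_config_in_configs)

text \<open>Both conditions in \<open>factor_map\<close> are unchanged when labels and copies are
  permuted by \<open>\<phi>\<close>, so the same branch is taken on both sides. The default branch
  is consistent because the empty configuration is fixed by the action.\<close>

lemma factor_map_act:
  assumes \<phi>: "\<phi> \<in> graph_Aut E" and \<zeta>: "\<And>x. \<zeta> x \<in> space (traj_configs E)"
  shows "factor_map (\<lambda>x. U (inv \<phi> x), \<lambda>x. \<zeta> (inv \<phi> x)) = act_traj_config E \<phi> (factor_map (U, \<zeta>))"
proof -
  have bij: "bij (inv \<phi>)" using graph_Aut_inv[OF \<phi>] by (simp add: graph_Aut_def)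
  have inj: "inj (\<lambda>x. U (inv \<phi> x)) \<longleftrightarrow> inj U"
  proof
    assume "inj (\<lambda>x. U (inv \<phi> x))"
    then show "inj U" using \<phi> unfolding inj_def by (metis graph_Aut_inv_f)
  next
    assume "inj U"
    then show "inj (\<lambda>x. U (inv \<phi> x))" using bij by (simp add: inj_def bij_def)
  qed
  show ?thesis
  proof (cases "inj U")
    case True
    have \<zeta>': "\<zeta> x \<in> point_measures ltraj (hit_boxes E)" for x using \<zeta> by (simp add: space_traj_configs)
    note eq = assemble_act[where \<zeta> = \<zeta>, OF \<phi> True \<zeta>]
    note pm = assemble_point_measure[where \<zeta> = \<zeta> and U = U, OF \<zeta>']
    show ?thesis
      unfolding factor_map_def fst_conv snd_conv inj eq act_traj_config_in_configs_iff[OF \<phi> pm]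
      by (simp add: act_empty_config[OF \<phi>])
  next
    case False
    then show ?thesis by (simp add: factor_map_def inj act_empty_config[OF \<phi>])
  qed
qed

lemma measurable_factor_map: "factor_map \<in> measurable (labels \<Otimes>\<^sub>M \<kappa>s) (traj_configs E)"
proof (subst (2) traj_configs_def, rule measurable_point_measure_spaceI)
  show "factor_map z \<in> point_measures ltraj (hit_boxes E)" for z
    using factor_map_in_configs by (simp add: space_traj_configs)
  fix A assume A: "A \<in> sets ltraj"
  let ?X = "labels \<Otimes>\<^sub>M \<kappa>s"
  have good: "{z \<in> space ?X. assemble (fst z) (snd z) \<in> space (traj_configs E)} \<in> sets ?X"
    using measurable_sets[OF measurable_assemble_pair traj_configs_in_sets_cell_configs]
    by (simp add: vimage_def Int_def conj_commute)
  have "(\<lambda>z. fst z x) \<in> borel_measurable ?X" for x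
  proof -
    have "(\<lambda>U. U x) \<in> measurable labels unit_uniform" by measurable
    then have "(\<lambda>U. U x) \<in> borel_measurable labels"
      by (simp add: measurable_cong_sets[OF refl sets_unit_uniform])
    then show ?thesis by (rule measurable_compose[OF measurable_fst])
  qed
  then have "{z \<in> space ?X. \<forall>x\<in>UNIV. \<forall>y\<in>UNIV. x \<noteq> y \<longrightarrow> fst z x \<noteq> fst z y} \<in> sets ?X"
    by (intro sets.sets_Collect_countable_All'[OF _ countable_V] sets.sets_Collect_imp sets.sets_Collect_const borel_measurable_neq)
  also have "{z \<in> space ?X. \<forall>x\<in>UNIV. \<forall>y\<in>UNIV. x \<noteq> y \<longrightarrow> fst z x \<noteq> fst z y} = {z \<in> space ?X. inj (fst z)}"
    by (auto simp: inj_def)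
  finally have "{z \<in> space ?X. inj (fst z) \<and> assemble (fst z) (snd z) \<in> space (traj_configs E)} \<in> sets ?X"
    by (rule sets.sets_Collect_conj[OF good])
  then have "(\<lambda>z. if inj (fst z) \<and> assemble (fst z) (snd z) \<in> space (traj_configs E)
      then emeasure (assemble (fst z) (snd z)) A else 0) \<in> borel_measurable ?X"
    by (intro measurable_If measurable_compose[OF measurable_assemble_pair measurable_emeasure_point_measure[OF A]]) auto
  then show "(\<lambda>z. emeasure (factor_map z) A) \<in> borel_measurable ?X"
    by (rule measurable_cong[THEN iffD1, rotated]) (simp add: factor_map_def emeasure_empty_config)
qed

lemma factor_map_law: "distr (labels \<Otimes>\<^sub>M \<kappa>s) (traj_configs E) factor_map = \<kappa>"
proof -
  note meas_fm = measurable_factor_map[unfolded traj_configs_def]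
  note meas_ZW = measurable_ZW[unfolded traj_configs_def]
  interpret PS: prob_space "labels \<Otimes>\<^sub>M \<kappa>s" by (rule prob_space_pair)
  have count_meas: "{z \<in> space X. \<forall>D\<in>\<D>. emeasure (Z z) D = of_nat (k D)} \<in> sets X"
    if "finite \<D>" "\<D> \<subseteq> cell_sets" "Z \<in> measurable X (point_measure_space ltraj F)" for \<D> X Z F k
  proof -
    have "{\<omega> \<in> point_measures ltraj F. \<forall>D\<in>\<D>. emeasure \<omega> D = of_nat (k D)} \<in> sets (point_measure_space ltraj F)"
      using that(1,2) by (intro sets_counts) (auto simp: cell_sets_def)
    from measurable_sets[OF that(3) this]
    have "Z -` {\<omega> \<in> point_measures ltraj F. \<forall>D\<in>\<D>. emeasure \<omega> D = of_nat (k D)} \<inter> space X \<in> sets X" .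
    also have "Z -` {\<omega> \<in> point_measures ltraj F. \<forall>D\<in>\<D>. emeasure \<omega> D = of_nat (k D)} \<inter> space X =
        {z \<in> space X. \<forall>D\<in>\<D>. emeasure (Z z) D = of_nat (k D)}"
      using measurable_space[OF that(3)] by auto
    finally show ?thesis .
  qed
  show ?thesis
    unfolding traj_configs_def
  proof (rule point_measure_eqI)
    show "prob_space (distr (labels \<Otimes>\<^sub>M PiM UNIV (\<lambda>_. distr P (point_measure_space ltraj (hit_boxes E)) ZW))
        (point_measure_space ltraj (hit_boxes E)) factor_map)"
      using PS.prob_space_distr[OF measurable_factor_map] by (simp only: traj_configs_def)
    show "prob_space (distr P (point_measure_space ltraj (hit_boxes E)) ZW)"
      using prob_space_\<kappa> by (simp only: traj_configs_def)
    show "emeasure \<omega> (cell c) < \<infinity>" if "\<omega> \<in> point_measures ltraj (hit_boxes E)" for \<omega> c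
      using that emeasure_cell_config by (simp add: space_traj_configs)
    fix \<D> and k :: "((int \<Rightarrow> 'v) \<times> real) set \<Rightarrow> nat"
    assume \<D>: "finite \<D>" "disjoint \<D>" "\<D> \<subseteq> cell_sets"
    have "emeasure (labels \<Otimes>\<^sub>M \<kappa>s) {z \<in> space (labels \<Otimes>\<^sub>M \<kappa>s). \<forall>D\<in>\<D>. emeasure (factor_map z) D = of_nat (k D)} =
        emeasure (labels \<Otimes>\<^sub>M \<kappa>s) {z \<in> space (labels \<Otimes>\<^sub>M \<kappa>s). \<forall>D\<in>\<D>. emeasure (assemble (fst z) (snd z)) D = of_nat (k D)}"
    proof (rule emeasure_eq_AE)
      show "AE z in labels \<Otimes>\<^sub>M \<kappa>s. z \<in> {z \<in> space (labels \<Otimes>\<^sub>M \<kappa>s). \<forall>D\<in>\<D>. emeasure (factor_map z) D = of_nat (k D)} \<longleftrightarrow>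
          z \<in> {z \<in> space (labels \<Otimes>\<^sub>M \<kappa>s). \<forall>D\<in>\<D>. emeasure (assemble (fst z) (snd z)) D = of_nat (k D)}"
        using AE_assemble_good by eventually_elim (simp add: factor_map_def)
    next
      show "{z \<in> space (labels \<Otimes>\<^sub>M \<kappa>s). \<forall>D\<in>\<D>. emeasure (factor_map z) D = of_nat (k D)} \<in> sets (labels \<Otimes>\<^sub>M \<kappa>s)"
        unfolding traj_configs_def by (rule count_meas[OF \<D>(1,3) meas_fm])
      show "{z \<in> space (labels \<Otimes>\<^sub>M \<kappa>s). \<forall>D\<in>\<D>. emeasure (assemble (fst z) (snd z)) D = of_nat (k D)} \<in> sets (labels \<Otimes>\<^sub>M \<kappa>s)"
        by (rule count_meas[OF \<D>(1,3) measurable_assemble_pair])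
    qed
    then have "emeasure (labels \<Otimes>\<^sub>M \<kappa>s) {z \<in> space (labels \<Otimes>\<^sub>M \<kappa>s). \<forall>D\<in>\<D>. emeasure (factor_map z) D = of_nat (k D)} =
        emeasure P {\<xi> \<in> space P. \<forall>D\<in>\<D>. emeasure (ZW \<xi>) D = of_nat (k D)}"
      using assemble_fdd[OF \<D>] ZW_fdd[OF \<D>] by simp
    then show "emeasure (distr (labels \<Otimes>\<^sub>M PiM UNIV (\<lambda>_. distr P (point_measure_space ltraj (hit_boxes E)) ZW))
          (point_measure_space ltraj (hit_boxes E)) factor_map)
          {\<omega> \<in> point_measures ltraj (hit_boxes E). \<forall>D\<in>\<D>. emeasure \<omega> D = of_nat (k D)} =
        emeasure (distr P (point_measure_space ltraj (hit_boxes E)) ZW)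
          {\<omega> \<in> point_measures ltraj (hit_boxes E). \<forall>D\<in>\<D>. emeasure \<omega> D = of_nat (k D)}"
      by (simp only: emeasure_distr_counts[OF meas_fm \<D>(1,3)] emeasure_distr_counts[OF meas_ZW \<D>(1,3)] traj_configs_def)
  qed simp_all
qed

theorem traj_configs_factor_of_iid:
  "factor_of_iid (graph_Aut E) (act_traj_config E) (traj_configs E) \<kappa>"
proof -
  obtain c :: "real \<times> ((int \<Rightarrow> 'v) \<times> real) measure \<Rightarrow> nat \<Rightarrow> real"
    where c: "inj_on c (UNIV \<times> point_measures ltraj (hit_boxes E))"
    using ex_inj_label_code[OF countable_V] by blast
  have "space (unit_uniform \<Otimes>\<^sub>M \<kappa>) = UNIV \<times> point_measures ltraj (hit_boxes E)"
    by (simp add: space_pair_measure space_traj_configs unit_uniform_def)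
  with c have "inj_on c (space (unit_uniform \<Otimes>\<^sub>M \<kappa>))" by simp
  then show ?thesis
    by (rule factor_of_iid_pairI[OF prob_space_unit_uniform prob_space_\<kappa> _ measurable_factor_map _ factor_map_law])
      (simp add: factor_map_act)
qed

text \<open>The mapping property of Poisson processes: a count of the projection is the count of
  \<open>ZW\<close> on the preimage, and preimages preserve both disjointness and intensity.\<close>

lemma proj_poisson:
  assumes \<nu>: "sets \<nu> = sets (class_space E)"
    and Q: "\<And>A. A \<in> sets (class_space E) \<Longrightarrow> emeasure \<nu> A = emeasure Q (traj_proj E -` A \<inter> traj E)"
  shows "poisson_point_process P (class_configs E) (\<nu> \<Otimes>\<^sub>M halfline) (\<lambda>\<xi>. proj_config E (ZW \<xi>))"
proof -
  let ?f = "\<lambda>(w, t). (traj_proj E w, t)"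
  have "distr Q (class_space E) (traj_proj E) = \<nu>"
    by (rule measure_eqI)
      (simp_all add: \<nu> Q emeasure_distr measurable_Q measurable_traj_proj space_Q)
  then have distr: "distr \<mu> (labelled_class_space E) ?f = \<nu> \<Otimes>\<^sub>M halfline"
    using distr_map_label[OF measurable_traj_proj] by (simp add: labelled_class_space_def)
  have sets: "sets (\<nu> \<Otimes>\<^sub>M halfline) = sets (labelled_class_space E)"
    unfolding labelled_class_space_def by (intro sets_pair_measure_cong \<nu> refl)
  define pre where "pre A = {p \<in> space ltraj. ?f p \<in> A}" for A
  have pre_sets: "pre A \<in> sets \<mu>" if "A \<in> sets (\<nu> \<Otimes>\<^sub>M halfline)" for A
    using measurable_sets[OF measurable_labelled_proj, of A E] that
    unfolding sets sets_\<mu> pre_def by (simp add: vimage_def Int_def conj_commute)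
  have em: "emeasure (\<nu> \<Otimes>\<^sub>M halfline) A = emeasure \<mu> (pre A)" if "A \<in> sets (\<nu> \<Otimes>\<^sub>M halfline)" for A
  proof -
    have m: "?f \<in> measurable \<mu> (labelled_class_space E)"
      using measurable_labelled_proj by (simp add: measurable_cong_sets[OF sets_\<mu> refl])
    have sp: "space \<mu> = space ltraj" by (rule sets_eq_imp_space_eq[OF sets_\<mu>])
    have "emeasure (\<nu> \<Otimes>\<^sub>M halfline) A = emeasure \<mu> (?f -` A \<inter> space \<mu>)"
      unfolding distr[symmetric] by (rule emeasure_distr[OF m]) (use that in \<open>simp only: sets\<close>)
    also have "?f -` A \<inter> space \<mu> = pre A" unfolding sp pre_def by auto
    finally show ?thesis .
  qed
  have me: "measure (\<nu> \<Otimes>\<^sub>M halfline) A = measure \<mu> (pre A)" if "A \<in> sets (\<nu> \<Otimes>\<^sub>M halfline)" for A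
    using em[OF that] by (simp add: measure_def)
  have count: "emeasure (proj_config E (ZW \<xi>)) A = emeasure (ZW \<xi>) (pre A)"
    if "\<xi> \<in> space P" "A \<in> sets (\<nu> \<Otimes>\<^sub>M halfline)" for \<xi> A
  proof -
    have "ZW \<xi> \<in> point_measures ltraj (hit_boxes E)"
      using measurable_space[OF measurable_ZW that(1)] by (simp add: space_traj_configs)
    then show ?thesis
      unfolding proj_config_def pre_def
      by (rule emeasure_distr_point_measure[OF _ measurable_labelled_proj]) (use that(2) in \<open>simp only: sets\<close>)
  qed
  have pois: "measure P {\<xi> \<in> space P. emeasure (ZW \<xi>) A = of_nat k} = exp (- measure \<mu> A) * measure \<mu> A ^ k / fact k"
    if "A \<in> sets \<mu>" "emeasure \<mu> A < \<infinity>" for A and k :: nat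
    using poisson that by (simp add: poisson_point_process_def)
  have inf: "AE \<xi> in P. emeasure (ZW \<xi>) A = \<infinity>" if "A \<in> sets \<mu>" "emeasure \<mu> A = \<infinity>" for A
    using poisson that by (simp add: poisson_point_process_def)
  have ind: "ZP.indep_vars (\<lambda>_. borel) (\<lambda>i \<xi>. emeasure (ZW \<xi>) (A i)) J"
    if "finite J" "A ` J \<subseteq> sets \<mu>" "disjoint_family_on A J" for A and J :: "nat set"
    using poisson that by (simp add: poisson_point_process_def)
  show ?thesis
    unfolding poisson_point_process_def
  proof (intro conjI ballI impI allI)
    show "prob_space P" by (rule ZP.prob_space_axioms)
    show "(\<lambda>\<xi>. proj_config E (ZW \<xi>)) \<in> measurable P (class_configs E)"
      by (rule measurable_compose[OF measurable_ZW measurable_proj_config])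
  next
    fix A and k :: nat assume A: "A \<in> sets (\<nu> \<Otimes>\<^sub>M halfline)" "emeasure (\<nu> \<Otimes>\<^sub>M halfline) A < \<infinity>"
    have "{\<xi> \<in> space P. emeasure (proj_config E (ZW \<xi>)) A = of_nat k} = {\<xi> \<in> space P. emeasure (ZW \<xi>) (pre A) = of_nat k}"
      using count A(1) by auto
    then show "measure P {\<xi> \<in> space P. emeasure (proj_config E (ZW \<xi>)) A = of_nat k} =
        exp (- measure (\<nu> \<Otimes>\<^sub>M halfline) A) * measure (\<nu> \<Otimes>\<^sub>M halfline) A ^ k / fact k"
      using pois[OF pre_sets[OF A(1)], of k] A(2) by (simp only: em[OF A(1)] me[OF A(1)])
  next
    fix A assume A: "A \<in> sets (\<nu> \<Otimes>\<^sub>M halfline)" "emeasure (\<nu> \<Otimes>\<^sub>M halfline) A = \<infinity>"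
    have "AE \<xi> in P. emeasure (ZW \<xi>) (pre A) = \<infinity>"
      using inf[OF pre_sets[OF A(1)]] A(2) by (simp only: em[OF A(1)])
    then show "AE \<xi> in P. emeasure (proj_config E (ZW \<xi>)) A = \<infinity>"
      by (rule AE_mp) (rule AE_I2, simp add: count A(1))
  next
    fix J :: "nat set" and A assume J: "finite J" "A ` J \<subseteq> sets (\<nu> \<Otimes>\<^sub>M halfline)" "disjoint_family_on A J"
    have "ZP.indep_vars (\<lambda>_. borel) (\<lambda>i \<xi>. emeasure (ZW \<xi>) (pre (A i))) J"
    proof (rule ind[OF J(1)])
      show "(\<lambda>i. pre (A i)) ` J \<subseteq> sets \<mu>" using J(2) pre_sets by blast
      show "disjoint_family_on (\<lambda>i. pre (A i)) J"
        using J(3) by (auto simp: disjoint_family_on_def pre_def)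
    qed
    moreover have "ZP.indep_vars (\<lambda>_. borel) (\<lambda>i \<xi>. emeasure (proj_config E (ZW \<xi>)) (A i)) J \<longleftrightarrow>
        ZP.indep_vars (\<lambda>_. borel) (\<lambda>i \<xi>. emeasure (ZW \<xi>) (pre (A i))) J"
      using J(2) by (intro ZP.indep_vars_cong_on_space) (auto simp: count)
    ultimately show "ZP.indep_vars (\<lambda>_. borel) (\<lambda>i \<xi>. emeasure (proj_config E (ZW \<xi>)) (A i)) J" by simp
  qed
qed

end

theorem claim1p2:
  fixes E :: "'v set set"
    and \<nu> :: "(int \<Rightarrow> 'v) set measure"
    and Q :: "(int \<Rightarrow> 'v) measure"
    and P :: "'s measure"
    and ZW :: "'s \<Rightarrow> ((int \<Rightarrow> 'v) \<times> real) measure"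
  assumes "infinite (UNIV :: 'v set)"
    and "simple_graph E"
    and "locally_finite_graph E"
    and "connected_graph E"
    and "transitive_graph E"
    and "transient_graph E"
    and "interlacement_intensity E \<nu>"
    and "sets Q = sets (traj_space E)"
    and "\<And>A. A \<in> sets (class_space E) \<Longrightarrow>
           emeasure \<nu> A = emeasure Q (traj_proj E -` A \<inter> traj E)"
    and "\<And>B \<phi>. B \<in> sets (traj_space E) \<Longrightarrow> \<phi> \<in> graph_Aut E \<Longrightarrow>
           emeasure Q B = emeasure Q (act_traj \<phi> ` B)"
    and "poisson_point_process P (traj_configs E) (Q \<Otimes>\<^sub>M halfline) ZW"
  shows "factor_of_iid (graph_Aut E) (act_traj_config E) (traj_configs E)
           (distr P (traj_configs E) ZW) \<and>
         poisson_point_process P (class_configs E) (\<nu> \<Otimes>\<^sub>M halfline)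
           (\<lambda>\<xi>. proj_config E (ZW \<xi>)) \<and>
         factor_of_iid (graph_Aut E) (act_class_config E) (class_configs E)
           (distr P (class_configs E) (\<lambda>\<xi>. proj_config E (ZW \<xi>)))"
proof -
  \<comment> \<open>Any vertex may serve as the root, since by transitivity every other vertex is
    reached from it by an automorphism.\<close>
  fix root :: 'v
  interpret trajectory_poisson E root Q P ZW
    by unfold_locales (fact assms | (rule assms(10), assumption+))+
  have \<nu>: "sets \<nu> = sets (class_space E)"
    using assms(7) by (simp add: interlacement_intensity_def)
  note fact_W = traj_configs_factor_of_iid
  have "factor_of_iid (graph_Aut E) (act_class_config E) (class_configs E)
      (distr (distr P (traj_configs E) ZW) (class_configs E) (proj_config E))"
    by (rule factor_of_iid_image[OF fact_W measurable_proj_config]) (rule proj_config_act)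
  also have "distr (distr P (traj_configs E) ZW) (class_configs E) (proj_config E) =
      distr P (class_configs E) (\<lambda>\<xi>. proj_config E (ZW \<xi>))"
    by (simp add: distr_distr[OF measurable_proj_config measurable_ZW] comp_def)
  finally show ?thesis
    using fact_W proj_poisson[OF \<nu> assms(9)] by simp
qed

end
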